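(* Let $f(x)=\mathbb{E}_\xi[f(x,\xi)]$ be convex and $L_0$-Lipschitz continuous on $\mathbb{R}^d$, with minimizer $x^*$. Suppose that $f(\cdot,\xi)$ is $L$-smooth and that for all $x\in\mathbb{R}^d$, $\mathbb{E}_\xi[(f(x,\xi)-f(x))^2]\le\sigma_0^2$ and $\mathbb{E}_\xi[\|\nabla f(x,\xi)-\nabla f(x)\|^2]\le\sigma_1^2$, where $\sigma_0,\sigma_1>0$. Assume that the iteration number satisfies $$T\ge\max\left\{\frac{20^{3/2}L\|x_1-x^*\|^2}{\sigma_0d^4},\ \frac{L_0^2\|x_1-x^*\|^2}{\sigma_0^2},\ \frac{2^{7/2}Ld^{1/2}\|x_1-x^*\|^2}{\sigma_0},\ \frac{L_0^2}{4\sigma_1^2}\right\}.$$ Run the stochastic one-point residual feedback algorithm from $x_1$ for $T$ iterations with $$\alpha=4\left(\frac{d\|x_1-x^*\|\sigma_0}{L}\right)^{1/3}\frac{1}{T^{1/6}},\qquad \eta=\frac{\alpha\|x_1-x^*\|}{8\sqrt T\,d\sigma_0}.$$ Let $\varepsilon>0$. To find an $\varepsilon$-suboptimal solution, the sample complexity of the algorithm is $$T=\max\left\{\frac{12^3\,Ld^2\|x_1-x^*\|^2\sigma_0^2}{\varepsilon^3},\ \frac{2^{21/2}\,d^{1/2}\|x_1-x^*\|^2\sigma_1^3}{L^{1/2}\sigma_0\varepsilon^{3/2}}\right\},$$ that is, $\frac1T\sum_{t=1}^T\mathbb{E}[f(x_t)-f(x^* )]\le\varepsilon$ whenever $T$ satisfies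 the condition above and is at least this quantity.
   Context: $\|\cdot\|$ is the Euclidean norm on $\mathbb{R}^d$, $d\ge1$. A function $f$ is $L_0$-Lipschitz continuous ($L_0>0$) if $|f(x)-f(y)|\le L_0\|x-y\|$ for all $x,y$; it is $L$-smooth ($L>0$) if it is differentiable and $\|\nabla f(x)-\nabla f(y)\|\le L\|x-y\|$ for all $x,y$. $\xi$ is a random variable and $f(\cdot,\xi)$ is the random objective; "$f(\cdot,\xi)$ is $L$-smooth" means smooth in the first variable for every $\xi$, and $\nabla$ is the gradient in $x$. $x^*$ denotes a minimizer of $f$ over $\mathbb{R}^d$. Stochastic one-point residual feedback algorithm: given $x_1\in\mathbb{R}^d$, step size $\eta>0$, smoothing parameter $\alpha>0$ and iteration number $T$, set $x_0=x_1$, let $u_0,\dots,u_T$ be independent and uniformly distributed on the unit sphere of $\mathbb{R}^d$, let $\xi_0,\dots,\xi_T$ be independent copies of $\xi$, independent of the $u_t$, and for $t=1,\dots,T$ put $$\tilde g_t=d\cdot\frac{f(x_t+\alpha u_t,\xi_t)-f(x_{t-1}+\alpha u_{t-1},\xi_{t-1})}{\alpha}\,u_t,\qquad x_{t+1}=x_t-\eta\tilde g_t .$$ Each iteration uses one new function evaluation, so the number of iterations is the sample complexity. Expectations $\mathbb{E}$ are over all the $u_t,\xi_t$. *)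

theory Defs
  imports "HOL-Probability.Probability"
begin

definition gradient :: "('a::real_inner \<Rightarrow> real) \<Rightarrow> 'a \<Rightarrow> 'a" where
  "gradient f x = (THE g. GDERIV f x :> g)"

definition smooth :: "real \<Rightarrow> ('a::real_inner \<Rightarrow> real) \<Rightarrow> bool" where
  "smooth L f \<longleftrightarrow>
     (\<forall>x. f differentiable (at x)) \<and>
     (\<forall>x y. norm (gradient f x - gradient f y) \<le> L * norm (x - y))"

(* The normalised surface measure of the unit sphere, in its polar-coordinates form:
   the measure of a Borel set A of directions is the fraction of the volume of the unit
   ball lying in the cone over A.  For dimension 1 this is the uniform law on {-1, 1}. *)
definition uniform_sphere :: "'a::euclidean_space measure" where
  "uniform_sphere = distr (uniform_measure lborel (ball 0 1)) borel (\<lambda>v. v /\<^sub>R norm v)"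

(* Independence of two random variables whose value types may differ; the library's
   indep_var requires both to take values in the same type. *)
definition indep_rv ::
  "'w measure \<Rightarrow> 'b measure \<Rightarrow> ('w \<Rightarrow> 'b) \<Rightarrow> 'c measure \<Rightarrow> ('w \<Rightarrow> 'c) \<Rightarrow> bool"
where
  "indep_rv M S X S' Y \<longleftrightarrow>
     X \<in> measurable M S \<and> Y \<in> measurable M S' \<and>
     prob_space.indep_set M
       {X -` A \<inter> space M | A. A \<in> sets S}
       {Y -` A \<inter> space M | A. A \<in> sets S'}"

definition residual_estimate ::
  "('a::euclidean_space \<Rightarrow> 'z \<Rightarrow> real) \<Rightarrow> real \<Rightarrow> 'a \<Rightarrow> 'a \<Rightarrow> 'z \<Rightarrow> 'a \<Rightarrow> 'a \<Rightarrow> 'z \<Rightarrow> 'a"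
where
  "residual_estimate F \<alpha> x u z x' u' z' =
     (real DIM('a) * ((F (x + \<alpha> *\<^sub>R u) z - F (x' + \<alpha> *\<^sub>R u') z') / \<alpha>)) *\<^sub>R u"

(* The iterates x_0 = x_1, x_2, x_3, ... for one realisation u, z of the random directions
   and of the random samples. *)
fun residual_iterate ::
  "('a::euclidean_space \<Rightarrow> 'z \<Rightarrow> real) \<Rightarrow> real \<Rightarrow> real \<Rightarrow> 'a \<Rightarrow> (nat \<Rightarrow> 'a) \<Rightarrow> (nat \<Rightarrow> 'z) \<Rightarrow> nat \<Rightarrow> 'a"
where
  "residual_iterate F \<alpha> \<eta> x1 u z 0 = x1"
| "residual_iterate F \<alpha> \<eta> x1 u z (Suc 0) = x1"
| "residual_iterate F \<alpha> \<eta> x1 u z (Suc (Suc t)) =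
     residual_iterate F \<alpha> \<eta> x1 u z (Suc t) - \<eta> *\<^sub>R
       residual_estimate F \<alpha>
         (residual_iterate F \<alpha> \<eta> x1 u z (Suc t)) (u (Suc t)) (z (Suc t))
         (residual_iterate F \<alpha> \<eta> x1 u z t) (u t) (z t)"

end

theory Submission
  imports Defs
begin

text \<open>Write \<open>p x\<close> for the mean of the gradient of \<open>f\<close> over the ball of radius \<open>\<alpha>\<close> around \<open>x\<close>, and
\<open>d\<close> for the dimension. The squared distance of the iterates to the minimizer telescopes, so the regret is
controlled by two conditional moments of the estimator: its mean and its second moment.

The mean is \<open>p (x t)\<close>: averaging \<open>(d / \<alpha>) f (x + \<alpha> u) u\<close> over the sphere gives the ball average of the
gradient, by the divergence theorem on the ball (\<open>integral_gradient_ball\<close>). Convexity and smoothness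
together make the resulting descent inequality stronger than convexity alone does: up to the smoothing bias
\<open>L \<alpha>\<^sup>2 / 2\<close>, the inner product of \<open>p x\<close> with \<open>x - xstar\<close> exceeds the gap \<open>f x - f xstar\<close> by
\<open>(norm (p x))\<^sup>2 / (2 L)\<close> (\<open>ball_gradient_descent\<close>). This surplus pays for the gradient part of the
second moment.

The estimator is a difference of two consecutive values. Its square splits into three contributions. The
sampling noise contributes a multiple of \<open>\<sigma>0\<^sup>2\<close>. The sphere mean of \<open>f\<close> moves by at most
\<open>L0\<close> times the length of the previous step, that is, by a multiple of the previous estimator, and the lower
bound on \<open>T\<close> in terms of \<open>L0\<close> makes this recursion a contraction. The fluctuation of \<open>f\<close> on the
sphere around \<open>x\<close> has variance at most \<open>(\<alpha>\<^sup>2 / d) ((norm (p x))\<^sup>2 + 5/8 L\<^sup>2 \<alpha>\<^sup>2)\<close>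
(\<open>sphere_variance_bound\<close>). The factor \<open>1 / d\<close> is essential here, because the estimator multiplies
by \<open>d\<^sup>2\<close>. For the linear part of \<open>f\<close> it is a computation; the nonlinear part has a gradient of
order \<open>L \<alpha>\<close>, and a Poincare inequality on the sphere (\<open>sphere_poincare\<close>) supplies the factor.
Summing everything gives \<open>regret_bound\<close>.

With the prescribed step size and smoothing parameter every term of the regret bound is a multiple of
\<open>L \<alpha>\<^sup>2\<close>, the multiples add up to less than \<open>3/4\<close>, and \<open>3/4 L \<alpha>\<^sup>2 \<le> \<epsilon>\<close> is what the
first of the two sample complexities says (\<open>step_size_calculus\<close>).\<close>

section \<open>Uniform distributions on the ball and the sphere\<close>

abbreviation uniform_ball :: "'a::euclidean_space measure" where
  "uniform_ball \<equiv> uniform_measure lborel (ball 0 1)"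

lemma emeasure_unit_ball:
  "emeasure lborel (ball 0 1 :: 'a::euclidean_space set) \<noteq> 0"
  "emeasure lborel (ball 0 1 :: 'a::euclidean_space set) \<noteq> \<infinity>"
proof -
  show "emeasure lborel (ball 0 1 :: 'a set) \<noteq> 0"
    using content_ball_pos[of 1 "0::'a"] by (auto simp: measure_def)
  show "emeasure lborel (ball 0 1 :: 'a set) \<noteq> \<infinity>"
    using emeasure_lborel_ball_finite[of 0 1] by (simp add: less_top)
qed

lemma prob_space_uniform_ball: "prob_space (uniform_ball :: 'a::euclidean_space measure)"
  by (rule prob_space_uniform_measure) (use emeasure_unit_ball in auto)

lemma prob_space_uniform_sphere: "prob_space (uniform_sphere :: 'a::euclidean_space measure)"
  unfolding uniform_sphere_def
  by (rule prob_space.prob_space_distr[OF prob_space_uniform_ball]) measurable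

lemma sets_uniform_sphere [simp, measurable_cong]: "sets uniform_sphere = sets borel"
  by (simp add: uniform_sphere_def)

lemma space_uniform_sphere [simp]: "space uniform_sphere = UNIV"
  by (simp add: uniform_sphere_def)

lemma AE_uniform_ball: "AE v in (uniform_ball :: 'a::euclidean_space measure). norm v < 1 \<and> v \<noteq> 0"
proof -
  have "AE v in (lborel :: 'a measure). v \<noteq> 0"
    by (rule AE_lborel_singleton)
  then show ?thesis
    by (subst AE_uniform_measure) (use emeasure_unit_ball in \<open>auto simp: less_top\<close>)
qed

lemma AE_uniform_sphere: "AE u in (uniform_sphere :: 'a::euclidean_space measure). norm u = 1"
  unfolding uniform_sphere_def
  by (subst AE_distr_iff) (use AE_uniform_ball in \<open>auto elim!: eventually_mono\<close>)

lemma integral_uniform_sphere: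
  fixes h :: "'a::euclidean_space \<Rightarrow> real"
  assumes [measurable]: "h \<in> borel_measurable borel"
  shows "(\<integral>u. h u \<partial>uniform_sphere) = (\<integral>v. h (v /\<^sub>R norm v) \<partial>uniform_ball)"
  unfolding uniform_sphere_def by (rule integral_distr) measurable

text \<open>The law of the direction charges only unit vectors, so a bound on the unit sphere suffices, whatever the
function does elsewhere.\<close>

lemma integrable_uniform_sphere_bounded:
  fixes h :: "'a::euclidean_space \<Rightarrow> real"
  assumes [measurable]: "h \<in> borel_measurable borel" and B: "\<And>u. norm u = 1 \<Longrightarrow> \<bar>h u\<bar> \<le> B"
  shows "integrable uniform_sphere h"
proof -
  interpret prob_space "uniform_sphere :: 'a measure" by (rule prob_space_uniform_sphere)
  show ?thesis
    by (rule integrable_const_bound[where B = B])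
       (use AE_uniform_sphere in \<open>auto elim!: eventually_mono simp: B\<close>)
qed

lemma integrable_uniform_ball_bounded:
  fixes h :: "'a::euclidean_space \<Rightarrow> real"
  assumes [measurable]: "h \<in> borel_measurable borel" and B: "\<And>v. norm v < 1 \<Longrightarrow> \<bar>h v\<bar> \<le> B"
  shows "integrable uniform_ball h"
proof -
  interpret prob_space "uniform_ball :: 'a measure" by (rule prob_space_uniform_ball)
  show ?thesis
    by (rule integrable_const_bound[where B = B])
       (use AE_uniform_ball in \<open>auto elim!: eventually_mono simp: B\<close>)
qed

text \<open>Dilation by \<open>r\<close> maps the part of the unit ball inside a cone onto the part of radius less than \<open>r\<close>
and scales volume by \<open>r ^ DIM('a)\<close>. Since the factor does not depend on the cone, norm and direction of
a uniform point of the ball are independent.\<close>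

lemma emeasure_uniform_ball_cone:
  fixes B :: "'a::euclidean_space set"
  assumes [measurable]: "B \<in> sets borel" and r: "0 < r" "r \<le> 1"
  shows "emeasure uniform_ball {v. norm v < r \<and> v /\<^sub>R norm v \<in> B}
       = ennreal (r ^ DIM('a)) * emeasure uniform_ball {v. v /\<^sub>R norm v \<in> B}"
proof -
  let ?C = "{v::'a. norm v < r \<and> v /\<^sub>R norm v \<in> B}" and ?D = "{v::'a. norm v < 1 \<and> v /\<^sub>R norm v \<in> B}"
  have D: "(\<lambda>x. 0 + r *\<^sub>R x) -` ?C = ?D"
  proof (rule set_eqI)
    fix v :: 'a
    have "(r *\<^sub>R v) /\<^sub>R norm (r *\<^sub>R v) = v /\<^sub>R norm v"
      using r by (cases "v = 0") (simp_all add: field_simps)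
    moreover have "norm (r *\<^sub>R v) < r \<longleftrightarrow> norm v < 1"
      using r by simp
    ultimately show "v \<in> (\<lambda>x. 0 + r *\<^sub>R x) -` ?C \<longleftrightarrow> v \<in> ?D"
      by (simp only: vimage_eq mem_Collect_eq add_0_left)
  qed
  have "emeasure lborel ?C = emeasure (density (distr lborel borel (\<lambda>x. 0 + r *\<^sub>R x)) (\<lambda>_. ennreal (\<bar>r\<bar> ^ DIM('a)))) ?C"
    using lborel_affine[of r "0::'a"] r by simp
  also have "\<dots> = ennreal (r ^ DIM('a)) * emeasure (distr lborel borel (\<lambda>x. 0 + r *\<^sub>R x)) ?C"
    using r by (simp add: emeasure_density nn_integral_cmult_indicator)
  also have "emeasure (distr lborel borel (\<lambda>x. 0 + r *\<^sub>R x)) ?C = emeasure lborel ?D"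
    unfolding D[symmetric] by (subst emeasure_distr) (simp_all only: space_lborel Int_UNIV_right, measurable)
  finally have *: "emeasure lborel ?C = ennreal (r ^ DIM('a)) * emeasure lborel ?D" .
  have "ball 0 1 \<inter> ?C = ?C" "ball 0 1 \<inter> {v. v /\<^sub>R norm v \<in> B} = ?D"
    using r by (auto simp: dist_norm)
  then show ?thesis
    using * by (simp add: ennreal_times_divide)
qed

lemma prob_uniform_ball_less:
  assumes "0 < r" "r \<le> 1"
  shows "measure (uniform_ball :: 'a::euclidean_space measure) {v. norm v < r} = r ^ DIM('a)"
proof -
  interpret prob_space "uniform_ball :: 'a measure" by (rule prob_space_uniform_ball)
  show ?thesis
    using emeasure_uniform_ball_cone[of "UNIV :: 'a set" r] assms emeasure_space_1
    by (simp add: measure_def)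
qed

text \<open>Independence is checked on the generators \<open>norm v < r\<close> and \<open>v /\<^sub>R norm v \<in> B\<close>, both closed under
intersection.\<close>

lemma indep_norm_direction:
  "prob_space.indep_set uniform_ball
     (sigma_sets UNIV {norm -` A |A. A \<in> sets (borel :: real measure)})
     (sigma_sets UNIV {(\<lambda>v::'a::euclidean_space. v /\<^sub>R norm v) -` B |B. B \<in> sets borel})"
proof -
  interpret prob_space "uniform_ball :: 'a measure" by (rule prob_space_uniform_ball)
  let ?U = "\<lambda>v::'a. v /\<^sub>R norm v"
  let ?A = "{{v::'a. norm v < r} |r. True}" and ?B = "{?U -` B |B. B \<in> sets borel}"
  have sA: "?A \<subseteq> events" by auto
  have sB: "?B \<subseteq> events"
  proof safe
    fix B :: "'a set" assume [measurable]: "B \<in> sets borel"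
    have "?U -` B \<inter> space borel \<in> sets borel" by (rule measurable_sets[of _ _ borel]) measurable
    then show "?U -` B \<in> events" by simp
  qed
  have prod: "prob ({v. norm v < r} \<inter> ?U -` B) = prob {v. norm v < r} * prob (?U -` B)"
    if [measurable]: "B \<in> sets borel" for r B
  proof -
    consider "r \<le> 0" | "0 < r" "r \<le> 1" | "1 < r" by linarith
    then show ?thesis
    proof cases
      case 1
      then have "{v::'a. norm v < r} = {}"
        by (auto simp: not_less intro: order_trans)
      then show ?thesis by (metis Int_empty_left measure_empty mult_zero_left)
    next
      case 2
      then show ?thesis
        using emeasure_uniform_ball_cone[of B r] prob_uniform_ball_less[where ?'a = 'a, of r]
        by (simp add: measure_def Int_def vimage_def enn2real_mult del: emeasure_uniform_measure)
    next
      case 3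
      have U: "?U -` B \<in> events" using sB that by blast
      have "prob {v. norm v < r} = 1"
        by (subst prob_eq_1) (use AE_uniform_ball 3 in \<open>auto elim!: eventually_mono\<close>)
      moreover have "prob ({v. norm v < r} \<inter> ?U -` B) = prob (?U -` B)"
      proof (rule finite_measure_eq_AE)
        show "AE x in uniform_ball. x \<in> {v. norm v < r} \<inter> ?U -` B \<longleftrightarrow> x \<in> ?U -` B"
          using AE_uniform_ball by eventually_elim (use 3 in auto)
      qed (use U in \<open>auto intro!: sets.Int\<close>)
      ultimately show ?thesis by simp
    qed
  qed
  have "indep_set ?A ?B"
    unfolding indep_sets2_eq
    using sA sB prod by auto
  moreover have "Int_stable ?A"
    by (rule Int_stableI) (auto simp: set_eq_iff, metis min_less_iff_conj)
  moreover have "Int_stable ?B"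
    by (rule Int_stableI) (auto, metis sets.Int vimage_Int)
  ultimately have "indep_set (sigma_sets UNIV ?A) (sigma_sets UNIV ?B)"
    using indep_set_sigma_sets[of ?A ?B] by simp
  moreover have "sigma_sets UNIV ?A = sigma_sets UNIV {norm -` A |A. A \<in> sets (borel :: real measure)}"
  proof (rule sigma_sets_eqI)
    fix a assume "a \<in> ?A"
    then obtain r where "a = norm -` {..<r}" by auto
    then show "a \<in> sigma_sets UNIV {norm -` A |A. A \<in> sets (borel :: real measure)}"
      by (intro sigma_sets.Basic) (auto intro!: exI[of _ "{..<r}"])
  next
    fix b assume "b \<in> {(norm :: 'a \<Rightarrow> real) -` A |A. A \<in> sets (borel :: real measure)}"
    then obtain A where b: "b = norm -` A" and A: "A \<in> sets (borel :: real measure)" by auto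
    have "A \<in> sigma_sets UNIV (range lessThan)"
      using A unfolding borel_Iio by (simp add: sets_measure_of)
    then have "(norm :: 'a \<Rightarrow> real) -` A \<inter> UNIV \<in> sigma_sets UNIV {norm -` X \<inter> UNIV |X. X \<in> range lessThan}"
      using sigma_sets_vimage_commute[of norm UNIV UNIV "range lessThan"] by auto
    moreover have "{(norm :: 'a \<Rightarrow> real) -` X \<inter> UNIV |X. X \<in> range lessThan} = (\<lambda>r. norm -` {..<r}) ` UNIV"
      by auto
    moreover have "\<dots> = ?A" by (auto simp: vimage_def)
    ultimately show "b \<in> sigma_sets UNIV ?A" using b by auto
  qed
  ultimately show ?thesis by simp
qed

text \<open>Integration in polar coordinates, in the form in which it is used: a function of the norm times a function of
the direction factorizes.\<close>

lemma integral_polar: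
  fixes a :: "real \<Rightarrow> real" and k :: "'a::euclidean_space \<Rightarrow> real"
  assumes [measurable]: "a \<in> borel_measurable borel" "k \<in> borel_measurable borel"
    and a: "\<And>r. 0 \<le> r \<Longrightarrow> r < 1 \<Longrightarrow> \<bar>a r\<bar> \<le> A" and k: "\<And>u. norm u = 1 \<Longrightarrow> \<bar>k u\<bar> \<le> K"
  shows "(\<integral>v. a (norm v) * k (v /\<^sub>R norm v) \<partial>uniform_ball)
       = (\<integral>v. a (norm (v::'a)) \<partial>uniform_ball) * (\<integral>u. k u \<partial>uniform_sphere)"
proof -
  interpret prob_space "uniform_ball :: 'a measure" by (rule prob_space_uniform_ball)
  let ?U = "\<lambda>v::'a. v /\<^sub>R norm v"
  let ?N = "sigma_sets UNIV {norm -` A |A. A \<in> sets (borel :: real measure)} :: 'a set set"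
  let ?D = "sigma_sets UNIV {?U -` B |B. B \<in> sets borel}"
  have "indep_var borel (\<lambda>v::'a. a (norm v)) borel (\<lambda>v. k (?U v))"
    unfolding indep_var_eq
  proof (intro conjI)
    show "random_variable borel (\<lambda>v::'a. a (norm v))" "random_variable borel (\<lambda>v. k (?U v))"
      by measurable
    have "sigma_sets (space uniform_ball) {(\<lambda>v::'a. a (norm v)) -` A \<inter> space uniform_ball |A. A \<in> sets borel} \<subseteq> ?N"
      unfolding space_uniform_measure space_lborel space_borel
    proof (rule sigma_sets_mono, rule subsetI)
      fix X assume "X \<in> {(\<lambda>v::'a. a (norm v)) -` A \<inter> UNIV |A. A \<in> sets borel}"
      then obtain A where A[measurable]: "A \<in> sets borel" and X: "X = (\<lambda>v::'a. a (norm v)) -` A" by auto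
      have "a -` A \<inter> space borel \<in> sets borel" by measurable
      then show "X \<in> ?N" unfolding X by (intro sigma_sets.Basic) (auto intro!: exI[of _ "a -` A"])
    qed
    moreover have "sigma_sets (space uniform_ball) {(\<lambda>v::'a. k (?U v)) -` A \<inter> space uniform_ball |A. A \<in> sets borel} \<subseteq> ?D"
      unfolding space_uniform_measure space_lborel space_borel
    proof (rule sigma_sets_mono, rule subsetI)
      fix X assume "X \<in> {(\<lambda>v::'a. k (?U v)) -` A \<inter> UNIV |A. A \<in> sets borel}"
      then obtain A where A[measurable]: "A \<in> sets borel" and X: "X = (\<lambda>v::'a. k (?U v)) -` A" by auto
      have "k -` A \<inter> space borel \<in> sets borel" by measurable
      then show "X \<in> ?D" unfolding X by (intro sigma_sets.Basic) (auto intro!: exI[of _ "k -` A"])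
    qed
    ultimately show "indep_set (sigma_sets (space uniform_ball) {(\<lambda>v::'a. a (norm v)) -` A \<inter> space uniform_ball |A. A \<in> sets borel})
       (sigma_sets (space uniform_ball) {(\<lambda>v::'a. k (?U v)) -` A \<inter> space uniform_ball |A. A \<in> sets borel})"
      using indep_norm_direction[where ?'a = 'a] unfolding indep_sets2_eq
      by blast
  qed
  moreover have "integrable uniform_ball (\<lambda>v::'a. a (norm v))"
    by (rule integrable_uniform_ball_bounded[where B = A]) (auto intro: a)
  moreover have "integrable uniform_ball (\<lambda>v. k (?U v))"
    by (rule integrable_const_bound[where B = K])
      (use AE_uniform_ball in \<open>auto elim!: eventually_mono intro!: k\<close>)
  ultimately show ?thesis
    by (simp add: indep_var_lebesgue_integral integral_uniform_sphere)
qed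

lemma uniform_ball_density:
  "uniform_ball = density lborel
     (\<lambda>v::'a::euclidean_space. ennreal (indicator (ball 0 1) v / measure lborel (ball 0 1 :: 'a set)))"
proof -
  define V where "V = measure lborel (ball 0 1 :: 'a set)"
  have V: "emeasure lborel (ball 0 1 :: 'a set) = ennreal V" "V > 0"
    using emeasure_unit_ball[where ?'a = 'a] content_ball_pos[of 1 "0::'a"]
    by (simp_all add: V_def emeasure_eq_ennreal_measure)
  have [measurable]: "(indicator (ball 0 1) :: 'a \<Rightarrow> real) \<in> borel_measurable lborel"
    "(indicator (ball 0 1) :: 'a \<Rightarrow> ennreal) \<in> borel_measurable lborel"
    by (rule borel_measurable_indicator, simp)+
  have "uniform_ball = density lborel (\<lambda>v::'a. ennreal (indicator (ball 0 1) v / V))"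
    unfolding uniform_measure_def V(1)
  proof (rule density_cong)
    show "AE v in lborel. indicator (ball 0 1 :: 'a set) v / ennreal V = ennreal (indicator (ball 0 1) v / V)"
      using V(2) divide_ennreal[of 1 V] by (auto split: split_indicator)
  qed measurable
  then show ?thesis by (simp add: V_def)
qed

lemma integral_uniform_ball:
  fixes h :: "'a::euclidean_space \<Rightarrow> real"
  assumes [measurable]: "h \<in> borel_measurable borel"
  shows "(\<integral>v. h v \<partial>uniform_ball)
       = (\<integral>v. indicator (ball 0 1) v * h v \<partial>lborel) / measure lborel (ball 0 1 :: 'a set)"
proof -
  define V where "V = measure lborel (ball 0 1 :: 'a set)"
  have [measurable]: "(indicator (ball 0 1) :: 'a \<Rightarrow> real) \<in> borel_measurable lborel"
    by (rule borel_measurable_indicator) simp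
  have "(\<integral>v. h v \<partial>uniform_ball) = (\<integral>v. (indicator (ball 0 1) v / V) *\<^sub>R h v \<partial>lborel)"
    unfolding uniform_ball_density V_def[symmetric] by (subst integral_density) (auto simp: V_def)
  also have "\<dots> = (\<integral>v. (indicator (ball 0 1) v * h v) / V \<partial>lborel)"
    by (rule Bochner_Integration.integral_cong) auto
  finally show ?thesis by (simp add: V_def)
qed

section \<open>The divergence theorem on the ball\<close>

lemma tendsto_difference_quotient:
  fixes k :: "real \<Rightarrow> real"
  assumes "(k has_real_derivative D) (at 0)" "X \<longlonglongrightarrow> 0" "\<And>n. X n \<noteq> 0"
  shows "(\<lambda>n. (k (X n) - k 0) / X n) \<longlonglongrightarrow> D"
proof -
  have "((\<lambda>h. (k (0 + h) - k 0) / h) \<longlongrightarrow> D) (at 0)"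
    using assms(1) by (simp add: DERIV_def)
  moreover have "filterlim X (at 0) sequentially"
    using assms(2,3) by (simp add: filterlim_at)
  ultimately show ?thesis
    by (auto dest: filterlim_compose)
qed

text \<open>Lebesgue measure is translation invariant, so the integrals of the difference quotients in the direction
\<open>w\<close> vanish; the Lipschitz bound and the bounded support dominate them.\<close>

lemma integral_directional_derivative_eq_0:
  fixes k k' :: "'a::euclidean_space \<Rightarrow> real"
  assumes lip: "C-lipschitz_on UNIV k" and supp: "\<And>v. norm v \<ge> 1 \<Longrightarrow> k v = 0"
    and [measurable]: "k' \<in> borel_measurable borel"
    and deriv: "AE v in lborel. ((\<lambda>t. k (v + t *\<^sub>R w)) has_real_derivative k' v) (at 0)"
  shows "(\<integral>v. k' v \<partial>lborel) = 0"
proof -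
  define X where "X n = inverse (real (Suc n))" for n
  have X0: "X \<longlonglongrightarrow> 0" unfolding X_def by (rule LIMSEQ_inverse_real_of_nat)
  have Xpos: "X n > 0" and X1: "X n \<le> 1" for n by (auto simp: X_def inverse_le_1_iff)
  have C: "\<bar>k x - k y\<bar> \<le> C * norm (x - y)" "C \<ge> 0" for x y
    using lip by (auto simp: lipschitz_on_def dist_norm)
  have cont: "continuous_on UNIV k" using lip by (rule lipschitz_on_continuous_on)
  then have [measurable]: "k \<in> borel_measurable borel" by (rule borel_measurable_continuous_onI)
  let ?s = "\<lambda>n v. (k (v + X n *\<^sub>R w) - k v) / X n"
  have int_k: "integrable lborel k"
  proof -
    have "integrable lborel (\<lambda>v. indicator (cball 0 1) v *\<^sub>R k v)"
      using cont by (intro borel_integrable_compact) (auto intro: continuous_on_subset)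
    moreover have "indicator (cball 0 1) v *\<^sub>R k v = k v" for v
      using supp[of v] by (auto split: split_indicator)
    ultimately show ?thesis by (metis (no_types, lifting) Bochner_Integration.integrable_cong)
  qed
  have shift: "integrable lborel (\<lambda>v. k (v + c))" "(\<integral>v. k (v + c) \<partial>lborel) = (\<integral>v. k v \<partial>lborel)" for c
  proof -
    have *: "lborel = distr lborel borel ((+) c)" by (simp add: lborel_distr_plus)
    have "integrable (distr lborel borel ((+) c)) k" using int_k * by simp
    then show "integrable lborel (\<lambda>v. k (v + c))" by (subst (asm) integrable_distr_eq) (auto simp: add.commute)
    show "(\<integral>v. k (v + c) \<partial>lborel) = (\<integral>v. k v \<partial>lborel)"
      by (subst (2) *, subst integral_distr) (auto simp: add.commute)
  qed
  have "(\<lambda>n. \<integral>v. ?s n v \<partial>lborel) \<longlonglongrightarrow> (\<integral>v. k' v \<partial>lborel)"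
  proof (rule integral_dominated_convergence)
    show "integrable lborel (\<lambda>v::'a. (C * norm w) * indicator (cball 0 (1 + norm w)) v)"
      using emeasure_bounded_finite[of "cball (0::'a) (1 + norm w)"] by (intro integrable_mult_right integrable_real_indicator) auto
    show "AE v in lborel. (\<lambda>n. ?s n v) \<longlonglongrightarrow> k' v"
      using deriv
    proof eventually_elim
      case (elim v)
      show ?case
        using tendsto_difference_quotient[OF elim X0] Xpos by (simp add: less_imp_neq[symmetric])
    qed
    show "AE v in lborel. norm (?s n v) \<le> (C * norm w) * indicator (cball 0 (1 + norm w)) v" for n
    proof (rule AE_I2)
      fix v
      show "norm (?s n v) \<le> (C * norm w) * indicator (cball 0 (1 + norm w)) v"
      proof (cases "norm v \<le> 1 + norm w")
        case True
        have "\<bar>k (v + X n *\<^sub>R w) - k v\<bar> \<le> C * (X n * norm w)"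
          using C(1)[of "v + X n *\<^sub>R w" v] Xpos[of n] by simp
        then show ?thesis using True Xpos[of n] by (simp add: divide_simps mult_ac)
      next
        case False
        have "norm v \<le> norm (v + X n *\<^sub>R w) + X n * norm w"
          using norm_triangle_ineq4[of "v + X n *\<^sub>R w" "X n *\<^sub>R w"] Xpos[of n] by simp
        moreover have "X n * norm w \<le> norm w" using X1[of n] Xpos[of n] by (simp add: mult_left_le_one_le)
        ultimately have "norm (v + X n *\<^sub>R w) \<ge> 1" "norm v \<ge> 1" using False norm_ge_zero[of w] by linarith+
        then show ?thesis using supp C(2) by simp
      qed
    qed
  qed measurable
  moreover have "(\<integral>v. ?s n v \<partial>lborel) = 0" for n
    using shift[of "X n *\<^sub>R w"] int_k by simp
  ultimately have "(\<lambda>n. 0) \<longlonglongrightarrow> (\<integral>v. k' v \<partial>lborel)"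
    by (simp only:)
  then show ?thesis by (simp add: LIMSEQ_const_iff)
qed

lemma lipschitz_on_mult_bump:
  fixes G \<phi> :: "'a::euclidean_space \<Rightarrow> real"
  assumes G: "\<Lambda>-lipschitz_on UNIV G" and M: "\<And>v. norm v < 1 \<Longrightarrow> \<bar>G v\<bar> \<le> M"
    and \<phi>: "D-lipschitz_on UNIV \<phi>" and supp: "\<And>v. norm v \<ge> 1 \<Longrightarrow> \<phi> v = 0"
    and \<phi>01: "\<And>v. 0 \<le> \<phi> v" "\<And>v. \<phi> v \<le> 1"
  shows "(M * D + \<Lambda>)-lipschitz_on UNIV (\<lambda>v. G v * \<phi> v)"
proof (rule lipschitz_onI)
  have M0: "0 \<le> M" using M[of 0] by simp
  have D0: "0 \<le> D" and L0: "0 \<le> \<Lambda>" using G \<phi> by (auto simp: lipschitz_on_def)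
  show "0 \<le> M * D + \<Lambda>" using M0 D0 L0 by simp
  have *: "\<bar>G x * \<phi> x - G y * \<phi> y\<bar> \<le> (M * D + \<Lambda>) * dist x y" if "norm x < 1" for x y
  proof -
    have "G x * \<phi> x - G y * \<phi> y = G x * (\<phi> x - \<phi> y) + \<phi> y * (G x - G y)"
      by (simp add: algebra_simps)
    then have "\<bar>G x * \<phi> x - G y * \<phi> y\<bar> \<le> \<bar>G x\<bar> * \<bar>\<phi> x - \<phi> y\<bar> + \<phi> y * \<bar>G x - G y\<bar>"
      using \<phi>01(1)[of y] by (simp add: abs_mult abs_triangle_ineq[THEN order_trans])
    also have "\<dots> \<le> M * (D * dist x y) + 1 * (\<Lambda> * dist x y)"
      using M[OF that] \<phi>01[of y] G \<phi> M0 L0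
      by (intro add_mono mult_mono) (auto simp: lipschitz_on_def dist_real_def)
    finally show ?thesis by (simp add: algebra_simps)
  qed
  fix x y :: 'a
  show "dist (G x * \<phi> x) (G y * \<phi> y) \<le> (M * D + \<Lambda>) * dist x y"
  proof (cases "norm x < 1 \<or> norm y < 1")
    case True
    then show ?thesis using *[of x y] *[of y x] by (auto simp: dist_real_def dist_commute abs_minus_commute)
  next
    case False
    then show ?thesis using supp M0 D0 L0 by (simp add: not_less)
  qed
qed

text \<open>A Lipschitz substitute for the indicator function of the unit ball: it descends linearly from \<open>1\<close> to
\<open>0\<close> on the shell between the radii \<open>1 - \<delta>\<close> and \<open>1\<close>.\<close>

definition radial_ramp :: "real \<Rightarrow> 'a::euclidean_space \<Rightarrow> real" where
  "radial_ramp \<delta> v = min 1 (max 0 ((1 - norm v) / \<delta>))"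

lemma radial_ramp_deriv:
  fixes v w :: "'a::euclidean_space"
  assumes \<delta>: "0 < \<delta>" "\<delta> < 1" and v: "norm v \<noteq> 1" "norm v \<noteq> 1 - \<delta>"
  shows "((\<lambda>t. radial_ramp \<delta> (v + t *\<^sub>R w)) has_real_derivative
           (if 1 - \<delta> < norm v \<and> norm v < 1 then - ((v /\<^sub>R norm v) \<bullet> w) / \<delta> else 0)) (at 0)"
proof -
  let ?n = "\<lambda>t. norm (v + t *\<^sub>R w)"
  have tn: "((\<lambda>t. norm (v + t *\<^sub>R w)) \<longlongrightarrow> norm v) (nhds 0)"
  proof -
    have "isCont (\<lambda>t. norm (v + t *\<^sub>R w)) 0" by (intro continuous_intros)
    then show ?thesis
      using tendsto_at_iff_tendsto_nhds[of "\<lambda>t. norm (v + t *\<^sub>R w)" 0] by (simp add: isCont_def)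
  qed
  have const: ?thesis if "eventually (\<lambda>t. radial_ramp \<delta> (v + t *\<^sub>R w) = c) (nhds 0)" 
     "\<not> (1 - \<delta> < norm v \<and> norm v < 1)" for c
  proof -
    have "((\<lambda>t. radial_ramp \<delta> (v + t *\<^sub>R w)) has_real_derivative 0) (at 0)
        \<longleftrightarrow> ((\<lambda>t. c) has_real_derivative 0) (at 0)"
      by (rule DERIV_cong_ev) (use that in auto)
    then show ?thesis using that(2) by auto
  qed
  consider "norm v > 1" | "norm v < 1 - \<delta>" | "1 - \<delta> < norm v" "norm v < 1"
    using v by linarith
  then show ?thesis
  proof cases
    case 1
    have "eventually (\<lambda>t. ?n t > 1) (nhds 0)" using tn 1 by (rule order_tendstoD)
    then have "eventually (\<lambda>t. radial_ramp \<delta> (v + t *\<^sub>R w) = 0) (nhds 0)"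
      by eventually_elim (use \<delta> in \<open>auto simp: radial_ramp_def divide_simps max_def\<close>)
    then show ?thesis using 1 by (intro const) auto
  next
    case 2
    have "eventually (\<lambda>t. ?n t < 1 - \<delta>) (nhds 0)" using tn 2 by (rule order_tendstoD)
    then have "eventually (\<lambda>t. radial_ramp \<delta> (v + t *\<^sub>R w) = 1) (nhds 0)"
      by eventually_elim (use \<delta> in \<open>auto simp: radial_ramp_def divide_simps max_def min_def\<close>)
    then show ?thesis using 2 by (intro const) auto
  next
    case 3
    have "eventually (\<lambda>t. 1 - \<delta> < ?n t \<and> ?n t < 1) (nhds 0)"
      using order_tendstoD[OF tn] 3 by (auto simp: eventually_conj_iff)
    then have ev: "eventually (\<lambda>t. radial_ramp \<delta> (v + t *\<^sub>R w) = (1 - ?n t) / \<delta>) (nhds 0)"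
      by eventually_elim (use \<delta> in \<open>auto simp: radial_ramp_def divide_simps max_def min_def\<close>)
    have v0: "v \<noteq> 0" using 3 \<delta> by auto
    have "(norm has_derivative (\<lambda>h. h \<bullet> sgn v)) (at (v + 0 *\<^sub>R w))"
      using has_derivative_norm[OF v0] by simp
    then have "(?n has_derivative (\<lambda>t. (t *\<^sub>R w) \<bullet> sgn v)) (at 0)"
      by (rule has_derivative_compose[rotated]) (auto intro!: derivative_eq_intros)
    then have "(?n has_real_derivative (w \<bullet> sgn v)) (at 0)"
      unfolding has_field_derivative_def by (rule has_derivative_eq_rhs) (simp add: fun_eq_iff mult.commute)
    then have "((\<lambda>t. (1 - ?n t) / \<delta>) has_real_derivative - (w \<bullet> sgn v) / \<delta>) (at 0)"
      using \<delta> by (auto intro!: derivative_eq_intros)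
    moreover have "w \<bullet> sgn v = (v /\<^sub>R norm v) \<bullet> w" by (simp add: sgn_div_norm inner_commute)
    ultimately show ?thesis
      using DERIV_cong_ev[OF refl ev refl] 3 by simp
  qed
qed

lemma radial_ramp_lipschitz:
  assumes "0 < \<delta>"
  shows "(1 / \<delta>)-lipschitz_on UNIV (radial_ramp \<delta> :: 'a::euclidean_space \<Rightarrow> real)"
proof (rule lipschitz_onI)
  fix x y :: 'a
  have "dist (radial_ramp \<delta> x) (radial_ramp \<delta> y) \<le> \<bar>(1 - norm x) / \<delta> - (1 - norm y) / \<delta>\<bar>"
    unfolding radial_ramp_def dist_real_def by (auto simp: min_def max_def)
  also have "\<dots> = \<bar>norm x - norm y\<bar> / \<delta>"
    using assms by (simp add: diff_divide_distrib[symmetric] abs_minus_commute)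
  also have "\<dots> \<le> norm (x - y) / \<delta>"
    using assms norm_triangle_ineq3[of x y] by (simp add: divide_right_mono)
  finally show "dist (radial_ramp \<delta> x) (radial_ramp \<delta> y) \<le> 1 / \<delta> * dist x y"
    by (simp add: dist_norm)
qed (use assms in simp)

lemma AE_norm_neq: "AE v in (lborel :: 'a::euclidean_space measure). norm v \<noteq> r"
proof -
  have "sphere (0::'a) r \<in> null_sets lborel"
    using negligible_sphere[of "0::'a" r] by (simp add: null_sets_completion_iff negligible_iff_null_sets)
  then have "AE v in (lborel :: 'a measure). v \<notin> sphere 0 r" by (rule AE_not_in)
  then show ?thesis by eventually_elim simp
qed


lemma has_derivative_along_line:
  fixes G :: "'a::euclidean_space \<Rightarrow> real"
  assumes "(G has_derivative (\<lambda>h. g \<bullet> h)) (at v)"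
  shows "((\<lambda>t. G (v + t *\<^sub>R w)) has_real_derivative (g \<bullet> w)) (at 0)"
proof -
  have "(G has_derivative (\<lambda>h. g \<bullet> h)) (at (v + 0 *\<^sub>R w))" using assms by simp
  then have "((\<lambda>t. G (v + t *\<^sub>R w)) has_derivative (\<lambda>t. g \<bullet> (t *\<^sub>R w))) (at 0)"
    by (rule has_derivative_compose[rotated]) (auto intro!: derivative_eq_intros)
  then show ?thesis
    unfolding has_field_derivative_def by (rule has_derivative_eq_rhs) (simp add: fun_eq_iff mult.commute)
qed

lemma norm_gradient_le_lipschitz:
  fixes G :: "'a::euclidean_space \<Rightarrow> real"
  assumes lip: "\<Lambda>-lipschitz_on UNIV G" and der: "(G has_derivative (\<lambda>h. g \<bullet> h)) (at v)"
  shows "norm g \<le> \<Lambda>"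
proof -
  let ?X = "\<lambda>n. inverse (real (Suc n))"
  have "(\<lambda>n. (G (v + ?X n *\<^sub>R g) - G (v + 0 *\<^sub>R g)) / ?X n) \<longlonglongrightarrow> g \<bullet> g"
    by (rule tendsto_difference_quotient[OF has_derivative_along_line[OF der] LIMSEQ_inverse_real_of_nat]) simp
  moreover have "(G (v + ?X n *\<^sub>R g) - G (v + 0 *\<^sub>R g)) / ?X n \<le> \<Lambda> * norm g" for n
  proof -
    have "dist (G (v + ?X n *\<^sub>R g)) (G v) \<le> \<Lambda> * dist (v + ?X n *\<^sub>R g) v"
      using lip by (auto simp: lipschitz_on_def)
    then have "G (v + ?X n *\<^sub>R g) - G v \<le> (\<Lambda> * norm g) * ?X n"
      by (simp add: dist_norm mult_ac)
    then show ?thesis by (simp add: divide_simps)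
  qed
  ultimately have "g \<bullet> g \<le> \<Lambda> * norm g"
    by (auto intro: LIMSEQ_le_const2)
  then have "norm g * norm g \<le> \<Lambda> * norm g" by (simp add: dot_square_norm power2_eq_square)
  moreover have "0 \<le> \<Lambda>" using lip by (auto simp: lipschitz_on_def)
  ultimately show ?thesis by (cases "norm g = 0") auto
qed

text \<open>The directional derivative of \<open>G\<close> times the ramp integrates to zero, and the derivative of the ramp lives
on the shell. This is the divergence theorem before the shell is shrunk to the sphere.\<close>

lemma integral_gradient_ramp:
  fixes G :: "'a::euclidean_space \<Rightarrow> real"
  assumes lip: "\<Lambda>-lipschitz_on UNIV G"
    and der: "\<And>v. (G has_derivative (\<lambda>h. g v \<bullet> h)) (at v)"
    and cont: "continuous_on UNIV g" and \<delta>: "0 < \<delta>" "\<delta> < 1"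
  shows "(\<integral>v. (g v \<bullet> w) * radial_ramp \<delta> v \<partial>uniform_ball)
       = (\<integral>v. indicator {1 - \<delta><..<1} (norm v) * (G v * ((v /\<^sub>R norm v) \<bullet> w)) \<partial>uniform_ball) / \<delta>"
proof -
  let ?I = "\<lambda>v::'a. indicator {1 - \<delta><..<1} (norm v) :: real"
  let ?k' = "\<lambda>v. (g v \<bullet> w) * radial_ramp \<delta> v - ?I v * (G v * ((v /\<^sub>R norm v) \<bullet> w)) / \<delta>"
  define M where "M = \<bar>G 0\<bar> + \<Lambda>"
  have \<Lambda>0: "\<Lambda> \<ge> 0" using lip by (auto simp: lipschitz_on_def)
  have M: "\<bar>G v\<bar> \<le> M" if "norm v < 1" for v
  proof -
    have "dist (G v) (G 0) \<le> \<Lambda> * dist v 0" using lipschitz_onD[OF lip, of v 0] by simp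
    also have "\<dots> \<le> \<Lambda> * 1" using that \<Lambda>0 by (intro mult_left_mono) auto
    finally show ?thesis by (simp add: M_def dist_real_def)
  qed
  have [measurable]: "g \<in> borel_measurable borel" using cont by (rule borel_measurable_continuous_onI)
  have [measurable]: "G \<in> borel_measurable borel"
    using lip by (intro borel_measurable_continuous_onI lipschitz_on_continuous_on)
  have ramp01: "0 \<le> radial_ramp \<delta> v" "radial_ramp \<delta> v \<le> 1" for v :: 'a
    by (auto simp: radial_ramp_def)
  have ramp0: "radial_ramp \<delta> v = 0" if "norm v \<ge> 1" for v :: 'a
    using that \<delta> by (auto simp: radial_ramp_def max_def divide_le_0_iff zero_le_divide_iff)
  have [measurable]: "(radial_ramp \<delta> :: 'a \<Rightarrow> real) \<in> borel_measurable borel"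
    unfolding radial_ramp_def[abs_def] by measurable
  have u1: "\<bar>(v /\<^sub>R norm v) \<bullet> w\<bar> \<le> norm w" for v :: 'a
    using Cauchy_Schwarz_ineq2[of "v /\<^sub>R norm v" w] by (cases "v = 0") auto
  have "(\<integral>v. ?k' v \<partial>lborel) = 0"
  proof (rule integral_directional_derivative_eq_0)
    show "(M * (1 / \<delta>) + \<Lambda>)-lipschitz_on UNIV (\<lambda>v. G v * radial_ramp \<delta> v)"
      by (rule lipschitz_on_mult_bump[OF lip M radial_ramp_lipschitz ramp0 ramp01]) (use \<delta> in auto)
    show "G v * radial_ramp \<delta> v = 0" if "norm v \<ge> 1" for v
      using ramp0[OF that] by simp
    show "AE v in lborel. ((\<lambda>t. G (v + t *\<^sub>R w) * radial_ramp \<delta> (v + t *\<^sub>R w)) has_real_derivative ?k' v) (at 0)"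
      using AE_norm_neq[of 1] AE_norm_neq[of "1 - \<delta>"]
    proof eventually_elim
      case (elim v)
      show ?case
        by (rule DERIV_cong[OF DERIV_mult[OF has_derivative_along_line[OF der] radial_ramp_deriv[OF \<delta> elim]]])
           (simp add: indicator_def)
    qed
  qed measurable
  moreover have "indicator (ball 0 1) v * ?k' v = ?k' v" for v
    using ramp0[of v] by (auto simp: indicator_def)
  ultimately have "(\<integral>v. ?k' v \<partial>uniform_ball) = 0"
    by (subst integral_uniform_ball) (measurable, simp only: div_0)
  moreover have "integrable uniform_ball (\<lambda>v. (g v \<bullet> w) * radial_ramp \<delta> v)"
  proof (rule integrable_uniform_ball_bounded)
    fix v :: 'a
    have "\<bar>g v \<bullet> w\<bar> \<le> norm (g v) * norm w" by (rule Cauchy_Schwarz_ineq2)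
    also have "\<dots> \<le> \<Lambda> * norm w"
      using norm_gradient_le_lipschitz[OF lip der] by (intro mult_right_mono) auto
    finally show "\<bar>(g v \<bullet> w) * radial_ramp \<delta> v\<bar> \<le> (\<Lambda> * norm w) * 1"
      unfolding abs_mult using ramp01[of v] \<Lambda>0 by (intro mult_mono) auto
  qed measurable
  moreover have "integrable uniform_ball (\<lambda>v. ?I v * (G v * ((v /\<^sub>R norm v) \<bullet> w)))"
  proof (rule integrable_uniform_ball_bounded)
    fix v :: 'a assume v: "norm v < 1"
    have "\<bar>G v * ((v /\<^sub>R norm v) \<bullet> w)\<bar> \<le> M * norm w"
      unfolding abs_mult using M[OF v] u1[of v] by (intro mult_mono) auto
    then show "\<bar>?I v * (G v * ((v /\<^sub>R norm v) \<bullet> w))\<bar> \<le> M * norm w"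
      by (auto simp: indicator_def intro: order_trans[OF abs_ge_zero])
  qed measurable
  ultimately show ?thesis by simp
qed

lemma prob_uniform_ball_shell:
  assumes \<delta>: "0 < \<delta>" "\<delta> < 1"
  shows "(\<integral>v. indicator {1 - \<delta><..<1} (norm (v::'a::euclidean_space)) \<partial>uniform_ball) = 1 - (1 - \<delta>) ^ DIM('a)"
proof -
  interpret B: prob_space "uniform_ball :: 'a measure" by (rule prob_space_uniform_ball)
  have "(\<integral>v. (indicator {1 - \<delta><..<1} (norm (v::'a)) :: real) \<partial>uniform_ball)
      = (\<integral>v. 1 - indicator {v::'a. norm v < 1 - \<delta>} v \<partial>uniform_ball)"
  proof (rule integral_cong_AE)
    have "AE v::'a in uniform_ball. norm v \<noteq> 1 - \<delta>"
      by (rule AE_uniform_measureI) (use AE_norm_neq[of "1 - \<delta>"] in \<open>auto elim!: eventually_mono\<close>)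
    then show "AE v::'a in uniform_ball. indicator {1 - \<delta><..<1} (norm v) = (1 - indicator {v. norm v < 1 - \<delta>} v :: real)"
      using AE_uniform_ball by eventually_elim (auto simp: indicator_def)
  qed measurable
  also have "\<dots> = 1 - B.prob {v. norm v < 1 - \<delta>}"
    using B.prob_space by (subst Bochner_Integration.integral_diff)
      (auto intro!: integrable_uniform_ball_bounded[where B = 1] simp: indicator_def)
  finally show ?thesis
    using prob_uniform_ball_less[where ?'a = 'a, of "1 - \<delta>"] \<delta> by simp
qed

text \<open>As the shell gets thin, a function that is close to its value at the radial projection onto the sphere may be
replaced by a function of the direction alone.\<close>

lemma integral_shell_approx:
  fixes K k :: "'a::euclidean_space \<Rightarrow> real"
  assumes [measurable]: "K \<in> borel_measurable borel" "k \<in> borel_measurable borel"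
    and B: "\<And>v. norm v < 1 \<Longrightarrow> \<bar>K v\<bar> \<le> B" "\<And>u. norm u = 1 \<Longrightarrow> \<bar>k u\<bar> \<le> B"
    and e: "\<And>v. 1 - \<delta> < norm v \<Longrightarrow> norm v < 1 \<Longrightarrow> \<bar>K v - k (v /\<^sub>R norm v)\<bar> \<le> e"
    and \<delta>: "0 < \<delta>" "\<delta> < 1"
  shows "\<bar>(\<integral>v. indicator {1 - \<delta><..<1} (norm v) * K v \<partial>uniform_ball)
          - (1 - (1 - \<delta>) ^ DIM('a)) * (\<integral>u. k u \<partial>uniform_sphere)\<bar> \<le> (1 - (1 - \<delta>) ^ DIM('a)) * e"
proof -
  define I :: "real \<Rightarrow> real" where "I = indicator {1 - \<delta><..<1}"
  define c where "c = 1 - (1 - \<delta>) ^ DIM('a)"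
  have [measurable]: "I \<in> borel_measurable borel" unfolding I_def by measurable
  have I01: "0 \<le> I r" "I r \<le> 1" for r by (auto simp: I_def indicator_def)
  have c: "(\<integral>v. I (norm (v::'a)) \<partial>uniform_ball) = c"
    unfolding I_def c_def by (rule prob_uniform_ball_shell[OF \<delta>])
  have "AE v::'a in uniform_ball. \<bar>I (norm v) * k (v /\<^sub>R norm v)\<bar> \<le> B"
    using AE_uniform_ball
  proof eventually_elim
    case (elim v)
    have "\<bar>I (norm v)\<bar> * \<bar>k (v /\<^sub>R norm v)\<bar> \<le> 1 * B"
      using I01 elim by (intro mult_mono B) auto
    then show ?case by (simp only: abs_mult mult_1_left)
  qed
  then have ik: "integrable uniform_ball (\<lambda>v::'a. I (norm v) * k (v /\<^sub>R norm v))"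
    by (intro finite_measure.integrable_const_bound[where B = B] prob_space.finite_measure[OF prob_space_uniform_ball]) simp_all
  have iK: "integrable uniform_ball (\<lambda>v::'a. I (norm v) * K v)"
  proof (rule integrable_uniform_ball_bounded)
    fix v :: 'a assume v: "norm v < 1"
    have "\<bar>I (norm v)\<bar> * \<bar>K v\<bar> \<le> 1 * B"
      using I01 v by (intro mult_mono B) auto
    then show "\<bar>I (norm v) * K v\<bar> \<le> B" by (simp only: abs_mult mult_1_left)
  qed measurable
  have iI: "integrable uniform_ball (\<lambda>v::'a. I (norm v))"
    by (rule integrable_uniform_ball_bounded[where B = 1]) (use I01 in auto)
  have "(\<integral>v. I (norm v) * k (v /\<^sub>R norm v) \<partial>uniform_ball) = c * (\<integral>u. k u \<partial>uniform_sphere)"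
    unfolding c[symmetric]
    by (rule integral_polar[where a = I and k = k and A = 1 and K = B]) (use I01 B in auto)
  then have "(\<integral>v. I (norm v) * K v \<partial>uniform_ball) - c * (\<integral>u. k u \<partial>uniform_sphere)
      = (\<integral>v. I (norm v) * K v - I (norm v) * k (v /\<^sub>R norm v) \<partial>uniform_ball)"
    by (simp add: Bochner_Integration.integral_diff[OF iK ik])
  also have "\<bar>\<dots>\<bar> \<le> (\<integral>v. \<bar>I (norm v) * K v - I (norm v) * k (v /\<^sub>R norm v)\<bar> \<partial>uniform_ball)"
    by (rule integral_abs_bound)
  also have "\<dots> \<le> (\<integral>v. I (norm (v::'a)) * e \<partial>uniform_ball)"
  proof (rule integral_mono)
    show "integrable uniform_ball (\<lambda>v. \<bar>I (norm v) * K v - I (norm v) * k (v /\<^sub>R norm v)\<bar>)"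
      by (intro integrable_abs Bochner_Integration.integrable_diff ik iK)
    show "integrable uniform_ball (\<lambda>v::'a. I (norm v) * e)" by (intro integrable_mult_left iI)
    fix v :: 'a
    show "\<bar>I (norm v) * K v - I (norm v) * k (v /\<^sub>R norm v)\<bar> \<le> I (norm v) * e"
      using e[of v] by (auto simp: I_def indicator_def)
  qed
  also have "\<dots> = c * e" by (simp add: c)
  finally show ?thesis unfolding I_def c_def .
qed

text \<open>The divergence theorem on the unit ball for the vector field \<open>G w\<close>. The factor \<open>DIM('a)\<close> is the ratio of
the area of the sphere to the volume of the ball; it arises as the derivative of \<open>1 - (1 - \<delta>) ^ DIM('a)\<close>
at \<open>0\<close>.\<close>

theorem integral_gradient_ball:
  fixes G :: "'a::euclidean_space \<Rightarrow> real"
  assumes lip: "\<Lambda>-lipschitz_on UNIV G"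
    and der: "\<And>v. (G has_derivative (\<lambda>h. g v \<bullet> h)) (at v)"
    and cont: "continuous_on UNIV g"
  shows "(\<integral>v. g v \<bullet> w \<partial>uniform_ball) = DIM('a) * (\<integral>u. G u * (u \<bullet> w) \<partial>uniform_sphere)"
proof -
  interpret B: prob_space "uniform_ball :: 'a measure" by (rule prob_space_uniform_ball)
  define \<delta> where "\<delta> n = inverse (real (Suc (Suc n)))" for n
  have \<delta>: "0 < \<delta> n" "\<delta> n < 1" for n by (auto simp: \<delta>_def field_simps)
  have \<delta>0: "\<delta> \<longlonglongrightarrow> 0"
    using LIMSEQ_Suc[OF LIMSEQ_inverse_real_of_nat] by (simp add: \<delta>_def[abs_def])
  let ?I = "\<lambda>n v. indicator {1 - \<delta> n<..<1} (norm (v::'a)) :: real"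
  let ?U = "\<lambda>v::'a. v /\<^sub>R norm v"
  let ?S = "\<integral>u. G u * (u \<bullet> w) \<partial>uniform_sphere"
  have \<Lambda>0: "\<Lambda> \<ge> 0" using lip by (auto simp: lipschitz_on_def)
  have G: "\<bar>G x - G y\<bar> \<le> \<Lambda> * norm (x - y)" for x y
    using lip by (auto simp: lipschitz_on_def dist_norm)
  have [measurable]: "g \<in> borel_measurable borel" using cont by (rule borel_measurable_continuous_onI)
  have [measurable]: "G \<in> borel_measurable borel"
    using lip by (intro borel_measurable_continuous_onI lipschitz_on_continuous_on)
  have [measurable]: "(radial_ramp \<delta> :: 'a \<Rightarrow> real) \<in> borel_measurable borel" for \<delta>
    unfolding radial_ramp_def[abs_def] by measurable
  have u1: "\<bar>?U v \<bullet> w\<bar> \<le> norm w" for v :: 'a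
    using Cauchy_Schwarz_ineq2[of "?U v" w] by (cases "v = 0") auto
  have G1: "\<bar>G v\<bar> \<le> \<bar>G 0\<bar> + \<Lambda>" if "norm v \<le> 1" for v
  proof -
    have "\<bar>G v - G 0\<bar> \<le> \<Lambda> * norm v" using G[of v 0] by simp
    also have "\<dots> \<le> \<Lambda> * 1" using that \<Lambda>0 by (intro mult_left_mono) auto
    finally show ?thesis by linarith
  qed
  have lim1: "(\<lambda>n. \<integral>v. (g v \<bullet> w) * radial_ramp (\<delta> n) v \<partial>uniform_ball) \<longlonglongrightarrow> (\<integral>v. g v \<bullet> w \<partial>uniform_ball)"
  proof (rule integral_dominated_convergence)
    show "AE v in uniform_ball. (\<lambda>n. (g v \<bullet> w) * radial_ramp (\<delta> n) v) \<longlonglongrightarrow> g v \<bullet> w"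
      using AE_uniform_ball
    proof eventually_elim
      case (elim v)
      have "eventually (\<lambda>n. \<delta> n < 1 - norm v) sequentially"
        using \<delta>0 elim by (intro order_tendstoD) auto
      then have "eventually (\<lambda>n. radial_ramp (\<delta> n) v = 1) sequentially"
        by eventually_elim (use \<delta> elim in \<open>auto simp: radial_ramp_def min_def max_def divide_simps\<close>)
      then have "eventually (\<lambda>n. g v \<bullet> w = (g v \<bullet> w) * radial_ramp (\<delta> n) v) sequentially"
        by eventually_elim simp
      then show ?case by (rule Lim_transform_eventually[OF tendsto_const])
    qed
    show "AE v in uniform_ball. norm ((g v \<bullet> w) * radial_ramp (\<delta> n) v) \<le> \<Lambda> * norm w" for n
    proof (rule AE_I2)
      fix v
      have "\<bar>g v \<bullet> w\<bar> \<le> norm (g v) * norm w" by (rule Cauchy_Schwarz_ineq2)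
      also have "\<dots> \<le> \<Lambda> * norm w"
        using norm_gradient_le_lipschitz[OF lip der] by (intro mult_right_mono) auto
      finally have "\<bar>g v \<bullet> w\<bar> * \<bar>radial_ramp (\<delta> n) v\<bar> \<le> (\<Lambda> * norm w) * 1"
        using \<Lambda>0 by (intro mult_mono) (auto simp: radial_ramp_def)
      then show "norm ((g v \<bullet> w) * radial_ramp (\<delta> n) v) \<le> \<Lambda> * norm w" by (simp add: abs_mult)
    qed
  qed measurable
  define c where "c n = 1 - (1 - \<delta> n) ^ DIM('a)" for n
  have c\<delta>: "(\<lambda>n. c n / \<delta> n) \<longlonglongrightarrow> DIM('a)"
  proof -
    have "((\<lambda>t. - ((1 - t) ^ DIM('a))) has_real_derivative real DIM('a)) (at 0)"
      by (auto intro!: derivative_eq_intros)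
    from tendsto_difference_quotient[OF this \<delta>0] \<delta> show ?thesis by (simp add: c_def less_imp_neq[symmetric])
  qed
  have rest: "\<bar>(\<integral>v. ?I n v * (G v * (?U v \<bullet> w)) \<partial>uniform_ball) - c n * ?S\<bar> \<le> c n * (\<delta> n * \<Lambda> * norm w)" for n
    unfolding c_def
  proof (rule integral_shell_approx[where B = "(\<bar>G 0\<bar> + \<Lambda>) * norm w", OF _ _ _ _ _ \<delta>])
    show "\<bar>G v * (?U v \<bullet> w)\<bar> \<le> (\<bar>G 0\<bar> + \<Lambda>) * norm w" if "norm v < 1" for v
      unfolding abs_mult using G1[of v] that u1[of v] \<Lambda>0 by (intro mult_mono) auto
    show "\<bar>G u * (u \<bullet> w)\<bar> \<le> (\<bar>G 0\<bar> + \<Lambda>) * norm w" if "norm u = 1" for u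
      unfolding abs_mult using G1[of u] that Cauchy_Schwarz_ineq2[of u w] \<Lambda>0 by (intro mult_mono) auto
    show "\<bar>G v * (?U v \<bullet> w) - G (?U v) * (?U v \<bullet> w)\<bar> \<le> \<delta> n * \<Lambda> * norm w"
      if v: "1 - \<delta> n < norm v" "norm v < 1" for v
    proof -
      have v0: "v \<noteq> 0" using v \<delta>[of n] by auto
      have "v - ?U v = (norm v - 1) *\<^sub>R ?U v" using v0 by (simp add: left_diff_distrib scaleR_diff_left)
      then have "norm (v - ?U v) = 1 - norm v" using v0 v by (simp add: abs_mult)
      then have "norm (v - ?U v) \<le> \<delta> n" using v by linarith
      then have "\<bar>G v - G (?U v)\<bar> \<le> \<Lambda> * \<delta> n"
        by (rule order_trans[OF G[of v "?U v"] mult_left_mono[OF _ \<Lambda>0]])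
      then have "\<bar>G v - G (?U v)\<bar> * \<bar>?U v \<bullet> w\<bar> \<le> (\<Lambda> * \<delta> n) * norm w"
        using \<Lambda>0 \<delta>(1)[of n] by (intro mult_mono u1) (auto intro: less_imp_le)
      then show ?thesis
        unfolding left_diff_distrib[symmetric] abs_mult by (simp only: mult.commute[of "\<delta> n" \<Lambda>])
    qed
  qed measurable
  have lim2: "(\<lambda>n. (\<integral>v. ?I n v * (G v * (?U v \<bullet> w)) \<partial>uniform_ball) / \<delta> n) \<longlonglongrightarrow> DIM('a) * ?S"
  proof -
    have "(\<lambda>n. c n / \<delta> n * (\<delta> n * \<Lambda> * norm w)) \<longlonglongrightarrow> DIM('a) * (0 * \<Lambda> * norm w)"
      by (intro tendsto_intros c\<delta> \<delta>0)
    then have g: "(\<lambda>n. c n / \<delta> n * (\<delta> n * \<Lambda> * norm w)) \<longlonglongrightarrow> 0" by simp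
    have bd: "norm ((\<integral>v. ?I n v * (G v * (?U v \<bullet> w)) \<partial>uniform_ball) / \<delta> n - c n / \<delta> n * ?S)
        \<le> c n / \<delta> n * (\<delta> n * \<Lambda> * norm w)" for n
      using divide_right_mono[OF rest[of n], of "\<delta> n"] \<delta>[of n] by (simp add: diff_divide_distrib[symmetric])
    have "(\<lambda>n. (\<integral>v. ?I n v * (G v * (?U v \<bullet> w)) \<partial>uniform_ball) / \<delta> n - c n / \<delta> n * ?S) \<longlonglongrightarrow> 0"
      by (rule Lim_null_comparison[OF always_eventually g]) (intro allI bd)
    from tendsto_add[OF this tendsto_mult[OF c\<delta> tendsto_const[of ?S]]] show ?thesis by simp
  qed
  have "(\<lambda>n. \<integral>v. (g v \<bullet> w) * radial_ramp (\<delta> n) v \<partial>uniform_ball) \<longlonglongrightarrow> DIM('a) * ?S"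
    using lim2 by (simp add: integral_gradient_ramp[OF lip der cont \<delta>])
  then show ?thesis using lim1 by (rule LIMSEQ_unique[rotated])
qed

text \<open>The divergence theorem for a constant function.\<close>

corollary integral_uniform_sphere_inner:
  fixes w :: "'a::euclidean_space"
  shows "(\<integral>u. u \<bullet> w \<partial>uniform_sphere) = 0"
proof -
  have "(0::real) = DIM('a) * (\<integral>u. 1 * (u \<bullet> w) \<partial>uniform_sphere)"
    using integral_gradient_ball[of 0 "\<lambda>_::'a. 1::real" "\<lambda>_. 0" w] by (simp add: lipschitz_on_def)
  then show ?thesis by simp
qed

text \<open>The divergence theorem for a linear function: the covariance of a uniform direction is isotropic.\<close>

corollary integral_uniform_sphere_inner_mult:
  fixes a w :: "'a::euclidean_space"
  shows "(\<integral>u. (a \<bullet> u) * (u \<bullet> w) \<partial>uniform_sphere) = (a \<bullet> w) / DIM('a)"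
proof -
  interpret B: prob_space "uniform_ball :: 'a measure" by (rule prob_space_uniform_ball)
  have "(norm a)-lipschitz_on UNIV (\<lambda>u. a \<bullet> u)"
    using Cauchy_Schwarz_ineq2[of a] by (auto simp: lipschitz_on_def dist_norm inner_diff_right[symmetric])
  then have "a \<bullet> w = DIM('a) * (\<integral>u. (a \<bullet> u) * (u \<bullet> w) \<partial>uniform_sphere)"
    using integral_gradient_ball[of "norm a" "\<lambda>u. a \<bullet> u" "\<lambda>_. a" w] B.prob_space
    by (simp add: bounded_linear_imp_has_derivative bounded_linear_inner_right)
  then show ?thesis by simp
qed

section \<open>Rotations of a pair of vectors\<close>

abbreviation ball_pair :: "('a::euclidean_space \<times> 'a) measure" where
  "ball_pair \<equiv> uniform_ball \<Otimes>\<^sub>M uniform_ball"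

text \<open>The unit ball of \<open>'a \<times> 'a\<close>. It is contained in the product of the two unit balls, so that polar
coordinates are available in each component, and it is invariant under rotations that mix the components.\<close>

abbreviation pair_disc :: "('a::euclidean_space \<times> 'a) set" where
  "pair_disc \<equiv> {z. (norm (fst z))\<^sup>2 + (norm (snd z))\<^sup>2 < 1}"

definition rotate_pair :: "real \<Rightarrow> 'a::euclidean_space \<times> 'a \<Rightarrow> 'a \<times> 'a" where
  "rotate_pair \<theta> z = (cos \<theta> *\<^sub>R fst z + sin \<theta> *\<^sub>R snd z, cos \<theta> *\<^sub>R snd z - sin \<theta> *\<^sub>R fst z)"

lemma nn_integral_lborel_shift:
  fixes c :: "'a::euclidean_space"
  assumes [measurable]: "h \<in> borel_measurable borel"
  shows "(\<integral>\<^sup>+y. h (y + c) \<partial>lborel) = (\<integral>\<^sup>+y. h y \<partial>lborel)"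
proof -
  have "(\<integral>\<^sup>+y. h y \<partial>lborel) = (\<integral>\<^sup>+y. h y \<partial>distr lborel borel ((+) c))"
    by (simp add: lborel_distr_plus)
  also have "\<dots> = (\<integral>\<^sup>+y. h (y + c) \<partial>lborel)"
    by (subst nn_integral_distr) (auto simp: add.commute)
  finally show ?thesis by simp
qed

text \<open>A shear translates each fibre, and Lebesgue measure is translation invariant.\<close>

lemma distr_shear_snd:
  "distr (lborel \<Otimes>\<^sub>M lborel) (borel \<Otimes>\<^sub>M borel) (\<lambda>z. (fst z, snd z + b *\<^sub>R fst z)) =
     (lborel \<Otimes>\<^sub>M lborel :: ('a::euclidean_space \<times> 'a) measure)"
proof (rule measure_eqI)
  fix A :: "('a \<times> 'a) set"
  assume "A \<in> sets (distr (lborel \<Otimes>\<^sub>M lborel) (borel \<Otimes>\<^sub>M borel) (\<lambda>z. (fst z, snd z + b *\<^sub>R fst z)))"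
  then have [measurable]: "A \<in> sets (borel \<Otimes>\<^sub>M borel)" by simp
  have "emeasure (distr (lborel \<Otimes>\<^sub>M lborel) (borel \<Otimes>\<^sub>M borel) (\<lambda>z. (fst z, snd z + b *\<^sub>R fst z))) A
      = (\<integral>\<^sup>+z. indicator A z \<partial>distr (lborel \<Otimes>\<^sub>M lborel) (borel \<Otimes>\<^sub>M borel) (\<lambda>z. (fst z, snd z + b *\<^sub>R fst z)))"
    by simp
  also have "\<dots> = (\<integral>\<^sup>+z. indicator A (fst z, snd z + b *\<^sub>R fst z) \<partial>(lborel \<Otimes>\<^sub>M lborel))"
    by (subst nn_integral_distr) auto
  also have "\<dots> = (\<integral>\<^sup>+x. \<integral>\<^sup>+y. indicator A (x, y + b *\<^sub>R x) \<partial>lborel \<partial>lborel)"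
    by (subst lborel.nn_integral_fst[symmetric]) auto
  also have "\<dots> = (\<integral>\<^sup>+x. \<integral>\<^sup>+y. indicator A (x, y) \<partial>lborel \<partial>lborel)"
    by (intro nn_integral_cong nn_integral_lborel_shift) measurable
  also have "\<dots> = emeasure (lborel \<Otimes>\<^sub>M lborel) A"
    by (subst lborel.nn_integral_fst) auto
  finally show "emeasure (distr (lborel \<Otimes>\<^sub>M lborel) (borel \<Otimes>\<^sub>M borel) (\<lambda>z. (fst z, snd z + b *\<^sub>R fst z))) A
      = emeasure (lborel \<Otimes>\<^sub>M lborel) A" .
qed simp

lemma distr_shear_fst:
  "distr (lborel \<Otimes>\<^sub>M lborel) (borel \<Otimes>\<^sub>M borel) (\<lambda>z. (fst z + a *\<^sub>R snd z, snd z)) =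
     (lborel \<Otimes>\<^sub>M lborel :: ('a::euclidean_space \<times> 'a) measure)"
proof -
  let ?L = "lborel \<Otimes>\<^sub>M lborel :: ('a \<times> 'a) measure"
  let ?B = "borel \<Otimes>\<^sub>M borel :: ('a \<times> 'a) measure"
  let ?s = "\<lambda>z::'a \<times> 'a. (snd z, fst z)"
  have swap: "?L = distr ?L ?B ?s"
    using lborel_pair.distr_pair_swap[where ?'a = 'a and ?'b = 'a]
    by (simp add: case_prod_beta' cong: distr_cong)
  have "distr ?L ?B (\<lambda>z. (fst z + a *\<^sub>R snd z, snd z))
      = distr ?L ?B (?s \<circ> ((\<lambda>z. (fst z, snd z + a *\<^sub>R fst z)) \<circ> ?s))"
    by (intro distr_cong) auto
  also have "\<dots> = distr (distr ?L ?B ((\<lambda>z. (fst z, snd z + a *\<^sub>R fst z)) \<circ> ?s)) ?B ?s"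
    by (rule distr_distr[symmetric]) measurable
  also have "distr ?L ?B ((\<lambda>z. (fst z, snd z + a *\<^sub>R fst z)) \<circ> ?s)
      = distr (distr ?L ?B ?s) ?B (\<lambda>z. (fst z, snd z + a *\<^sub>R fst z))"
    by (rule distr_distr[symmetric]) measurable
  also have "\<dots> = ?L" unfolding swap[symmetric] by (rule distr_shear_snd)
  also have "distr ?L ?B ?s = ?L" by (rule swap[symmetric])
  finally show ?thesis .
qed

text \<open>A rotation that mixes the two components is a product of three shears.\<close>

lemma distr_rotate_pair:
  assumes \<theta>: "0 \<le> \<theta>" "\<theta> < pi"
  shows "distr (lborel \<Otimes>\<^sub>M lborel) (borel \<Otimes>\<^sub>M borel) (rotate_pair \<theta>) =
     (lborel \<Otimes>\<^sub>M lborel :: ('a::euclidean_space \<times> 'a) measure)"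
proof (cases "\<theta> = 0")
  case True
  then have "rotate_pair \<theta> = (\<lambda>z::'a \<times> 'a. z)" by (auto simp: rotate_pair_def)
  then show ?thesis by (simp add: distr_id2)
next
  case False
  let ?L = "lborel \<Otimes>\<^sub>M lborel :: ('a \<times> 'a) measure"
  let ?B = "borel \<Otimes>\<^sub>M borel :: ('a \<times> 'a) measure"
  define a where "a = (1 - cos \<theta>) / sin \<theta>"
  let ?f = "\<lambda>z::'a \<times> 'a. (fst z + a *\<^sub>R snd z, snd z)"
  let ?g = "\<lambda>z::'a \<times> 'a. (fst z, snd z + (- sin \<theta>) *\<^sub>R fst z)"
  have s: "sin \<theta> > 0" using \<theta> False by (intro sin_gt_zero) auto
  have as: "a * sin \<theta> = 1 - cos \<theta>" using s by (simp add: a_def)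
  have ac: "a * (1 + cos \<theta>) = sin \<theta>"
    using s by (simp add: a_def field_simps)
  have "rotate_pair \<theta> = ?f \<circ> (?g \<circ> ?f)"
  proof (rule ext)
    fix z :: "'a \<times> 'a"
    have 1: "snd z - sin \<theta> *\<^sub>R (fst z + a *\<^sub>R snd z) = cos \<theta> *\<^sub>R snd z - sin \<theta> *\<^sub>R fst z"
    proof -
      have "sin \<theta> *\<^sub>R (fst z + a *\<^sub>R snd z) = sin \<theta> *\<^sub>R fst z + (1 - cos \<theta>) *\<^sub>R snd z"
        by (simp add: scaleR_add_right as mult.commute)
      then show ?thesis by (simp add: scaleR_diff_left)
    qed
    have "fst z + a *\<^sub>R snd z + a *\<^sub>R (cos \<theta> *\<^sub>R snd z - sin \<theta> *\<^sub>R fst z)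
        = fst z - (a * sin \<theta>) *\<^sub>R fst z + (a * (1 + cos \<theta>)) *\<^sub>R snd z"
      by (simp add: algebra_simps)
    also have "\<dots> = cos \<theta> *\<^sub>R fst z + sin \<theta> *\<^sub>R snd z"
      unfolding as ac by (simp add: algebra_simps)
    finally show "rotate_pair \<theta> z = (?f \<circ> (?g \<circ> ?f)) z"
      using 1 by (simp add: rotate_pair_def)
  qed
  then have "distr ?L ?B (rotate_pair \<theta>) = distr ?L ?B (?f \<circ> (?g \<circ> ?f))" by simp
  also have "\<dots> = distr (distr ?L ?B (?g \<circ> ?f)) ?B ?f"
    by (rule distr_distr[symmetric]) measurable
  also have "distr ?L ?B (?g \<circ> ?f) = distr (distr ?L ?B ?f) ?B ?g"
    by (rule distr_distr[symmetric]) measurable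
  finally show ?thesis by (simp only: distr_shear_fst distr_shear_snd)
qed

lemma rotate_pair_add:
  "rotate_pair \<theta> (rotate_pair \<phi> z) = rotate_pair (\<phi> + \<theta>) z"
  by (simp add: rotate_pair_def cos_add sin_add algebra_simps)

lemma rotate_pair_disc: "rotate_pair \<theta> z \<in> pair_disc \<longleftrightarrow> z \<in> pair_disc"
proof -
  have *: "(norm (c *\<^sub>R x + s *\<^sub>R y))\<^sup>2 + (norm (c *\<^sub>R y - s *\<^sub>R x))\<^sup>2
     = (c\<^sup>2 + s\<^sup>2) * ((norm x)\<^sup>2 + (norm y)\<^sup>2)" for c s :: real and x y :: 'a
    unfolding power2_norm_eq_inner
    by (simp add: inner_add inner_diff inner_commute[of y x] power2_eq_square) (simp add: algebra_simps)
  show ?thesis by (simp add: rotate_pair_def *)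
qed

lemma pair_disc_measurable [measurable]: "pair_disc \<in> sets (borel \<Otimes>\<^sub>M borel)"
proof -
  have "{z \<in> space (borel \<Otimes>\<^sub>M borel). (norm (fst z))\<^sup>2 + (norm (snd z))\<^sup>2 < 1} \<in> sets (borel \<Otimes>\<^sub>M borel)"
    by measurable
  then show ?thesis by (simp add: space_pair_measure)
qed

lemma rotate_pair_measurable [measurable]: "rotate_pair \<theta> \<in> borel \<Otimes>\<^sub>M borel \<rightarrow>\<^sub>M borel \<Otimes>\<^sub>M borel"
  unfolding rotate_pair_def[abs_def] by measurable

lemma integral_pair_disc:
  fixes \<Phi> :: "'a::euclidean_space \<times> 'a \<Rightarrow> real"
  assumes [measurable]: "\<Phi> \<in> borel_measurable (borel \<Otimes>\<^sub>M borel)"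
  shows "(\<integral>z. indicator pair_disc z * \<Phi> z \<partial>ball_pair)
    = (\<integral>z. indicator pair_disc z * \<Phi> z \<partial>(lborel \<Otimes>\<^sub>M lborel)) / (measure lborel (ball 0 1 :: 'a set))\<^sup>2"
proof -
  define V where "V = measure lborel (ball 0 1 :: 'a set)"
  let ?i = "\<lambda>v::'a. indicator (ball 0 1) v / V :: real"
  interpret prob_space "uniform_ball :: 'a measure" by (rule prob_space_uniform_ball)
  have V: "V \<ge> 0" by (simp add: V_def)
  have [measurable]: "(indicator (ball 0 1) :: 'a \<Rightarrow> real) \<in> borel_measurable borel"
    by (rule borel_measurable_indicator) simp
  have "ball_pair = density (lborel \<Otimes>\<^sub>M lborel) (\<lambda>(x, y). ennreal (?i x) * ennreal (?i y))"
    unfolding uniform_ball_density V_def[symmetric]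
  proof (rule pair_measure_density)
    show "sigma_finite_measure (density lborel (\<lambda>v. ennreal (?i v)))"
      using sigma_finite_measure_axioms unfolding uniform_ball_density V_def .
  qed (auto intro: lborel.sigma_finite_measure_axioms)
  also have "\<dots> = density (lborel \<Otimes>\<^sub>M lborel) (\<lambda>z. ennreal (?i (fst z) * ?i (snd z)))"
    using V by (intro density_cong AE_I2) (simp_all add: case_prod_beta ennreal_mult[symmetric])
  finally have "(\<integral>z. indicator pair_disc z * \<Phi> z \<partial>ball_pair)
     = (\<integral>z. (?i (fst z) * ?i (snd z)) *\<^sub>R (indicator pair_disc z * \<Phi> z) \<partial>(lborel \<Otimes>\<^sub>M lborel))"
    using V by (simp add: integral_density)
  also have "\<dots> = (\<integral>z. (indicator pair_disc z * \<Phi> z) / V\<^sup>2 \<partial>(lborel \<Otimes>\<^sub>M lborel))"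
  proof (rule Bochner_Integration.integral_cong)
    fix z :: "'a \<times> 'a"
    have "norm (fst z) < 1 \<and> norm (snd z) < 1" if "z \<in> pair_disc"
    proof -
      have "(norm (fst z))\<^sup>2 < 1" "(norm (snd z))\<^sup>2 < 1"
        using that by (auto intro: le_less_trans[rotated])
      then show ?thesis by (simp add: power_less_one_iff abs_square_less_1)
    qed
    then show "(?i (fst z) * ?i (snd z)) *\<^sub>R (indicator pair_disc z * \<Phi> z) = (indicator pair_disc z * \<Phi> z) / V\<^sup>2"
      by (auto simp: indicator_def power2_eq_square)
  qed simp
  finally show ?thesis by (simp add: V_def)
qed

lemma integral_rotate_pair:
  fixes \<Phi> :: "'a::euclidean_space \<times> 'a \<Rightarrow> real"
  assumes [measurable]: "\<Phi> \<in> borel_measurable (borel \<Otimes>\<^sub>M borel)" and \<theta>: "0 \<le> \<theta>" "\<theta> < pi"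
  shows "(\<integral>z. indicator pair_disc z * \<Phi> (rotate_pair \<theta> z) \<partial>ball_pair)
       = (\<integral>z. indicator pair_disc z * \<Phi> z \<partial>ball_pair)"
proof -
  have "(\<integral>z. indicator pair_disc z * \<Phi> z \<partial>(lborel \<Otimes>\<^sub>M lborel))
      = (\<integral>z. indicator pair_disc z * \<Phi> z \<partial>distr (lborel \<Otimes>\<^sub>M lborel) (borel \<Otimes>\<^sub>M borel) (rotate_pair \<theta>))"
    by (simp add: distr_rotate_pair[OF \<theta>])
  also have "\<dots> = (\<integral>z. indicator pair_disc (rotate_pair \<theta> z) * \<Phi> (rotate_pair \<theta> z) \<partial>(lborel \<Otimes>\<^sub>M lborel))"
    by (subst integral_distr) auto
  also have "\<dots> = (\<integral>z. indicator pair_disc z * \<Phi> (rotate_pair \<theta> z) \<partial>(lborel \<Otimes>\<^sub>M lborel))"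
    unfolding indicator_def rotate_pair_disc ..
  finally show ?thesis by (simp add: integral_pair_disc)
qed


section \<open>A Poincare inequality on the sphere\<close>

text \<open>The positively homogeneous extension of degree \<open>1\<close> from the sphere. Degree \<open>1\<close> makes it Lipschitz up to
the origin, and its second moment factorizes in polar coordinates.\<close>

definition radial_extension :: "('a::euclidean_space \<Rightarrow> real) \<Rightarrow> 'a \<Rightarrow> real" where
  "radial_extension \<rho> x = norm x * \<rho> (x /\<^sub>R norm x)"

lemma radial_extension_lipschitz:
  fixes \<rho> :: "'a::euclidean_space \<Rightarrow> real"
  assumes lip: "C-lipschitz_on (sphere 0 1) \<rho>" and B: "\<And>u. norm u = 1 \<Longrightarrow> \<bar>\<rho> u\<bar> \<le> B"
  shows "\<bar>radial_extension \<rho> x - radial_extension \<rho> y\<bar> \<le> (B + 2 * C) * norm (x - y)"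
proof -
  obtain b :: 'a where "norm b = 1" using norm_Basis SOME_Basis by blast
  with B[of b] have B0: "0 \<le> B" by (auto intro: order_trans[OF abs_ge_zero])
  have C0: "0 \<le> C" using lip by (auto simp: lipschitz_on_def)
  consider "x = 0" | "y = 0" | "x \<noteq> 0" "y \<noteq> 0" by blast
  then show ?thesis
  proof cases
    case 1
    have "norm y * \<bar>\<rho> (y /\<^sub>R norm y)\<bar> \<le> norm y * B" by (cases "y = 0") (auto intro!: mult_left_mono B)
    also have "\<dots> \<le> (B + 2 * C) * norm y" using C0 by (simp add: algebra_simps)
    finally show ?thesis using 1 by (simp add: radial_extension_def abs_mult)
  next
    case 2
    have "norm x * \<bar>\<rho> (x /\<^sub>R norm x)\<bar> \<le> norm x * B" by (cases "x = 0") (auto intro!: mult_left_mono B)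
    also have "\<dots> \<le> (B + 2 * C) * norm x" using C0 by (simp add: algebra_simps)
    finally show ?thesis using 2 by (simp add: radial_extension_def abs_mult)
  next
    case 3
    let ?u = "x /\<^sub>R norm x" and ?w = "y /\<^sub>R norm y"
    have u: "norm ?u = 1" "norm ?w = 1" using 3 by auto
    have "norm y *\<^sub>R (?u - ?w) = (norm y - norm x) *\<^sub>R ?u + (x - y)"
      using 3 by (simp add: scaleR_diff_right left_diff_distrib scaleR_diff_left)
    then have "norm y * norm (?u - ?w) = norm ((norm y - norm x) *\<^sub>R ?u + (x - y))"
      by (metis abs_norm_cancel norm_scaleR)
    also have "\<dots> \<le> norm ((norm y - norm x) *\<^sub>R ?u) + norm (x - y)" by (rule norm_triangle_ineq)
    also have "norm ((norm y - norm x) *\<^sub>R ?u) = \<bar>norm y - norm x\<bar>" by (simp only: norm_scaleR[of "norm y - norm x"] u mult_1_right)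
    also have "\<bar>norm y - norm x\<bar> + norm (x - y) \<le> 2 * norm (x - y)"
      using norm_triangle_ineq3[of x y] by (simp add: abs_minus_commute)
    finally have uw: "norm y * norm (?u - ?w) \<le> 2 * norm (x - y)" .
    have "\<bar>\<rho> ?u - \<rho> ?w\<bar> \<le> C * norm (?u - ?w)"
      using lipschitz_onD[OF lip, of ?u ?w] u by (simp add: dist_norm)
    then have "norm y * \<bar>\<rho> ?u - \<rho> ?w\<bar> \<le> C * (norm y * norm (?u - ?w))"
      by (metis mult.left_commute mult_left_mono norm_ge_zero)
    also have "\<dots> \<le> C * (2 * norm (x - y))" using uw C0 by (rule mult_left_mono)
    finally have 1: "norm y * \<bar>\<rho> ?u - \<rho> ?w\<bar> \<le> C * (2 * norm (x - y))" .
    have 2: "\<bar>norm x - norm y\<bar> * \<bar>\<rho> ?u\<bar> \<le> norm (x - y) * B"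
      using norm_triangle_ineq3[of x y] B[OF u(1)] by (intro mult_mono) auto
    have "radial_extension \<rho> x - radial_extension \<rho> y = (norm x - norm y) * \<rho> ?u + norm y * (\<rho> ?u - \<rho> ?w)"
      by (simp add: radial_extension_def algebra_simps)
    then have "\<bar>radial_extension \<rho> x - radial_extension \<rho> y\<bar>
        \<le> \<bar>norm x - norm y\<bar> * \<bar>\<rho> ?u\<bar> + norm y * \<bar>\<rho> ?u - \<rho> ?w\<bar>"
      by (metis abs_mult abs_norm_cancel abs_triangle_ineq)
    also have "\<dots> \<le> norm (x - y) * B + C * (2 * norm (x - y))" using 1 2 by linarith
    finally show ?thesis by (simp add: algebra_simps)
  qed
qed

text \<open>The gradient of the radial extension at \<open>u\<close> and, by homogeneity, on the whole ray through \<open>u\<close>: the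
radial derivative is \<open>\<rho> u\<close> and the tangential part is that of \<open>g u\<close>.\<close>

definition radial_gradient :: "('a::euclidean_space \<Rightarrow> real) \<Rightarrow> ('a \<Rightarrow> 'a) \<Rightarrow> 'a \<Rightarrow> 'a" where
  "radial_gradient \<rho> g u = (\<rho> u - g u \<bullet> u) *\<^sub>R u + g u"

text \<open>Discarding the radial part of \<open>g u\<close> only decreases the norm, by Pythagoras.\<close>

lemma norm_radial_gradient:
  assumes "norm u = 1" "(\<rho> u)\<^sup>2 + (norm (g u))\<^sup>2 \<le> B\<^sup>2"
  shows "(norm (radial_gradient \<rho> g u))\<^sup>2 \<le> B\<^sup>2"
proof -
  have uu: "u \<bullet> u = 1" using assms(1) by (simp add: dot_square_norm)
  have "(norm (radial_gradient \<rho> g u))\<^sup>2 = (\<rho> u)\<^sup>2 - (g u \<bullet> u)\<^sup>2 + (norm (g u))\<^sup>2"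
    unfolding power2_norm_eq_inner radial_gradient_def
    by (simp add: inner_add inner_commute[of u "g u"] uu power2_eq_square) (simp add: algebra_simps)
  also have "\<dots> \<le> B\<^sup>2" using assms(2) zero_le_power2[of "g u \<bullet> u"] by linarith
  finally show ?thesis .
qed

lemma radial_extension_deriv:
  fixes \<rho> :: "'a::euclidean_space \<Rightarrow> real"
  assumes x: "x \<noteq> 0" and der: "(\<rho> has_derivative (\<lambda>h. g (x /\<^sub>R norm x) \<bullet> h)) (at (x /\<^sub>R norm x))"
  shows "(radial_extension \<rho> has_derivative (\<lambda>h. radial_gradient \<rho> g (x /\<^sub>R norm x) \<bullet> h)) (at x)"
proof -
  let ?u = "x /\<^sub>R norm x"
  have n: "(norm has_derivative (\<lambda>h. h \<bullet> sgn x)) (at x)" using x by (rule has_derivative_norm)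
  have "((\<lambda>x. inverse (norm x)) has_derivative (\<lambda>h. - (inverse (norm x) * (h \<bullet> sgn x) * inverse (norm x)))) (at x)"
    by (rule Deriv.has_derivative_inverse[OF _ n]) (use x in simp)
  then have "((\<lambda>x. x /\<^sub>R norm x) has_derivative
      (\<lambda>h. inverse (norm x) *\<^sub>R h + (- (inverse (norm x) * (h \<bullet> sgn x) * inverse (norm x))) *\<^sub>R x)) (at x)"
    by (rule has_derivative_scaleR[OF _ has_derivative_ident])
  from has_derivative_compose[OF this der]
  have "((\<lambda>x. \<rho> (x /\<^sub>R norm x)) has_derivative
     (\<lambda>h. g ?u \<bullet> (inverse (norm x) *\<^sub>R h + (- (inverse (norm x) * (h \<bullet> sgn x) * inverse (norm x))) *\<^sub>R x))) (at x)" .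
  from has_derivative_mult[OF n this]
  have "((\<lambda>x. norm x * \<rho> (x /\<^sub>R norm x)) has_derivative
     (\<lambda>h. norm x * (g ?u \<bullet> (inverse (norm x) *\<^sub>R h + (- (inverse (norm x) * (h \<bullet> sgn x) * inverse (norm x))) *\<^sub>R x))
         + (h \<bullet> sgn x) * \<rho> ?u)) (at x)" .
  then have "(radial_extension \<rho> has_derivative
     (\<lambda>h. norm x * (g ?u \<bullet> (inverse (norm x) *\<^sub>R h + (- (inverse (norm x) * (h \<bullet> sgn x) * inverse (norm x))) *\<^sub>R x))
         + (h \<bullet> sgn x) * \<rho> ?u)) (at x)"
    by (simp add: radial_extension_def[abs_def])
  then show ?thesis
  proof (rule has_derivative_eq_rhs, intro ext)
    fix h
    have s: "sgn x = ?u" by (simp add: sgn_div_norm)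
    have "norm x * (g ?u \<bullet> (inverse (norm x) *\<^sub>R h + (- (inverse (norm x) * (h \<bullet> sgn x) * inverse (norm x))) *\<^sub>R x))
      = (norm x * inverse (norm x)) * (g ?u \<bullet> h) - (norm x * inverse (norm x)) * (h \<bullet> sgn x) * (g ?u \<bullet> ?u)"
      by (simp add: inner_add_right inner_diff_right algebra_simps)
    then show "norm x * (g ?u \<bullet> (inverse (norm x) *\<^sub>R h + (- (inverse (norm x) * (h \<bullet> sgn x) * inverse (norm x))) *\<^sub>R x))
         + (h \<bullet> sgn x) * \<rho> ?u = radial_gradient \<rho> g ?u \<bullet> h"
      using x unfolding s radial_gradient_def
      by (simp only: right_inverse norm_eq_zero mult_1_left inner_add_left inner_scaleR_left[of _ "?u"] inner_commute[of h] not_False_eq_True)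
         (simp only: algebra_simps)
  qed
qed

lemma prob_space_pair_ball: "prob_space (ball_pair :: ('a::euclidean_space \<times> 'a) measure)"
proof -
  interpret B: prob_space "uniform_ball :: 'a measure" by (rule prob_space_uniform_ball)
  interpret P: pair_prob_space "uniform_ball :: 'a measure" "uniform_ball :: 'a measure" ..
  show ?thesis by (rule P.prob_space_axioms)
qed

lemma integrable_pair_disc:
  fixes \<Phi> :: "'a::euclidean_space \<times> 'a \<Rightarrow> real"
  assumes [measurable]: "\<Phi> \<in> borel_measurable (borel \<Otimes>\<^sub>M borel)" and K: "\<And>z. z \<in> pair_disc \<Longrightarrow> \<bar>\<Phi> z\<bar> \<le> K"
  shows "integrable ball_pair (\<lambda>z. indicator pair_disc z * \<Phi> z)"
proof -
  interpret prob_space "ball_pair :: ('a \<times> 'a) measure" by (rule prob_space_pair_ball)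
  have K0: "0 \<le> K" using K[of 0] by (auto intro: order_trans[OF abs_ge_zero])
  show ?thesis
  proof (rule integrable_const_bound[where B = K])
    show "AE z in ball_pair. norm (indicator pair_disc z * \<Phi> z) \<le> K"
    proof (rule AE_I2)
      fix z :: "'a \<times> 'a"
      show "norm (indicator pair_disc z * \<Phi> z) \<le> K"
        using K[of z] K0 by (cases "z \<in> pair_disc") (simp_all add: indicator_simps)
    qed
  qed measurable
qed

lemma pair_disc_norm_less:
  assumes "z \<in> pair_disc" shows "norm (fst z) < 1" "norm (snd z) < 1"
proof -
  have "(norm (fst z))\<^sup>2 + (norm (snd z))\<^sup>2 < 1" using assms by simp
  then have "(norm (fst z))\<^sup>2 < 1" "(norm (snd z))\<^sup>2 < 1"
    using zero_le_power2[of "norm (fst z)"] zero_le_power2[of "norm (snd z)"] by linarith+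
  then show "norm (fst z) < 1" "norm (snd z) < 1" by (simp_all add: abs_square_less_1)
qed

text \<open>Turning the pair by a right angle moves its first component from \<open>x\<close> to \<open>y\<close>. The turn is made in
\<open>N\<close> equal steps, and by rotation invariance each step contributes the same mean square; the Cauchy-Schwarz
inequality costs a factor \<open>N\<close>.\<close>

lemma rotation_increment_bound:
  fixes H :: "'a::euclidean_space \<Rightarrow> real" and N :: nat
  assumes [measurable]: "H \<in> borel_measurable borel" and K: "\<And>x. norm x < 1 \<Longrightarrow> \<bar>H x\<bar> \<le> K" and N: "N \<ge> 1"
  defines "\<delta> \<equiv> pi / (2 * N)"
  shows "(\<integral>z. indicator pair_disc z * (H (fst z) - H (snd z))\<^sup>2 \<partial>ball_pair)
      \<le> (real N)\<^sup>2 * (\<integral>z. indicator pair_disc z * (H (fst z) - H (fst (rotate_pair \<delta> z)))\<^sup>2 \<partial>ball_pair)"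
    (is "?lhs \<le> _ * ?rhs")
proof -
  let ?h = "\<lambda>k z. H (fst (rotate_pair (real k * \<delta>) z))"
  have hK: "\<bar>?h k z\<bar> \<le> K" if "z \<in> pair_disc" for k z
    using that by (intro K pair_disc_norm_less) (simp only: rotate_pair_disc)
  have dK: "\<bar>(?h k z - ?h l z)\<^sup>2\<bar> \<le> (2 * K)\<^sup>2" if "z \<in> pair_disc" for k l z
  proof -
    have "\<bar>?h k z - ?h l z\<bar> \<le> 2 * K" using hK[OF that, of k] hK[OF that, of l] by linarith
    from power_mono[OF this abs_ge_zero, of 2] show ?thesis by simp
  qed
  have int: "integrable ball_pair (\<lambda>z. indicator pair_disc z * (?h k z - ?h l z)\<^sup>2)" for k l
    by (rule integrable_pair_disc[OF _ dK]) measurable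
  have rot: "(\<integral>z. indicator pair_disc z * (?h k z - ?h (Suc k) z)\<^sup>2 \<partial>ball_pair) = ?rhs"
    if k: "k < N" for k
  proof -
    have "real k * \<delta> \<le> real N * \<delta>" using k by (intro mult_right_mono) (auto simp: \<delta>_def)
    also have "\<dots> = pi / 2" using N by (simp add: \<delta>_def)
    also have "\<dots> < pi" by simp
    finally have "0 \<le> real k * \<delta>" "real k * \<delta> < pi" by (auto simp: \<delta>_def)
    from integral_rotate_pair[OF _ this, of "\<lambda>z. (H (fst z) - H (fst (rotate_pair \<delta> z)))\<^sup>2"]
    show ?thesis
      by (simp add: rotate_pair_add distrib_right add.commute)
  qed
  have h0: "?h 0 z = H (fst z)" for z by (simp add: rotate_pair_def)
  have "real N * \<delta> = pi / 2" using N by (simp add: \<delta>_def)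
  then have hN: "?h N z = H (snd z)" for z by (simp only: rotate_pair_def fst_conv) simp
  \<comment> \<open>Telescoping along the turn and the Cauchy-Schwarz inequality for \<open>N\<close> summands.\<close>
  have pw: "(?h 0 z - ?h N z)\<^sup>2 \<le> real N * (\<Sum>k<N. (?h k z - ?h (Suc k) z)\<^sup>2)" for z
  proof -
    have "?h 0 z - ?h N z = (\<Sum>k<N. ?h k z - ?h (Suc k) z)"
      by (rule sum_lessThan_telescope'[symmetric])
    then show ?thesis
      using sum_squared_le_sum_of_squares[of "\<lambda>k. ?h k z - ?h (Suc k) z" "{..<N}"] by (simp add: mult.commute)
  qed
  have "?lhs = (\<integral>z. indicator pair_disc z * (?h 0 z - ?h N z)\<^sup>2 \<partial>ball_pair)"
    unfolding h0 hN ..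
  also have "\<dots> \<le> (\<integral>z. real N * (\<Sum>k<N. indicator pair_disc z * (?h k z - ?h (Suc k) z)\<^sup>2) \<partial>ball_pair)"
  proof (rule integral_mono[OF int])
    show "integrable ball_pair (\<lambda>z. real N * (\<Sum>k<N. indicator pair_disc z * (?h k z - ?h (Suc k) z)\<^sup>2))"
      by (intro integrable_mult_right Bochner_Integration.integrable_sum int)
    fix z
    show "indicator pair_disc z * (?h 0 z - ?h N z)\<^sup>2 \<le> real N * (\<Sum>k<N. indicator pair_disc z * (?h k z - ?h (Suc k) z)\<^sup>2)"
      using mult_left_mono[OF pw[of z], of "indicator pair_disc z"]
      by (simp only: sum_distrib_left[symmetric] mult.left_commute[of "real N"] indicator_pos_le)
  qed
  also have "\<dots> = real N * (\<Sum>k<N. (\<integral>z. indicator pair_disc z * (?h k z - ?h (Suc k) z)\<^sup>2 \<partial>ball_pair))"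
    by (simp only: integral_mult_right_zero Bochner_Integration.integral_sum[OF int])
  also have "\<dots> = real N * (\<Sum>k<N. ?rhs)"
    by (intro arg_cong2[where f = "(*)"] sum.cong rot refl) simp
  also have "\<dots> = (real N)\<^sup>2 * ?rhs" by (simp add: power2_eq_square)
  finally show ?thesis .
qed


lemma one_minus_cos_le: "\<bar>cos \<theta> - 1\<bar> \<le> \<bar>\<theta>\<bar>" for \<theta> :: real
proof -
  have "cos \<theta> = 1 - 2 * (sin (\<theta> / 2))\<^sup>2" using cos_double_sin[of "\<theta> / 2"] by simp
  then have "\<bar>cos \<theta> - 1\<bar> = 2 * (\<bar>sin (\<theta> / 2)\<bar> * \<bar>sin (\<theta> / 2)\<bar>)"
    by (simp add: power2_eq_square abs_mult[symmetric])
  also have "\<dots> \<le> 2 * (\<bar>\<theta> / 2\<bar> * 1)"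
    by (intro mult_left_mono mult_mono abs_sin_x_le_abs_x abs_sin_le_one) auto
  finally show ?thesis by simp
qed

lemma AE_pair_ball_fst: "AE z in (ball_pair :: ('a::euclidean_space \<times> 'a) measure). fst z \<noteq> 0"
proof -
  interpret B: prob_space "uniform_ball :: 'a measure" by (rule prob_space_uniform_ball)
  interpret P: pair_prob_space "uniform_ball :: 'a measure" "uniform_ball :: 'a measure" ..
  show ?thesis
  proof (rule P.AE_pair_measure)
    show "{z \<in> space (ball_pair :: ('a \<times> 'a) measure). fst z \<noteq> 0} \<in> sets ball_pair"
      by measurable
    show "AE x in (uniform_ball :: 'a measure). AE y in (uniform_ball :: 'a measure). fst (x, y) \<noteq> 0"
      using AE_uniform_ball by eventually_elim simp
  qed
qed

text \<open>The limit of the previous bound for \<open>N\<close> tending to infinity: \<open>N\<close> times the increment over the angle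
\<open>pi / (2 N)\<close> tends to \<open>pi / 2\<close> times the derivative of \<open>H\<close> at \<open>x\<close> in the direction \<open>y\<close>.\<close>

lemma rotation_energy_bound:
  fixes H :: "'a::euclidean_space \<Rightarrow> real"
  assumes lip: "\<And>x y. \<bar>H x - H y\<bar> \<le> C * norm (x - y)" and H0: "H 0 = 0" and C0: "0 \<le> C"
    and der: "\<And>x. x \<noteq> 0 \<Longrightarrow> (H has_derivative (\<lambda>h. n x \<bullet> h)) (at x)"
    and [measurable]: "n \<in> borel_measurable borel"
  shows "(\<integral>z. indicator pair_disc z * (H (fst z) - H (snd z))\<^sup>2 \<partial>ball_pair)
      \<le> (pi / 2)\<^sup>2 * (\<integral>z. indicator pair_disc z * (n (fst z) \<bullet> snd z)\<^sup>2 \<partial>ball_pair)"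
    (is "?lhs \<le> _")
proof -
  interpret P: prob_space "ball_pair :: ('a \<times> 'a) measure" by (rule prob_space_pair_ball)
  have "C-lipschitz_on UNIV H" using lip C0 by (auto simp: lipschitz_on_def dist_norm)
  then have [measurable]: "H \<in> borel_measurable borel"
    by (intro borel_measurable_continuous_onI lipschitz_on_continuous_on)
  define \<theta> where "\<theta> N = pi / (2 * real (Suc N))" for N
  have \<theta>0: "\<theta> \<longlonglongrightarrow> 0"
  proof -
    have "(\<lambda>N. pi / 2 * inverse (real (Suc N))) \<longlonglongrightarrow> pi / 2 * 0"
      by (intro tendsto_mult tendsto_const LIMSEQ_inverse_real_of_nat)
    then show ?thesis by (simp add: \<theta>_def[abs_def] field_simps)
  qed
  have \<theta>pos: "\<theta> N > 0" and N\<theta>: "real (Suc N) * \<theta> N = pi / 2" for N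
    unfolding \<theta>_def by (simp_all del: of_nat_Suc)
  let ?i = "\<lambda>z::'a \<times> 'a. indicator pair_disc z :: real"
  let ?d = "\<lambda>N z. (real (Suc N) * (H (fst z) - H (fst (rotate_pair (\<theta> N) z))))\<^sup>2"
  have lim: "(\<lambda>N. \<integral>z. ?i z * ?d N z \<partial>ball_pair)
      \<longlonglongrightarrow> (\<integral>z. ?i z * ((pi / 2) * (n (fst z) \<bullet> snd z))\<^sup>2 \<partial>ball_pair)"
  proof (rule integral_dominated_convergence[where w = "\<lambda>_. (pi * C)\<^sup>2"])
    show "AE z in ball_pair. (\<lambda>N. ?i z * ?d N z) \<longlonglongrightarrow> ?i z * ((pi / 2) * (n (fst z) \<bullet> snd z))\<^sup>2"
      using AE_pair_ball_fst
    proof eventually_elim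
      case (elim z)
      obtain x y where z: "z = (x, y)" by (cases z)
      have "((\<lambda>t. cos t *\<^sub>R x + sin t *\<^sub>R y) has_derivative (\<lambda>t. t *\<^sub>R y)) (at 0)"
        by (auto intro!: derivative_eq_intros)
      moreover have "(H has_derivative (\<lambda>h. n x \<bullet> h)) (at (cos 0 *\<^sub>R x + sin 0 *\<^sub>R y))"
        using der[of x] elim z by simp
      ultimately have "((\<lambda>t. H (cos t *\<^sub>R x + sin t *\<^sub>R y)) has_derivative (\<lambda>t. n x \<bullet> (t *\<^sub>R y))) (at 0)"
        by (rule has_derivative_compose)
      then have "((\<lambda>t. H (cos t *\<^sub>R x + sin t *\<^sub>R y)) has_real_derivative (n x \<bullet> y)) (at 0)"
        unfolding has_field_derivative_def by (rule has_derivative_eq_rhs) (simp add: fun_eq_iff mult.commute)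
      from tendsto_difference_quotient[OF this \<theta>0] \<theta>pos
      have "(\<lambda>N. (H (cos (\<theta> N) *\<^sub>R x + sin (\<theta> N) *\<^sub>R y) - H x) / \<theta> N) \<longlonglongrightarrow> n x \<bullet> y"
        by (simp add: less_imp_neq[symmetric])
      then have "(\<lambda>N. ?i z * (- (pi / 2) * ((H (cos (\<theta> N) *\<^sub>R x + sin (\<theta> N) *\<^sub>R y) - H x) / \<theta> N))\<^sup>2)
          \<longlonglongrightarrow> ?i z * (- (pi / 2) * (n x \<bullet> y))\<^sup>2"
        by (intro tendsto_intros)
      moreover have "- (pi / 2) * ((H (cos (\<theta> N) *\<^sub>R x + sin (\<theta> N) *\<^sub>R y) - H x) / \<theta> N)
          = real (Suc N) * (H x - H (fst (rotate_pair (\<theta> N) (x, y))))" for N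
        unfolding N\<theta>[symmetric, of N] using \<theta>pos[of N] by (simp add: rotate_pair_def field_simps)
      ultimately show ?case by (simp only: z fst_conv snd_conv) (simp add: power_mult_distrib)
    qed
    show "AE z in ball_pair. norm (?i z * ?d N z) \<le> (pi * C)\<^sup>2" for N
    proof (rule AE_I2)
      fix z :: "'a \<times> 'a"
      show "norm (?i z * ?d N z) \<le> (pi * C)\<^sup>2"
      proof (cases "z \<in> pair_disc")
        case True
        obtain x y where z: "z = (x, y)" by (cases z)
        have xy: "norm x \<le> 1" "norm y \<le> 1" using pair_disc_norm_less[OF True] z by auto
        have "x - fst (rotate_pair (\<theta> N) z) = - ((cos (\<theta> N) - 1) *\<^sub>R x + sin (\<theta> N) *\<^sub>R y)"
          by (simp add: z rotate_pair_def algebra_simps)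
        then have "norm (x - fst (rotate_pair (\<theta> N) z)) \<le> \<bar>cos (\<theta> N) - 1\<bar> * norm x + \<bar>sin (\<theta> N)\<bar> * norm y"
          by (metis norm_minus_cancel norm_scaleR norm_triangle_ineq)
        also have "\<dots> \<le> \<bar>\<theta> N\<bar> * 1 + \<bar>\<theta> N\<bar> * 1"
          by (intro add_mono mult_mono one_minus_cos_le abs_sin_x_le_abs_x xy) auto
        finally have "norm (x - fst (rotate_pair (\<theta> N) z)) \<le> 2 * \<theta> N" using \<theta>pos[of N] by simp
        then have "\<bar>H x - H (fst (rotate_pair (\<theta> N) z))\<bar> \<le> C * (2 * \<theta> N)"
          by (rule order_trans[OF lip mult_left_mono[OF _ C0]])
        then have "real (Suc N) * \<bar>H x - H (fst (rotate_pair (\<theta> N) z))\<bar> \<le> real (Suc N) * (C * (2 * \<theta> N))"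
          by (intro mult_left_mono) auto
        also have "\<dots> = 2 * C * (real (Suc N) * \<theta> N)" by (simp only: mult_ac)
        also have "\<dots> = pi * C" unfolding N\<theta> by simp
        finally have "\<bar>real (Suc N) * (H x - H (fst (rotate_pair (\<theta> N) z)))\<bar> \<le> pi * C"
          by (simp only: abs_mult abs_of_nat)
        from power_mono[OF this abs_ge_zero, of 2] show ?thesis
          using True by (simp add: z)
      qed simp
    qed
  qed measurable
  have "?lhs \<le> (\<integral>z. ?i z * ?d N z \<partial>ball_pair)" for N
  proof -
    have "\<bar>H x\<bar> \<le> C" if "norm x < 1" for x
    proof -
      have "\<bar>H x\<bar> \<le> C * norm x" using lip[of x 0] H0 by simp
      also have "\<dots> \<le> C * 1" using that C0 by (intro mult_left_mono) auto
      finally show ?thesis by simp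
    qed
    from rotation_increment_bound[of H C "Suc N", OF _ this]
    have "?lhs \<le> (real (Suc N))\<^sup>2 * (\<integral>z. ?i z * (H (fst z) - H (fst (rotate_pair (\<theta> N) z)))\<^sup>2 \<partial>ball_pair)"
      by (simp add: \<theta>_def)
    also have "\<dots> = (\<integral>z. (real (Suc N))\<^sup>2 * (?i z * (H (fst z) - H (fst (rotate_pair (\<theta> N) z)))\<^sup>2) \<partial>ball_pair)"
      by (simp only: integral_mult_right_zero)
    also have "\<dots> = (\<integral>z. ?i z * ?d N z \<partial>ball_pair)"
      by (simp only: power_mult_distrib mult.left_commute[of "(real (Suc N))\<^sup>2"])
    finally show ?thesis .
  qed
  then have "?lhs \<le> (\<integral>z. ?i z * ((pi / 2) * (n (fst z) \<bullet> snd z))\<^sup>2 \<partial>ball_pair)"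
    by (intro LIMSEQ_le_const[OF lim]) auto
  also have "\<dots> = (\<integral>z. (pi / 2)\<^sup>2 * (?i z * (n (fst z) \<bullet> snd z)\<^sup>2) \<partial>ball_pair)"
    by (simp only: power_mult_distrib mult.left_commute[of "(pi / 2)\<^sup>2"])
  also have "\<dots> = (pi / 2)\<^sup>2 * (\<integral>z. ?i z * (n (fst z) \<bullet> snd z)\<^sup>2 \<partial>ball_pair)"
    by (simp only: integral_mult_right_zero)
  finally show ?thesis .
qed

text \<open>With one component fixed, the section of \<open>pair_disc\<close> is a ball around the origin, so the direction of the
other component is still uniform and independent of its norm.\<close>

lemma integral_disc_section:
  fixes k :: "'a::euclidean_space \<Rightarrow> real" and x :: 'a
  assumes [measurable]: "k \<in> borel_measurable borel" and K: "\<And>u. norm u = 1 \<Longrightarrow> \<bar>k u\<bar> \<le> K"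
  shows "(\<integral>y. indicator pair_disc (x, y) * (norm y ^ p * k (y /\<^sub>R norm y)) \<partial>uniform_ball)
       = (\<integral>y. indicator pair_disc (x, y) * norm y ^ p \<partial>uniform_ball) * (\<integral>u. k u \<partial>uniform_sphere)"
proof -
  define a :: "real \<Rightarrow> real" where "a r = (if (norm x)\<^sup>2 + r\<^sup>2 < 1 then r ^ p else 0)" for r
  have [measurable]: "a \<in> borel_measurable borel" unfolding a_def[abs_def] by measurable
  have a: "indicator pair_disc (x, y) * norm y ^ p = a (norm y)" for y :: 'a
    by (simp add: a_def indicator_def)
  have a1: "\<bar>a r\<bar> \<le> 1" if "0 \<le> r" "r < 1" for r
    using that by (auto simp: a_def power_le_one)
  have "(\<integral>y. a (norm y) * k (y /\<^sub>R norm y) \<partial>uniform_ball)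
       = (\<integral>y. a (norm (y::'a)) \<partial>uniform_ball) * (\<integral>u. k u \<partial>uniform_sphere)"
    by (rule integral_polar[where a = a and k = k, OF _ _ a1 K]) measurable
  then show ?thesis by (simp only: a[symmetric] mult.assoc)
qed

lemma disc_second_moment_pos:
  "(\<integral>z. indicator pair_disc z * (norm (snd z))\<^sup>2 \<partial>(ball_pair :: ('a::euclidean_space \<times> 'a) measure)) > 0"
proof -
  interpret B: prob_space "uniform_ball :: 'a measure" by (rule prob_space_uniform_ball)
  interpret P: pair_prob_space "uniform_ball :: 'a measure" "uniform_ball :: 'a measure" ..
  let ?\<mu> = "ball_pair :: ('a \<times> 'a) measure"
  let ?f = "\<lambda>z::'a \<times> 'a. indicator pair_disc z * (norm (snd z))\<^sup>2 :: real"
  have int: "integrable ?\<mu> ?f"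
  proof (rule integrable_pair_disc)
    fix z :: "'a \<times> 'a" assume "z \<in> pair_disc"
    then show "\<bar>(norm (snd z))\<^sup>2\<bar> \<le> 1"
      using pair_disc_norm_less(2)[of z] by (simp add: power_le_one)
  qed measurable
  have nonneg: "?f z \<ge> 0" for z by simp
  have "(\<integral>z. ?f z \<partial>?\<mu>) \<noteq> 0"
  proof
    assume "(\<integral>z. ?f z \<partial>?\<mu>) = 0"
    then have "AE z in ?\<mu>. ?f z = 0"
      using integral_nonneg_eq_0_iff_AE[OF int] nonneg by simp
    moreover have "AE z in ?\<mu>. snd z \<noteq> 0"
    proof (rule P.AE_pair_measure)
      show "{z \<in> space ?\<mu>. snd z \<noteq> 0} \<in> sets ?\<mu>" by measurable
      show "AE x in (uniform_ball :: 'a measure). AE y in (uniform_ball :: 'a measure). snd (x, y) \<noteq> 0"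
      proof (rule AE_I2)
        fix x :: 'a
        show "AE y in (uniform_ball :: 'a measure). snd (x, y) \<noteq> 0"
          using AE_uniform_ball by eventually_elim simp
      qed
    qed
    ultimately have out: "AE z in ?\<mu>. z \<notin> pair_disc"
      by eventually_elim (auto simp: indicator_def)
    let ?h = "{v::'a. norm v < 1 / 2}"
    have h: "?h \<in> sets uniform_ball" by simp
    have "norm x ^ 2 + norm y ^ 2 < 1" if "x \<in> ?h" "y \<in> ?h" for x y
    proof -
      have "norm x ^ 2 \<le> (1/2)^2" "norm y ^ 2 \<le> (1/2)^2" using that by (auto intro!: power_mono)
      then show ?thesis by (simp add: power2_eq_square)
    qed
    then have "?h \<times> ?h \<subseteq> pair_disc" by auto
    with out have "AE z in ?\<mu>. z \<notin> ?h \<times> ?h" by (auto elim!: eventually_mono)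
    then have "emeasure ?\<mu> (?h \<times> ?h) = 0"
      using h by (subst (asm) AE_iff_measurable[where N = "?h \<times> ?h"]) (auto simp: space_pair_measure)
    moreover have "emeasure ?\<mu> (?h \<times> ?h) = emeasure uniform_ball ?h * emeasure uniform_ball ?h"
      by (rule B.emeasure_pair_measure_Times[OF h h])
    moreover have "emeasure uniform_ball ?h = ennreal ((1/2) ^ DIM('a))"
      using prob_uniform_ball_less[where ?'a = 'a, of "1/2"] by (simp add: B.emeasure_eq_measure)
    ultimately show False by (simp del: emeasure_uniform_measure)
  qed
  moreover have "(\<integral>z. ?f z \<partial>?\<mu>) \<ge> 0" by (rule integral_nonneg_AE) (simp add: nonneg)
  ultimately show ?thesis by linarith
qed

text \<open>The rotation argument of Maurey and Pisier, applied to the radial extension \<open>H\<close> of \<open>\<rho>\<close>. Because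
\<open>\<rho>\<close> has mean zero, \<open>H x\<close> and \<open>H y\<close> are orthogonal, so the mean square of \<open>H x - H y\<close> is twice
that of \<open>H x\<close>. On the other side, \<open>y\<close> has an isotropic direction given \<open>x\<close>, which yields the
factor \<open>1 / DIM('a)\<close>. The second moment of the norm occurs on both sides and cancels.\<close>

theorem sphere_poincare:
  fixes \<rho> :: "'a::euclidean_space \<Rightarrow> real"
  assumes lip: "C-lipschitz_on (sphere 0 1) \<rho>"
    and der: "\<And>u. norm u = 1 \<Longrightarrow> (\<rho> has_derivative (\<lambda>h. g u \<bullet> h)) (at u)"
    and [measurable]: "\<rho> \<in> borel_measurable borel" "g \<in> borel_measurable borel"
    and mean: "(\<integral>u. \<rho> u \<partial>uniform_sphere) = 0"
    and B: "\<And>u. norm u = 1 \<Longrightarrow> (\<rho> u)\<^sup>2 + (norm (g u))\<^sup>2 \<le> B\<^sup>2" and B0: "0 \<le> B"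
  shows "(\<integral>u. (\<rho> u)\<^sup>2 \<partial>uniform_sphere) \<le> pi\<^sup>2 / 8 * (B\<^sup>2 / DIM('a))"
proof -
  interpret M: prob_space "uniform_ball :: 'a measure" by (rule prob_space_uniform_ball)
  interpret P: pair_prob_space "uniform_ball :: 'a measure" "uniform_ball :: 'a measure" ..
  let ?\<mu> = "ball_pair :: ('a \<times> 'a) measure"
  let ?i = "\<lambda>z::'a \<times> 'a. indicator pair_disc z :: real"
  define H where "H = radial_extension \<rho>"
  define n where "n x = radial_gradient \<rho> g (x /\<^sub>R norm x)" for x
  define A where "A = (\<integral>z. ?i z * (norm (snd z))\<^sup>2 \<partial>?\<mu>)"
  define V where "V = (\<integral>u. (\<rho> u)\<^sup>2 \<partial>uniform_sphere)"
  have [measurable]: "n \<in> borel_measurable borel"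
    unfolding n_def[abs_def] radial_gradient_def by measurable
  have [measurable]: "H \<in> borel_measurable borel"
    unfolding H_def radial_extension_def[abs_def] by measurable
  have \<rho>B: "\<bar>\<rho> u\<bar> \<le> B" if "norm u = 1" for u
  proof -
    have "\<bar>\<rho> u\<bar>\<^sup>2 \<le> B\<^sup>2" using B[OF that] zero_le_power2[of "norm (g u)"] unfolding power2_abs by linarith
    then show ?thesis using B0 by (rule power2_le_imp_le)
  qed
  have C0: "0 \<le> C" using lip by (auto simp: lipschitz_on_def)
  have Hlip: "\<bar>H x - H y\<bar> \<le> (B + 2 * C) * norm (x - y)" for x y
    unfolding H_def using lip \<rho>B by (rule radial_extension_lipschitz)
  have H0: "H 0 = 0" by (simp add: H_def radial_extension_def)
  have HK: "\<bar>H x\<bar> \<le> B" if "norm x < 1" for x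
  proof (cases "x = 0")
    case False
    have "norm x * \<bar>\<rho> (x /\<^sub>R norm x)\<bar> \<le> 1 * B" using that False by (intro mult_mono \<rho>B) auto
    then show ?thesis by (simp add: H_def radial_extension_def abs_mult)
  qed (use H0 B0 in simp)
  have H1: "\<bar>H (fst z)\<bar> \<le> B" "\<bar>H (snd z)\<bar> \<le> B" if "z \<in> pair_disc" for z
    using pair_disc_norm_less[OF that] by (auto intro: HK)
  have iA: "integrable ?\<mu> (\<lambda>z. ?i z * (norm (snd z))\<^sup>2)"
  proof (rule integrable_pair_disc)
    fix z :: "'a \<times> 'a" assume "z \<in> pair_disc"
    then show "\<bar>(norm (snd z))\<^sup>2\<bar> \<le> 1"
      using pair_disc_norm_less(2)[of z] by (simp add: power_le_one)
  qed measurable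
  have sq: "\<bar>a\<^sup>2\<bar> \<le> B\<^sup>2" if "\<bar>a\<bar> \<le> B" for a :: real
    using power_mono[OF that abs_ge_zero, of 2] by simp
  have i1: "integrable ?\<mu> (\<lambda>z. ?i z * (H (fst z))\<^sup>2)"
    by (rule integrable_pair_disc[OF _ sq[OF H1(1)]]) measurable
  have i2: "integrable ?\<mu> (\<lambda>z. ?i z * (H (snd z))\<^sup>2)"
    by (rule integrable_pair_disc[OF _ sq[OF H1(2)]]) measurable
  have i3: "integrable ?\<mu> (\<lambda>z. ?i z * (H (fst z) * H (snd z)))"
  proof (rule integrable_pair_disc)
    fix z :: "'a \<times> 'a" assume "z \<in> pair_disc"
    from H1[OF this] show "\<bar>H (fst z) * H (snd z)\<bar> \<le> B * B"
      unfolding abs_mult using B0 by (intro mult_mono) auto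
  qed measurable
  have cross: "(\<integral>z. ?i z * (H (fst z) * H (snd z)) \<partial>?\<mu>) = 0"
  proof -
    have "(\<integral>y. ?i (x, y) * (H x * H y) \<partial>uniform_ball) = 0" for x
    proof -
      have "(\<integral>y. ?i (x, y) * (H x * H y) \<partial>uniform_ball)
          = (\<integral>y. H x * (?i (x, y) * (norm y ^ 1 * \<rho> (y /\<^sub>R norm y))) \<partial>uniform_ball)"
        by (simp only: H_def radial_extension_def power_one_right mult_ac)
      also have "\<dots> = H x * (\<integral>y. ?i (x, y) * (norm y ^ 1 * \<rho> (y /\<^sub>R norm y)) \<partial>uniform_ball)"
        by (simp only: integral_mult_right_zero)
      also have "\<dots> = 0"
        by (subst integral_disc_section[OF _ \<rho>B]) (measurable, simp add: mean)
      finally show ?thesis .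
    qed
    then show ?thesis
      by (simp only: P.integral_fst'[OF i3, symmetric] fst_conv snd_conv Bochner_Integration.integral_zero)
  qed
  have snd_part: "(\<integral>z. ?i z * (H (snd z))\<^sup>2 \<partial>?\<mu>) = A * V"
  proof -
    have "(\<integral>y. ?i (x, y) * (H y)\<^sup>2 \<partial>uniform_ball) = (\<integral>y. ?i (x, y) * (norm y)\<^sup>2 \<partial>uniform_ball) * V" for x
    proof -
      have "(\<integral>y. ?i (x, y) * (H y)\<^sup>2 \<partial>uniform_ball)
          = (\<integral>y. ?i (x, y) * ((norm y)\<^sup>2 * (\<rho> (y /\<^sub>R norm y))\<^sup>2) \<partial>uniform_ball)"
        by (simp only: H_def radial_extension_def power_mult_distrib)
      also have "\<dots> = (\<integral>y. ?i (x, y) * (norm y)\<^sup>2 \<partial>uniform_ball) * V"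
        unfolding V_def by (rule integral_disc_section[OF _ sq[OF \<rho>B]]) measurable
      finally show ?thesis .
    qed
    then show ?thesis
      unfolding A_def
      by (simp only: P.integral_fst'[OF i2, symmetric] P.integral_fst'[OF iA, symmetric] fst_conv snd_conv integral_mult_left_zero)
  qed
  have fst_part: "(\<integral>z. ?i z * (H (fst z))\<^sup>2 \<partial>?\<mu>) = A * V"
  proof -
    have "(\<integral>z. ?i z * (H (fst (rotate_pair (pi / 2) z)))\<^sup>2 \<partial>?\<mu>) = (\<integral>z. ?i z * (H (fst z))\<^sup>2 \<partial>?\<mu>)"
      by (rule integral_rotate_pair[of "\<lambda>z. (H (fst z))\<^sup>2"], measurable)
    then show ?thesis using snd_part by (simp add: rotate_pair_def)
  qed
  have nB: "norm (n x) \<le> B" if "x \<noteq> 0" for x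
    unfolding n_def
  proof (rule power2_le_imp_le[OF norm_radial_gradient B0])
    show "norm (x /\<^sub>R norm x) = 1" using that by simp
    then show "(\<rho> (x /\<^sub>R norm x))\<^sup>2 + (norm (g (x /\<^sub>R norm x)))\<^sup>2 \<le> B\<^sup>2" by (rule B)
  qed
  have energy: "(\<integral>z. ?i z * (n (fst z) \<bullet> snd z)\<^sup>2 \<partial>?\<mu>) \<le> A * (B\<^sup>2 / DIM('a))"
  proof -
    \<comment> \<open>At the origin the direction is not a unit vector and there is no bound on the gradient; a null set.\<close>
    define n' where "n' x = (if x = 0 then 0 else n x)" for x
    have [measurable]: "n' \<in> borel_measurable borel" unfolding n'_def[abs_def] by measurable
    have n'B: "norm (n' x) \<le> B" for x using nB[of x] B0 by (auto simp: n'_def)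
    have i4: "integrable ?\<mu> (\<lambda>z. ?i z * (n' (fst z) \<bullet> snd z)\<^sup>2)"
    proof (rule integrable_pair_disc[OF _ sq])
      fix z :: "'a \<times> 'a" assume "z \<in> pair_disc"
      then have "norm (n' (fst z)) * norm (snd z) \<le> B * 1"
        using pair_disc_norm_less(2)[of z] n'B B0 by (intro mult_mono) auto
      then show "\<bar>n' (fst z) \<bullet> snd z\<bar> \<le> B" using Cauchy_Schwarz_ineq2[of "n' (fst z)" "snd z"] by linarith
    qed measurable
    have inner: "(\<integral>y. ?i (x, y) * (n' x \<bullet> y)\<^sup>2 \<partial>uniform_ball)
       \<le> (\<integral>y. ?i (x, y) * (norm y)\<^sup>2 \<partial>uniform_ball) * (B\<^sup>2 / DIM('a))" for x
    proof -
      have pt: "(n' x \<bullet> y)\<^sup>2 = (norm y)\<^sup>2 * (n' x \<bullet> (y /\<^sub>R norm y))\<^sup>2" for y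
        by (cases "y = 0") (simp_all add: power_mult_distrib power_inverse)
      have k1: "\<bar>(n' x \<bullet> u)\<^sup>2\<bar> \<le> (norm (n' x))\<^sup>2" if "norm u = 1" for u
        using power_mono[OF Cauchy_Schwarz_ineq2[of "n' x" u] abs_ge_zero, of 2] that by simp
      have "(\<integral>u. (n' x \<bullet> u)\<^sup>2 \<partial>uniform_sphere) = (n' x \<bullet> n' x) / DIM('a)"
        using integral_uniform_sphere_inner_mult[of "n' x" "n' x"] by (simp add: power2_eq_square inner_commute)
      also have "\<dots> \<le> B\<^sup>2 / DIM('a)"
        using power_mono[OF n'B, of x 2] by (intro divide_right_mono) (simp_all add: power2_norm_eq_inner[symmetric])
      finally have k2: "(\<integral>u. (n' x \<bullet> u)\<^sup>2 \<partial>uniform_sphere) \<le> B\<^sup>2 / DIM('a)" .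
      have "(\<integral>y. ?i (x, y) * (n' x \<bullet> y)\<^sup>2 \<partial>uniform_ball)
        = (\<integral>y. ?i (x, y) * ((norm y)\<^sup>2 * (n' x \<bullet> (y /\<^sub>R norm y))\<^sup>2) \<partial>uniform_ball)"
        by (simp only: pt[symmetric])
      also have "\<dots> = (\<integral>y. ?i (x, y) * (norm y)\<^sup>2 \<partial>uniform_ball) * (\<integral>u. (n' x \<bullet> u)\<^sup>2 \<partial>uniform_sphere)"
        by (rule integral_disc_section[OF _ k1]) measurable
      also have "\<dots> \<le> (\<integral>y. ?i (x, y) * (norm y)\<^sup>2 \<partial>uniform_ball) * (B\<^sup>2 / DIM('a))"
        by (rule mult_left_mono[OF k2], rule integral_nonneg_AE) simp
      finally show ?thesis .
    qed
    have "(\<integral>z. ?i z * (n (fst z) \<bullet> snd z)\<^sup>2 \<partial>?\<mu>) = (\<integral>z. ?i z * (n' (fst z) \<bullet> snd z)\<^sup>2 \<partial>?\<mu>)"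
    proof (rule integral_cong_AE)
      show "AE z in ?\<mu>. ?i z * (n (fst z) \<bullet> snd z)\<^sup>2 = ?i z * (n' (fst z) \<bullet> snd z)\<^sup>2"
        using AE_pair_ball_fst by eventually_elim (simp add: n'_def)
    qed measurable
    also have "\<dots> = (\<integral>x. \<integral>y. ?i (x, y) * (n' x \<bullet> y)\<^sup>2 \<partial>uniform_ball \<partial>uniform_ball)"
      by (simp only: P.integral_fst'[OF i4, symmetric] fst_conv snd_conv)
    also have "\<dots> \<le> (\<integral>x. (\<integral>y. ?i (x, y) * (norm y)\<^sup>2 \<partial>uniform_ball) * (B\<^sup>2 / DIM('a)) \<partial>uniform_ball)"
    proof (rule integral_mono[OF _ _ inner])
      show "integrable uniform_ball (\<lambda>x. \<integral>y. ?i (x, y) * (n' x \<bullet> y)\<^sup>2 \<partial>uniform_ball)"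
        using P.integrable_fst'[OF i4] by simp
      show "integrable uniform_ball (\<lambda>x. (\<integral>y. ?i (x, y) * (norm y)\<^sup>2 \<partial>uniform_ball) * (B\<^sup>2 / DIM('a)))"
        using P.integrable_fst'[OF iA] by (intro integrable_mult_left) simp
    qed
    also have "\<dots> = A * (B\<^sup>2 / DIM('a))"
      unfolding A_def by (simp only: P.integral_fst'[OF iA, symmetric] fst_conv snd_conv integral_mult_left_zero)
    finally show ?thesis .
  qed
  have "2 * (A * V) = (\<integral>z. ?i z * (H (fst z) - H (snd z))\<^sup>2 \<partial>?\<mu>)"
  proof -
    have "(\<integral>z. ?i z * (H (fst z) - H (snd z))\<^sup>2 \<partial>?\<mu>)
      = (\<integral>z. (?i z * (H (fst z))\<^sup>2 + ?i z * (H (snd z))\<^sup>2) - 2 * (?i z * (H (fst z) * H (snd z))) \<partial>?\<mu>)"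
      by (rule Bochner_Integration.integral_cong) (simp_all add: power2_diff algebra_simps)
    also have "\<dots> = A * V + A * V - 2 * 0"
      by (simp only: Bochner_Integration.integral_diff[OF Bochner_Integration.integrable_add[OF i1 i2] integrable_mult_right[OF i3]]
          Bochner_Integration.integral_add[OF i1 i2] integral_mult_right_zero cross fst_part snd_part)
    finally show ?thesis by simp
  qed
  also have "\<dots> \<le> (pi / 2)\<^sup>2 * (\<integral>z. ?i z * (n (fst z) \<bullet> snd z)\<^sup>2 \<partial>?\<mu>)"
  proof (rule rotation_energy_bound[OF Hlip H0])
    show "(H has_derivative (\<lambda>h. n x \<bullet> h)) (at x)" if "x \<noteq> 0" for x
      unfolding H_def n_def using that by (intro radial_extension_deriv der) auto
  qed (use B0 C0 in simp_all)
  also have "\<dots> \<le> (pi / 2)\<^sup>2 * (A * (B\<^sup>2 / DIM('a)))"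
    by (rule mult_left_mono[OF energy]) simp
  finally have "A * (2 * V) \<le> A * ((pi / 2)\<^sup>2 * (B\<^sup>2 / DIM('a)))" by (simp only: mult_ac)
  moreover have "A > 0" unfolding A_def by (rule disc_second_moment_pos)
  ultimately have "2 * V \<le> (pi / 2)\<^sup>2 * (B\<^sup>2 / DIM('a))" by (simp only: mult_le_cancel_left_pos)
  then show ?thesis by (simp add: V_def power_divide)
qed

section \<open>Smooth convex functions\<close>

lemma has_derivative_along_line_at:
  fixes f :: "'a::euclidean_space \<Rightarrow> real"
  assumes "\<And>x. (f has_derivative (\<lambda>h. gf x \<bullet> h)) (at x)"
  shows "((\<lambda>t. f (x + t *\<^sub>R h)) has_real_derivative (gf (x + t *\<^sub>R h) \<bullet> h)) (at t)"
proof -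
  have "((\<lambda>t. f (x + t *\<^sub>R h)) has_derivative (\<lambda>s. gf (x + t *\<^sub>R h) \<bullet> (s *\<^sub>R h))) (at t)"
    by (rule has_derivative_compose[OF _ assms]) (auto intro!: derivative_eq_intros)
  then show ?thesis
    unfolding has_field_derivative_def by (rule has_derivative_eq_rhs) (simp add: fun_eq_iff mult.commute)
qed

lemma smooth_upper_bound:
  fixes f :: "'a::euclidean_space \<Rightarrow> real"
  assumes der: "\<And>x. (f has_derivative (\<lambda>h. gf x \<bullet> h)) (at x)"
    and lip: "\<And>x y. norm (gf x - gf y) \<le> L * norm (x - y)"
  shows "f (x + h) \<le> f x + gf x \<bullet> h + L / 2 * (norm h)\<^sup>2"
proof -
  let ?\<phi> = "\<lambda>t. f (x + t *\<^sub>R h) - t * (gf x \<bullet> h) - L / 2 * (norm h)\<^sup>2 * t\<^sup>2"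
  have "?\<phi> 1 \<le> ?\<phi> 0"
  proof (rule DERIV_nonpos_imp_nonincreasing[of 0 1 ?\<phi>])
    fix t :: real assume t: "0 \<le> t" "t \<le> 1"
    have "(?\<phi> has_real_derivative (gf (x + t *\<^sub>R h) \<bullet> h - gf x \<bullet> h - L / 2 * (norm h)\<^sup>2 * (2 * t))) (at t)"
      by (auto intro!: derivative_eq_intros has_derivative_along_line_at der)
    moreover have "gf (x + t *\<^sub>R h) \<bullet> h - gf x \<bullet> h - L / 2 * (norm h)\<^sup>2 * (2 * t) \<le> 0"
    proof -
      have "gf (x + t *\<^sub>R h) \<bullet> h - gf x \<bullet> h \<le> norm (gf (x + t *\<^sub>R h) - gf x) * norm h"
        using norm_cauchy_schwarz[of "gf (x + t *\<^sub>R h) - gf x" h] by (simp add: inner_diff_left)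
      also have "\<dots> \<le> (L * norm (x + t *\<^sub>R h - x)) * norm h" by (intro mult_right_mono lip) auto
      also have "\<dots> = L * (norm h)\<^sup>2 * t" using t by (simp add: power2_eq_square)
      finally show ?thesis by simp
    qed
    ultimately show "\<exists>y. (?\<phi> has_real_derivative y) (at t) \<and> y \<le> 0" by blast
  qed simp
  then show ?thesis by simp
qed

lemma smooth_lower_bound:
  fixes f :: "'a::euclidean_space \<Rightarrow> real"
  assumes der: "\<And>x. (f has_derivative (\<lambda>h. gf x \<bullet> h)) (at x)"
    and lip: "\<And>x y. norm (gf x - gf y) \<le> L * norm (x - y)"
  shows "f x + gf x \<bullet> h - L / 2 * (norm h)\<^sup>2 \<le> f (x + h)"
proof -
  have "((\<lambda>x. - f x) has_derivative (\<lambda>h. (- gf x) \<bullet> h)) (at x)" for x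
    by (rule has_derivative_eq_rhs[OF has_derivative_minus[OF der]]) simp
  moreover have "norm (- gf x - - gf y) \<le> L * norm (x - y)" for x y
    using lip[of y x] by (simp add: norm_minus_commute)
  ultimately have "- f (x + h) \<le> - f x + (- gf x) \<bullet> h + L / 2 * (norm h)\<^sup>2"
    by (rule smooth_upper_bound)
  then show ?thesis by simp
qed

text \<open>Convexity bounds every difference quotient along the segment from \<open>x\<close> to \<open>y\<close> by \<open>f y - f x\<close>.\<close>

lemma convex_above_tangent:
  fixes f :: "'a::euclidean_space \<Rightarrow> real"
  assumes conv: "convex_on UNIV f" and der: "(f has_derivative (\<lambda>h. g \<bullet> h)) (at x)"
  shows "f x + g \<bullet> (y - x) \<le> f y"
proof -
  let ?X = "\<lambda>n. inverse (real (Suc n))"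
  have "(\<lambda>n. (f (x + ?X n *\<^sub>R (y - x)) - f (x + 0 *\<^sub>R (y - x))) / ?X n) \<longlonglongrightarrow> g \<bullet> (y - x)"
    by (rule tendsto_difference_quotient[OF has_derivative_along_line[OF der] LIMSEQ_inverse_real_of_nat]) simp
  moreover have "(f (x + ?X n *\<^sub>R (y - x)) - f (x + 0 *\<^sub>R (y - x))) / ?X n \<le> f y - f x" for n
  proof -
    have X: "0 < ?X n" "?X n \<le> 1" by (simp_all add: inverse_le_1_iff)
    have "f ((1 - ?X n) *\<^sub>R x + ?X n *\<^sub>R y) \<le> (1 - ?X n) * f x + ?X n * f y"
      using convex_onD[OF conv, of "?X n" x y] X by simp
    moreover have "(1 - ?X n) *\<^sub>R x + ?X n *\<^sub>R y = x + ?X n *\<^sub>R (y - x)" by (simp add: algebra_simps)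
    ultimately have "f (x + ?X n *\<^sub>R (y - x)) - f x \<le> (f y - f x) * ?X n" by (simp add: algebra_simps)
    then have "(f (x + ?X n *\<^sub>R (y - x)) - f x) / ?X n \<le> f y - f x" using X(1) by (simp only: pos_divide_le_eq)
    then show ?thesis by simp
  qed
  ultimately have "g \<bullet> (y - x) \<le> f y - f x" by (auto intro: LIMSEQ_le_const2)
  then show ?thesis by simp
qed

lemma integrable_inner_uniform_sphere:
  "integrable uniform_sphere (\<lambda>u::'a::euclidean_space. a \<bullet> u)"
proof (rule integrable_uniform_sphere_bounded)
  fix u :: 'a assume "norm u = 1"
  then show "\<bar>a \<bullet> u\<bar> \<le> norm a" using Cauchy_Schwarz_ineq2[of a u] by simp
qed measurable

locale smooth_convex =
  fixes f :: "'a::euclidean_space \<Rightarrow> real" and gf :: "'a \<Rightarrow> 'a" and L L0 :: real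
  assumes der: "\<And>x. (f has_derivative (\<lambda>h. gf x \<bullet> h)) (at x)"
    and grad_lipschitz: "\<And>x y. norm (gf x - gf y) \<le> L * norm (x - y)"
    and convex: "convex_on UNIV f"
    and lipschitz: "L0-lipschitz_on UNIV f"
    and L_pos: "L > 0"
begin

lemma descent: "f y \<le> f x + gf x \<bullet> (y - x) + L / 2 * (norm (y - x))\<^sup>2"
  using smooth_upper_bound[of f gf L x "y - x", OF der grad_lipschitz] by simp

lemma tangent: "f x + gf x \<bullet> (y - x) \<le> f y"
  by (rule convex_above_tangent[OF convex der])

text \<open>The tangent at \<open>x\<close> lies below \<open>f\<close> everywhere, in particular at the point reached from \<open>y\<close> by a gradient
step of length \<open>1 / L\<close> for \<open>f\<close> minus the tangent; that step decreases the difference by the stated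
amount.\<close>

lemma cocoercive_tangent: "f x + gf x \<bullet> (y - x) + (norm (gf y - gf x))\<^sup>2 / (2 * L) \<le> f y"
proof -
  define w where "w = gf y - gf x"
  define z where "z = y - (1 / L) *\<^sub>R w"
  have zy: "z - y = - ((1 / L) *\<^sub>R w)" by (simp add: z_def)
  have zx: "z - x = (y - x) - (1 / L) *\<^sub>R w" by (simp add: z_def)
  have "f x + gf x \<bullet> (z - x) \<le> f y + gf y \<bullet> (z - y) + L / 2 * (norm (z - y))\<^sup>2"
    using tangent[of x z] descent[of z y] by linarith
  moreover have "L / 2 * (norm (z - y))\<^sup>2 = (w \<bullet> w) / (2 * L)"
    unfolding zy using L_pos by (simp add: power_mult_distrib power_divide power2_norm_eq_inner) (simp add: power2_eq_square field_simps)
  moreover have "gf y \<bullet> (z - y) - gf x \<bullet> (z - x) = - (gf x \<bullet> (y - x)) - (w \<bullet> w) / L"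
  proof -
    have "gf y \<bullet> (z - y) - gf x \<bullet> (z - x) = - (gf x \<bullet> (y - x)) - (gf y \<bullet> w - gf x \<bullet> w) / L"
      unfolding zy zx by (simp add: inner_diff_right diff_divide_distrib)
    then show ?thesis by (simp add: w_def inner_diff_left)
  qed
  moreover have "(w \<bullet> w) / L = 2 * ((w \<bullet> w) / (2 * L))" by simp
  ultimately show ?thesis unfolding power2_norm_eq_inner w_def[symmetric] by linarith
qed

lemma cocoercive: "(norm (gf y - gf x))\<^sup>2 \<le> L * ((gf y - gf x) \<bullet> (y - x))"
proof -
  have "(norm (gf y - gf x))\<^sup>2 / (2 * L) + (norm (gf x - gf y))\<^sup>2 / (2 * L) \<le> - (gf x \<bullet> (y - x)) - gf y \<bullet> (x - y)"
    using cocoercive_tangent[of x y] cocoercive_tangent[of y x] by linarith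
  also have "\<dots> = (gf y - gf x) \<bullet> (y - x)" by (simp add: inner_diff_left inner_diff_right)
  finally have "(norm (gf y - gf x))\<^sup>2 / L \<le> (gf y - gf x) \<bullet> (y - x)"
    by (simp add: norm_minus_commute[of "gf x"])
  then show ?thesis using L_pos by (simp add: divide_le_eq mult.commute)
qed

text \<open>Otherwise a gradient step of length \<open>1 / L\<close> would decrease \<open>f\<close> below its minimum.\<close>

lemma gradient_at_minimizer:
  assumes "\<And>y. f xs \<le> f y" shows "gf xs = 0"
proof -
  have "f xs \<le> f xs + gf xs \<bullet> (- (1 / L) *\<^sub>R gf xs) + L / 2 * (norm (- (1 / L) *\<^sub>R gf xs))\<^sup>2"
    using descent[of "xs + - (1 / L) *\<^sub>R gf xs" xs] assms[of "xs + - (1 / L) *\<^sub>R gf xs"] by simp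
  also have "\<dots> = f xs - (gf xs \<bullet> gf xs) / (2 * L)"
    using L_pos by (simp add: power_mult_distrib power_divide power2_norm_eq_inner) (simp add: power2_eq_square field_simps)
  finally have "gf xs \<bullet> gf xs \<le> 0" using L_pos by (simp add: divide_le_0_iff zero_le_divide_iff)
  then show ?thesis by (metis inner_eq_zero_iff inner_ge_zero order_antisym)
qed

lemma continuous_gradient: "continuous_on UNIV gf"
proof -
  have "L-lipschitz_on UNIV gf"
    using grad_lipschitz L_pos by (auto simp: lipschitz_on_def dist_norm)
  then show ?thesis by (rule lipschitz_on_continuous_on)
qed

lemma measurable_f [measurable]: "f \<in> borel_measurable borel"
  using lipschitz by (intro borel_measurable_continuous_onI lipschitz_on_continuous_on)

lemma measurable_gradient [measurable]: "gf \<in> borel_measurable borel"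
  using continuous_gradient by (rule borel_measurable_continuous_onI)

lemma lipschitzD: "\<bar>f x - f y\<bar> \<le> L0 * norm (x - y)"
  using lipschitz by (auto simp: lipschitz_on_def dist_norm)

lemma L0_nonneg: "0 \<le> L0"
  using lipschitz by (auto simp: lipschitz_on_def)

lemma norm_gradient_le: "norm (gf x) \<le> L0"
  by (rule norm_gradient_le_lipschitz[OF lipschitz der])

section \<open>Averages over the ball and over the sphere\<close>

definition ball_gradient :: "real \<Rightarrow> 'a \<Rightarrow> 'a" where
  "ball_gradient \<alpha> x = (\<integral>v. gf (x + \<alpha> *\<^sub>R v) \<partial>uniform_ball)"

definition sphere_mean :: "real \<Rightarrow> 'a \<Rightarrow> real" where
  "sphere_mean \<alpha> x = (\<integral>u. f (x + \<alpha> *\<^sub>R u) \<partial>uniform_sphere)"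

definition sphere_variance :: "real \<Rightarrow> 'a \<Rightarrow> real" where
  "sphere_variance \<alpha> x = (\<integral>u. (f (x + \<alpha> *\<^sub>R u) - sphere_mean \<alpha> x)\<^sup>2 \<partial>uniform_sphere)"

lemma integrable_ball_gradient: "integrable uniform_ball (\<lambda>v. gf (x + \<alpha> *\<^sub>R v))"
proof -
  interpret prob_space "uniform_ball :: 'a measure" by (rule prob_space_uniform_ball)
  show ?thesis by (rule integrable_const_bound[where B = L0]) (auto intro: norm_gradient_le)
qed

lemma ball_gradient_inner: "ball_gradient \<alpha> x \<bullet> w = (\<integral>v. gf (x + \<alpha> *\<^sub>R v) \<bullet> w \<partial>uniform_ball)"
  unfolding ball_gradient_def by (rule integral_inner_left[symmetric]) (rule integrable_ball_gradient)

text \<open>The cocoercive tangent inequality is used at the points \<open>x + \<alpha> v\<close> of the ball, not at \<open>x\<close>, because it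
is the average of the gradient over the ball that the estimator sees. The return from \<open>x + \<alpha> v\<close> to \<open>x\<close>
costs \<open>L \<alpha>\<^sup>2 / 2\<close>, and the surplus survives averaging by the convexity of the square.\<close>

lemma ball_gradient_descent:
  assumes \<alpha>: "0 \<le> \<alpha>" and min: "\<And>y. f xs \<le> f y"
  shows "f x - f xs - L * \<alpha>\<^sup>2 / 2 + (norm (ball_gradient \<alpha> x))\<^sup>2 / (2 * L) \<le> ball_gradient \<alpha> x \<bullet> (x - xs)"
proof -
  interpret prob_space "uniform_ball :: 'a measure" by (rule prob_space_uniform_ball)
  define p where "p = ball_gradient \<alpha> x"
  have gs: "gf xs = 0" using min by (rule gradient_at_minimizer)
  have int: "integrable uniform_ball (\<lambda>v. gf (x + \<alpha> *\<^sub>R v) \<bullet> w)" for w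
    by (rule integrable_inner_left) (rule integrable_ball_gradient)
  have pt: "f x - f xs - L * \<alpha>\<^sup>2 / 2 - (p \<bullet> p) / (2 * L) \<le> gf (x + \<alpha> *\<^sub>R v) \<bullet> (x - xs - (1 / L) *\<^sub>R p)"
    if v: "norm v < 1" for v
  proof -
    define g where "g = gf (x + \<alpha> *\<^sub>R v)"
    have 1: "f (x + \<alpha> *\<^sub>R v) + g \<bullet> (xs - x - \<alpha> *\<^sub>R v) + (g \<bullet> g) / (2 * L) \<le> f xs"
      using cocoercive_tangent[of "x + \<alpha> *\<^sub>R v" xs] gs by (simp add: g_def power2_norm_eq_inner diff_diff_eq)
    have "f x \<le> f (x + \<alpha> *\<^sub>R v) + g \<bullet> (- (\<alpha> *\<^sub>R v)) + L / 2 * (norm (\<alpha> *\<^sub>R v))\<^sup>2"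
      using descent[of x "x + \<alpha> *\<^sub>R v"] by (simp add: g_def)
    moreover have "(norm (\<alpha> *\<^sub>R v))\<^sup>2 \<le> \<alpha>\<^sup>2"
      using v \<alpha> by (intro power_mono) (auto simp: mult_left_le)
    then have "L / 2 * (norm (\<alpha> *\<^sub>R v))\<^sup>2 \<le> L * \<alpha>\<^sup>2 / 2" using L_pos by simp
    ultimately have 2: "f x \<le> f (x + \<alpha> *\<^sub>R v) - g \<bullet> (\<alpha> *\<^sub>R v) + L * \<alpha>\<^sup>2 / 2" by simp
    have "0 \<le> (g - p) \<bullet> (g - p)" by simp
    then have "2 * (g \<bullet> p) - p \<bullet> p \<le> g \<bullet> g" by (simp add: inner_diff_left inner_diff_right inner_commute)
    then have "(2 * (g \<bullet> p) - p \<bullet> p) / (2 * L) \<le> (g \<bullet> g) / (2 * L)" using L_pos by (intro divide_right_mono) auto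
    then have 3: "(g \<bullet> p) / L - (p \<bullet> p) / (2 * L) \<le> (g \<bullet> g) / (2 * L)" by (simp add: diff_divide_distrib)
    have "g \<bullet> (x - xs - (1 / L) *\<^sub>R p) = - (g \<bullet> (xs - x - \<alpha> *\<^sub>R v)) - g \<bullet> (\<alpha> *\<^sub>R v) - (g \<bullet> p) / L"
      by (simp add: inner_diff_right)
    then show ?thesis using 1 2 3 unfolding g_def[symmetric] by linarith
  qed
  have "f x - f xs - L * \<alpha>\<^sup>2 / 2 - (p \<bullet> p) / (2 * L) \<le> p \<bullet> (x - xs - (1 / L) *\<^sub>R p)"
  proof -
    have "(\<integral>v. f x - f xs - L * \<alpha>\<^sup>2 / 2 - (p \<bullet> p) / (2 * L) \<partial>(uniform_ball :: 'a measure))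
        \<le> (\<integral>v. gf (x + \<alpha> *\<^sub>R v) \<bullet> (x - xs - (1 / L) *\<^sub>R p) \<partial>uniform_ball)"
    proof (rule integral_mono_AE)
      show "AE v in uniform_ball. f x - f xs - L * \<alpha>\<^sup>2 / 2 - (p \<bullet> p) / (2 * L) \<le> gf (x + \<alpha> *\<^sub>R v) \<bullet> (x - xs - (1 / L) *\<^sub>R p)"
        using AE_uniform_ball by eventually_elim (rule pt, simp)
    qed (use int in auto)
    then show ?thesis using prob_space by (simp add: p_def ball_gradient_inner)
  qed
  moreover have "p \<bullet> (x - xs - (1 / L) *\<^sub>R p) = p \<bullet> (x - xs) - 2 * ((p \<bullet> p) / (2 * L))"
    by (simp add: inner_diff_right)
  ultimately show ?thesis unfolding p_def[symmetric] power2_norm_eq_inner by linarith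
qed

lemma integrable_sphere: "integrable uniform_sphere (\<lambda>u. f (x + \<alpha> *\<^sub>R u))"
proof (rule integrable_uniform_sphere_bounded)
  fix u :: 'a assume "norm u = 1"
  then show "\<bar>f (x + \<alpha> *\<^sub>R u)\<bar> \<le> \<bar>f x\<bar> + L0 * \<bar>\<alpha>\<bar>"
    using lipschitzD[of "x + \<alpha> *\<^sub>R u" x] by simp
qed measurable

text \<open>The divergence theorem for \<open>v \<mapsto> f (x + \<alpha> v)\<close>, whose gradient carries the factor \<open>\<alpha>\<close>.\<close>

lemma sphere_gradient_estimate:
  "(\<integral>u. f (x + \<alpha> *\<^sub>R u) * (u \<bullet> w) \<partial>uniform_sphere) = \<alpha> / DIM('a) * (ball_gradient \<alpha> x \<bullet> w)"
proof -
  have "(L0 * \<bar>\<alpha>\<bar>)-lipschitz_on UNIV (\<lambda>v. f (x + \<alpha> *\<^sub>R v))"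
  proof (rule lipschitz_onI)
    fix u v :: 'a
    show "dist (f (x + \<alpha> *\<^sub>R u)) (f (x + \<alpha> *\<^sub>R v)) \<le> L0 * \<bar>\<alpha>\<bar> * dist u v"
      using lipschitzD[of "x + \<alpha> *\<^sub>R u" "x + \<alpha> *\<^sub>R v"]
      by (simp add: dist_norm scaleR_diff_right[symmetric] mult.assoc)
  qed (use L0_nonneg in simp)
  moreover have "((\<lambda>v. f (x + \<alpha> *\<^sub>R v)) has_derivative (\<lambda>h. (\<alpha> *\<^sub>R gf (x + \<alpha> *\<^sub>R v)) \<bullet> h)) (at v)" for v
  proof -
    have "((\<lambda>v. f (x + \<alpha> *\<^sub>R v)) has_derivative (\<lambda>h. gf (x + \<alpha> *\<^sub>R v) \<bullet> (\<alpha> *\<^sub>R h))) (at v)"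
      by (rule has_derivative_compose[OF _ der]) (auto intro!: derivative_eq_intros)
    then show ?thesis by (rule has_derivative_eq_rhs) simp
  qed
  moreover have "continuous_on UNIV (\<lambda>v. \<alpha> *\<^sub>R gf (x + \<alpha> *\<^sub>R v))"
    by (intro continuous_intros continuous_on_compose2[OF continuous_gradient]) auto
  ultimately have "(\<integral>v. (\<alpha> *\<^sub>R gf (x + \<alpha> *\<^sub>R v)) \<bullet> w \<partial>uniform_ball)
      = DIM('a) * (\<integral>u. f (x + \<alpha> *\<^sub>R u) * (u \<bullet> w) \<partial>uniform_sphere)"
    by (rule integral_gradient_ball)
  then have "\<alpha> * (ball_gradient \<alpha> x \<bullet> w) = DIM('a) * (\<integral>u. f (x + \<alpha> *\<^sub>R u) * (u \<bullet> w) \<partial>uniform_sphere)"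
    by (simp add: ball_gradient_inner)
  then show ?thesis by (simp add: field_simps)
qed

lemma smoothing_residual:
  assumes u: "norm u = 1" and \<alpha>: "0 \<le> \<alpha>"
  shows "0 \<le> f (x + \<alpha> *\<^sub>R u) - f x - \<alpha> * (gf x \<bullet> u)"
    and "f (x + \<alpha> *\<^sub>R u) - f x - \<alpha> * (gf x \<bullet> u) \<le> L * \<alpha>\<^sup>2 / 2"
  using tangent[of x "x + \<alpha> *\<^sub>R u"] descent[of "x + \<alpha> *\<^sub>R u" x] u \<alpha>
  by (simp_all add: power_mult_distrib)

lemma sphere_mean_bounds:
  assumes \<alpha>: "0 \<le> \<alpha>"
  shows "0 \<le> sphere_mean \<alpha> x - f x" and "sphere_mean \<alpha> x - f x \<le> L * \<alpha>\<^sup>2 / 2"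
proof -
  interpret prob_space "uniform_sphere :: 'a measure" by (rule prob_space_uniform_sphere)
  have iu: "integrable uniform_sphere (\<lambda>u. gf x \<bullet> u)"
    by (rule integrable_inner_uniform_sphere)
  have ir: "integrable uniform_sphere (\<lambda>u. f (x + \<alpha> *\<^sub>R u) - f x - \<alpha> * (gf x \<bullet> u))"
    using iu integrable_sphere by auto
  have eq: "(\<integral>u. f (x + \<alpha> *\<^sub>R u) - f x - \<alpha> * (gf x \<bullet> u) \<partial>uniform_sphere) = sphere_mean \<alpha> x - f x"
    using iu integrable_sphere[of x \<alpha>] integral_uniform_sphere_inner[of "gf x"] prob_space
    by (simp add: sphere_mean_def inner_commute[of "gf x"])
  show "0 \<le> sphere_mean \<alpha> x - f x"
    unfolding eq[symmetric]
  proof (rule integral_nonneg_AE)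
    show "AE u in uniform_sphere. 0 \<le> f (x + \<alpha> *\<^sub>R u) - f x - \<alpha> * (gf x \<bullet> u)"
      using AE_uniform_sphere by eventually_elim (rule smoothing_residual(1)[OF _ \<alpha>])
  qed
  have "(\<integral>u. f (x + \<alpha> *\<^sub>R u) - f x - \<alpha> * (gf x \<bullet> u) \<partial>uniform_sphere) \<le> (\<integral>u. L * \<alpha>\<^sup>2 / 2 \<partial>(uniform_sphere :: 'a measure))"
  proof (rule integral_mono_AE[OF ir])
    show "AE u in uniform_sphere. f (x + \<alpha> *\<^sub>R u) - f x - \<alpha> * (gf x \<bullet> u) \<le> L * \<alpha>\<^sup>2 / 2"
      using AE_uniform_sphere by eventually_elim (rule smoothing_residual(2)[OF _ \<alpha>])
  qed simp
  then show "sphere_mean \<alpha> x - f x \<le> L * \<alpha>\<^sup>2 / 2" unfolding eq using prob_space by simp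
qed

text \<open>On the sphere a multiple of \<open>v \<bullet> v - 1\<close> may be subtracted without any effect. Subtracting
\<open>L \<alpha>\<^sup>2 / 4\<close> times it centres the second derivative: cocoercivity then bounds the gradient of the remainder
by \<open>L \<alpha>\<^sup>2 / 2\<close>, half of what smoothness alone gives, and \<open>sphere_poincare\<close> applies.\<close>

lemma sphere_nonlinearity_bound:
  assumes \<alpha>: "0 \<le> \<alpha>"
  shows "(\<integral>u. (f (x + \<alpha> *\<^sub>R u) - \<alpha> * (gf x \<bullet> u) - sphere_mean \<alpha> x)\<^sup>2 \<partial>uniform_sphere)
       \<le> 5 / 8 * (L\<^sup>2 * \<alpha> ^ 4) / DIM('a)"
proof -
  interpret prob_space "uniform_sphere :: 'a measure" by (rule prob_space_uniform_sphere)
  define l where "l = L * \<alpha>\<^sup>2 / 2"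
  have l0: "0 \<le> l" using L_pos by (simp add: l_def)
  define \<rho> where "\<rho> v = f (x + \<alpha> *\<^sub>R v) - \<alpha> * (gf x \<bullet> v) - sphere_mean \<alpha> x - l / 2 * (v \<bullet> v - 1)" for v
  define g where "g v = \<alpha> *\<^sub>R (gf (x + \<alpha> *\<^sub>R v) - gf x) - l *\<^sub>R v" for v
  have \<rho>1: "\<rho> u = f (x + \<alpha> *\<^sub>R u) - \<alpha> * (gf x \<bullet> u) - sphere_mean \<alpha> x" if "norm u = 1" for u
    using that by (simp add: \<rho>_def dot_square_norm)
  have [measurable]: "\<rho> \<in> borel_measurable borel" "g \<in> borel_measurable borel"
    unfolding \<rho>_def[abs_def] g_def[abs_def] by measurable
  have AE\<rho>: "AE u in uniform_sphere. \<rho> u = f (x + \<alpha> *\<^sub>R u) - \<alpha> * (gf x \<bullet> u) - sphere_mean \<alpha> x"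
    using AE_uniform_sphere by eventually_elim (rule \<rho>1)
  have iu: "integrable uniform_sphere (\<lambda>u. gf x \<bullet> u)"
    by (rule integrable_inner_uniform_sphere)
  have "(\<integral>u. (\<rho> u)\<^sup>2 \<partial>uniform_sphere) \<le> pi\<^sup>2 / 8 * ((sqrt 2 * l)\<^sup>2 / DIM('a))"
  proof (rule sphere_poincare)
    show "(L0 * \<alpha> + \<alpha> * norm (gf x))-lipschitz_on (sphere 0 1) \<rho>"
    proof (rule lipschitz_onI)
      fix u v :: 'a assume uv: "u \<in> sphere 0 1" "v \<in> sphere 0 1"
      have "\<rho> u - \<rho> v = (f (x + \<alpha> *\<^sub>R u) - f (x + \<alpha> *\<^sub>R v)) - \<alpha> * (gf x \<bullet> (u - v))"
        using uv by (simp add: \<rho>1 inner_diff_right algebra_simps)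
      also have "\<bar>\<dots>\<bar> \<le> \<bar>f (x + \<alpha> *\<^sub>R u) - f (x + \<alpha> *\<^sub>R v)\<bar> + \<alpha> * \<bar>gf x \<bullet> (u - v)\<bar>"
        using abs_triangle_ineq4[of "f (x + \<alpha> *\<^sub>R u) - f (x + \<alpha> *\<^sub>R v)" "\<alpha> * (gf x \<bullet> (u - v))"] \<alpha>
        by (simp add: abs_mult)
      also have "\<dots> \<le> L0 * (\<alpha> * norm (u - v)) + \<alpha> * (norm (gf x) * norm (u - v))"
        using lipschitzD[of "x + \<alpha> *\<^sub>R u" "x + \<alpha> *\<^sub>R v"] Cauchy_Schwarz_ineq2[of "gf x" "u - v"] \<alpha>
        by (intro add_mono mult_left_mono) (simp_all add: scaleR_diff_right[symmetric])
      finally show "dist (\<rho> u) (\<rho> v) \<le> (L0 * \<alpha> + \<alpha> * norm (gf x)) * dist u v"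
        by (simp add: dist_norm algebra_simps)
    qed (use \<alpha> L0_nonneg in simp)
    show "(\<rho> has_derivative (\<lambda>h. g u \<bullet> h)) (at u)" for u
    proof -
      have "((\<lambda>v. f (x + \<alpha> *\<^sub>R v)) has_derivative (\<lambda>h. gf (x + \<alpha> *\<^sub>R u) \<bullet> (\<alpha> *\<^sub>R h))) (at u)"
        by (rule has_derivative_compose[OF _ der]) (auto intro!: derivative_eq_intros)
      then have "(\<rho> has_derivative (\<lambda>h. gf (x + \<alpha> *\<^sub>R u) \<bullet> (\<alpha> *\<^sub>R h) - \<alpha> * (gf x \<bullet> h) - l / 2 * (u \<bullet> h + h \<bullet> u))) (at u)"
        unfolding \<rho>_def[abs_def] by (auto intro!: derivative_eq_intros)
      then show ?thesis
        by (rule has_derivative_eq_rhs)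
           (simp add: g_def fun_eq_iff inner_diff_left inner_diff_right inner_commute right_diff_distrib)
    qed
    show "(\<integral>u. \<rho> u \<partial>uniform_sphere) = 0"
    proof -
      have "(\<integral>u. \<rho> u \<partial>uniform_sphere) = (\<integral>u. f (x + \<alpha> *\<^sub>R u) - \<alpha> * (gf x \<bullet> u) - sphere_mean \<alpha> x \<partial>uniform_sphere)"
        by (rule integral_cong_AE[OF _ _ AE\<rho>]) measurable
      also have "\<dots> = 0"
        using iu integrable_sphere[of x \<alpha>] integral_uniform_sphere_inner[of "gf x"] prob_space
        by (simp add: sphere_mean_def inner_commute[of "gf x"])
      finally show ?thesis .
    qed
    show "(\<rho> u)\<^sup>2 + (norm (g u))\<^sup>2 \<le> (sqrt 2 * l)\<^sup>2" if u: "norm u = 1" for u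
    proof -
      have "\<rho> u = (f (x + \<alpha> *\<^sub>R u) - f x - \<alpha> * (gf x \<bullet> u)) - (sphere_mean \<alpha> x - f x)"
        by (simp add: \<rho>1[OF u])
      then have "\<bar>\<rho> u\<bar> \<le> l"
        using smoothing_residual[OF u \<alpha>, of x] sphere_mean_bounds[OF \<alpha>, of x] unfolding l_def by linarith
      then have 1: "(\<rho> u)\<^sup>2 \<le> l\<^sup>2" using power_mono[of "\<bar>\<rho> u\<bar>" l 2] by simp
      define W where "W = gf (x + \<alpha> *\<^sub>R u) - gf x"
      have uu: "u \<bullet> u = 1" using u by (simp add: dot_square_norm)
      have "W \<bullet> W \<le> L * (\<alpha> * (W \<bullet> u))"
        using cocoercive[of "x + \<alpha> *\<^sub>R u" x] by (simp add: W_def power2_norm_eq_inner)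
      then have "\<alpha>\<^sup>2 * (W \<bullet> W) \<le> \<alpha>\<^sup>2 * (L * (\<alpha> * (W \<bullet> u)))" by (rule mult_left_mono) simp
      moreover have "(norm (g u))\<^sup>2 = \<alpha>\<^sup>2 * (W \<bullet> W) - 2 * \<alpha> * l * (W \<bullet> u) + l\<^sup>2"
        unfolding power2_norm_eq_inner g_def W_def[symmetric]
        by (simp add: inner_diff_left inner_diff_right inner_commute[of u W] uu power2_eq_square)
           (simp add: algebra_simps)
      moreover have "2 * \<alpha> * l * (W \<bullet> u) = \<alpha>\<^sup>2 * (L * (\<alpha> * (W \<bullet> u)))" by (simp add: l_def power2_eq_square)
      ultimately have 2: "(norm (g u))\<^sup>2 \<le> l\<^sup>2" by linarith
      have "(sqrt 2 * l)\<^sup>2 = l\<^sup>2 + l\<^sup>2" by (simp add: power_mult_distrib)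
      then show ?thesis using 1 2 by linarith
    qed
  qed (use l0 in \<open>simp_all\<close>)
  also have "(\<integral>u. (\<rho> u)\<^sup>2 \<partial>uniform_sphere)
     = (\<integral>u. (f (x + \<alpha> *\<^sub>R u) - \<alpha> * (gf x \<bullet> u) - sphere_mean \<alpha> x)\<^sup>2 \<partial>uniform_sphere)"
  proof (rule integral_cong_AE)
    show "AE u in uniform_sphere. (\<rho> u)\<^sup>2 = (f (x + \<alpha> *\<^sub>R u) - \<alpha> * (gf x \<bullet> u) - sphere_mean \<alpha> x)\<^sup>2"
      using AE\<rho> by eventually_elim (simp only:)
  qed measurable
  also have "pi\<^sup>2 / 8 * ((sqrt 2 * l)\<^sup>2 / DIM('a)) = pi\<^sup>2 * (L\<^sup>2 * \<alpha> ^ 4 / (16 * DIM('a)))"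
    by (simp add: l_def power_mult_distrib power_divide power_mult[symmetric])
  also have "\<dots> \<le> 10 * (L\<^sup>2 * \<alpha> ^ 4 / (16 * DIM('a)))"
  proof (rule mult_right_mono)
    have "pi\<^sup>2 \<le> 3.15\<^sup>2" using pi_approx by (intro power_mono) auto
    then show "pi\<^sup>2 \<le> 10" by (simp add: power2_eq_square)
  qed simp
  finally show ?thesis by simp
qed

text \<open>The covariance of \<open>f (x + \<alpha> u)\<close> with linear functions of \<open>u\<close> is known exactly from
\<open>sphere_gradient_estimate\<close>. Therefore, up to a square of favourable sign, the gradient at \<open>x\<close> that is used to
split off the linear part is replaced by the ball gradient, which is the one that \<open>ball_gradient_descent\<close> can
compensate.\<close>

lemma sphere_variance_bound:
  assumes \<alpha>: "0 \<le> \<alpha>"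
  shows "sphere_variance \<alpha> x \<le> \<alpha>\<^sup>2 / DIM('a) * ((norm (ball_gradient \<alpha> x))\<^sup>2 + 5 / 8 * (L\<^sup>2 * \<alpha>\<^sup>2))"
proof -
  interpret prob_space "uniform_sphere :: 'a measure" by (rule prob_space_uniform_sphere)
  let ?d = "real DIM('a)" and ?g = "gf x" and ?p = "ball_gradient \<alpha> x"
  let ?\<phi> = "\<lambda>u. f (x + \<alpha> *\<^sub>R u) - sphere_mean \<alpha> x" and ?s = "\<lambda>u. gf x \<bullet> u"
  have s1: "\<bar>?s u\<bar> \<le> norm ?g" if "norm u = 1" for u
    using Cauchy_Schwarz_ineq2[of ?g u] that by simp
  have fx: "\<bar>f (x + \<alpha> *\<^sub>R u)\<bar> \<le> \<bar>f x\<bar> + L0 * \<alpha>" if "norm u = 1" for u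
    using lipschitzD[of "x + \<alpha> *\<^sub>R u" x] that \<alpha> by simp
  have \<phi>1: "\<bar>?\<phi> u\<bar> \<le> (\<bar>f x\<bar> + L0 * \<alpha>) + \<bar>sphere_mean \<alpha> x\<bar>" (is "_ \<le> ?K") if "norm u = 1" for u
    using lipschitzD[of "x + \<alpha> *\<^sub>R u" x] that \<alpha> by simp
  have i1: "integrable uniform_sphere (\<lambda>u. (?\<phi> u)\<^sup>2)"
  proof (rule integrable_uniform_sphere_bounded)
    show "\<bar>(?\<phi> u)\<^sup>2\<bar> \<le> ?K\<^sup>2" if "norm u = 1" for u
      unfolding power_abs by (rule power_mono[OF \<phi>1[OF that] abs_ge_zero])
  qed measurable
  have i2: "integrable uniform_sphere (\<lambda>u. ?\<phi> u * ?s u)"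
  proof (rule integrable_uniform_sphere_bounded)
    show "\<bar>?\<phi> u * ?s u\<bar> \<le> ?K * norm ?g" if "norm u = 1" for u
      unfolding abs_mult
      by (rule mult_mono[OF \<phi>1[OF that] s1[OF that]]) (use \<alpha> L0_nonneg in simp_all)
  qed measurable
  have i3: "integrable uniform_sphere (\<lambda>u. (?s u)\<^sup>2)"
  proof (rule integrable_uniform_sphere_bounded)
    show "\<bar>(?s u)\<^sup>2\<bar> \<le> (norm ?g)\<^sup>2" if "norm u = 1" for u
      unfolding power_abs by (rule power_mono[OF s1[OF that] abs_ge_zero])
  qed measurable
  have i4: "integrable uniform_sphere (\<lambda>u. f (x + \<alpha> *\<^sub>R u) * ?s u)"
  proof (rule integrable_uniform_sphere_bounded)
    show "\<bar>f (x + \<alpha> *\<^sub>R u) * ?s u\<bar> \<le> (\<bar>f x\<bar> + L0 * \<alpha>) * norm ?g" if "norm u = 1" for u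
      unfolding abs_mult
      by (rule mult_mono[OF fx[OF that] s1[OF that]]) (use \<alpha> L0_nonneg in simp_all)
  qed measurable
  have i5: "integrable uniform_sphere ?s"
    by (rule integrable_inner_uniform_sphere)
  have e2: "(\<integral>u. ?\<phi> u * ?s u \<partial>uniform_sphere) = \<alpha> / ?d * (?p \<bullet> ?g)"
  proof -
    have "(\<integral>u. ?\<phi> u * ?s u \<partial>uniform_sphere)
        = (\<integral>u. f (x + \<alpha> *\<^sub>R u) * ?s u - sphere_mean \<alpha> x * ?s u \<partial>uniform_sphere)"
      by (simp only: left_diff_distrib)
    also have "\<dots> = (\<integral>u. f (x + \<alpha> *\<^sub>R u) * (u \<bullet> ?g) \<partial>uniform_sphere) - sphere_mean \<alpha> x * (\<integral>u. u \<bullet> ?g \<partial>uniform_sphere)"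
      by (subst (3 4) inner_commute) (simp only: Bochner_Integration.integral_diff[OF i4 integrable_mult_right[OF i5]] integral_mult_right_zero)
    finally show ?thesis by (simp add: sphere_gradient_estimate integral_uniform_sphere_inner)
  qed
  have e3: "(\<integral>u. (?s u)\<^sup>2 \<partial>uniform_sphere) = (?g \<bullet> ?g) / ?d"
    using integral_uniform_sphere_inner_mult[of ?g ?g] by (simp add: power2_eq_square inner_commute)
  have "(\<integral>u. (f (x + \<alpha> *\<^sub>R u) - \<alpha> * ?s u - sphere_mean \<alpha> x)\<^sup>2 \<partial>uniform_sphere)
      = (\<integral>u. (?\<phi> u)\<^sup>2 - 2 * \<alpha> * (?\<phi> u * ?s u) + \<alpha>\<^sup>2 * (?s u)\<^sup>2 \<partial>uniform_sphere)"
    by (rule Bochner_Integration.integral_cong) (simp_all add: power2_eq_square algebra_simps)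
  also have "\<dots> = sphere_variance \<alpha> x - 2 * \<alpha> * (\<alpha> / ?d * (?p \<bullet> ?g)) + \<alpha>\<^sup>2 * ((?g \<bullet> ?g) / ?d)"
    unfolding sphere_variance_def e2[symmetric] e3[symmetric]
    by (simp only: Bochner_Integration.integral_add[OF Bochner_Integration.integrable_diff[OF i1 integrable_mult_right[OF i2]] integrable_mult_right[OF i3]]
        Bochner_Integration.integral_diff[OF i1 integrable_mult_right[OF i2]] integral_mult_right_zero)
  finally have "sphere_variance \<alpha> x - 2 * \<alpha> * (\<alpha> / ?d * (?p \<bullet> ?g)) + \<alpha>\<^sup>2 * ((?g \<bullet> ?g) / ?d)
      \<le> 5 / 8 * (L\<^sup>2 * \<alpha> ^ 4) / ?d"
    using sphere_nonlinearity_bound[OF \<alpha>, of x] by (simp only:)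
  moreover have "\<alpha>\<^sup>2 / ?d * (2 * (?p \<bullet> ?g) - ?g \<bullet> ?g) \<le> \<alpha>\<^sup>2 / ?d * (?p \<bullet> ?p)"
  proof (rule mult_left_mono)
    have "0 \<le> (?p - ?g) \<bullet> (?p - ?g)" by simp
    then show "2 * (?p \<bullet> ?g) - ?g \<bullet> ?g \<le> ?p \<bullet> ?p" by (simp add: inner_diff_left inner_diff_right inner_commute)
  qed simp
  moreover have "\<alpha>\<^sup>2 / ?d * (2 * (?p \<bullet> ?g) - ?g \<bullet> ?g) = 2 * \<alpha> * (\<alpha> / ?d * (?p \<bullet> ?g)) - \<alpha>\<^sup>2 * ((?g \<bullet> ?g) / ?d)"
    by (simp add: power2_eq_square field_simps)
  moreover have "5 / 8 * (L\<^sup>2 * \<alpha> ^ 4) / ?d = \<alpha>\<^sup>2 / ?d * (5 / 8 * (L\<^sup>2 * \<alpha>\<^sup>2))"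
    by (simp add: power4_eq_xxxx power2_eq_square mult_ac)
  ultimately show ?thesis unfolding power2_norm_eq_inner distrib_left by linarith
qed

lemma sphere_mean_lipschitz: "\<bar>sphere_mean \<alpha> x - sphere_mean \<alpha> y\<bar> \<le> L0 * norm (x - y)"
proof -
  interpret S: prob_space "uniform_sphere :: 'a measure" by (rule prob_space_uniform_sphere)
  have "sphere_mean \<alpha> x - sphere_mean \<alpha> y = (\<integral>u. f (x + \<alpha> *\<^sub>R u) - f (y + \<alpha> *\<^sub>R u) \<partial>uniform_sphere)"
    unfolding sphere_mean_def by (rule Bochner_Integration.integral_diff[symmetric]) (rule integrable_sphere)+
  also have "\<bar>\<dots>\<bar> \<le> (\<integral>u. L0 * norm (x - y) \<partial>(uniform_sphere :: 'a measure))"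
  proof (rule order_trans[OF integral_abs_bound], rule integral_mono)
    show "integrable uniform_sphere (\<lambda>u. \<bar>f (x + \<alpha> *\<^sub>R u) - f (y + \<alpha> *\<^sub>R u)\<bar>)"
      by (intro integrable_abs Bochner_Integration.integrable_diff integrable_sphere)
    show "\<bar>f (x + \<alpha> *\<^sub>R u) - f (y + \<alpha> *\<^sub>R u)\<bar> \<le> L0 * norm (x - y)" for u
      using lipschitzD[of "x + \<alpha> *\<^sub>R u" "y + \<alpha> *\<^sub>R u"] by simp
  qed simp
  finally show ?thesis using S.prob_space by simp
qed

lemma measurable_sphere_mean [measurable]: "sphere_mean \<alpha> \<in> borel_measurable borel"
proof -
  have "L0-lipschitz_on UNIV (sphere_mean \<alpha>)"
    using sphere_mean_lipschitz L0_nonneg by (auto simp: lipschitz_on_def dist_norm)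
  then show ?thesis by (intro borel_measurable_continuous_onI lipschitz_on_continuous_on)
qed

lemma measurable_sphere_variance [measurable]: "sphere_variance \<alpha> \<in> borel_measurable borel"
proof -
  interpret S: prob_space "uniform_sphere :: 'a measure" by (rule prob_space_uniform_sphere)
  show ?thesis unfolding sphere_variance_def[abs_def] by measurable
qed

lemma measurable_ball_gradient [measurable]: "ball_gradient \<alpha> \<in> borel_measurable borel"
proof -
  interpret B: prob_space "uniform_ball :: 'a measure" by (rule prob_space_uniform_ball)
  show ?thesis unfolding ball_gradient_def[abs_def] by measurable
qed

lemma norm_ball_gradient_le: "norm (ball_gradient \<alpha> x) \<le> L0"
proof -
  interpret B: prob_space "uniform_ball :: 'a measure" by (rule prob_space_uniform_ball)
  have "norm (ball_gradient \<alpha> x) \<le> (\<integral>v. L0 \<partial>(uniform_ball :: 'a measure))"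
    unfolding ball_gradient_def
    by (rule order_trans[OF integral_norm_bound], rule integral_mono)
       (use integrable_ball_gradient norm_gradient_le in auto)
  then show ?thesis using B.prob_space by simp
qed

lemma sphere_variance_nonneg: "0 \<le> sphere_variance \<alpha> x"
  unfolding sphere_variance_def by (rule integral_nonneg_AE) simp

text \<open>Bias-variance decomposition around the sphere mean.\<close>

lemma sphere_second_moment:
  "integrable uniform_sphere (\<lambda>u. (f (x + \<alpha> *\<^sub>R u) - c)\<^sup>2)"
  "(\<integral>u. (f (x + \<alpha> *\<^sub>R u) - c)\<^sup>2 \<partial>uniform_sphere) = sphere_variance \<alpha> x + (sphere_mean \<alpha> x - c)\<^sup>2"
proof -
  interpret S: prob_space "uniform_sphere :: 'a measure" by (rule prob_space_uniform_sphere)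
  let ?m = "sphere_mean \<alpha> x"
  show int: "integrable uniform_sphere (\<lambda>u. (f (x + \<alpha> *\<^sub>R u) - c)\<^sup>2)" for c
  proof (rule integrable_uniform_sphere_bounded)
    fix u :: 'a assume "norm u = 1"
    then have "\<bar>f (x + \<alpha> *\<^sub>R u) - c\<bar> \<le> \<bar>f x\<bar> + L0 * \<bar>\<alpha>\<bar> + \<bar>c\<bar>"
      using lipschitzD[of "x + \<alpha> *\<^sub>R u" x] by simp
    then show "\<bar>(f (x + \<alpha> *\<^sub>R u) - c)\<^sup>2\<bar> \<le> (\<bar>f x\<bar> + L0 * \<bar>\<alpha>\<bar> + \<bar>c\<bar>)\<^sup>2"
      unfolding power_abs by (rule power_mono) simp
  qed measurable
  have iF: "integrable uniform_sphere (\<lambda>u. f (x + \<alpha> *\<^sub>R u) - ?m)"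
    by (intro Bochner_Integration.integrable_diff integrable_sphere) simp
  have "(\<integral>u. (f (x + \<alpha> *\<^sub>R u) - c)\<^sup>2 \<partial>uniform_sphere)
     = (\<integral>u. (f (x + \<alpha> *\<^sub>R u) - ?m)\<^sup>2 + 2 * (?m - c) * (f (x + \<alpha> *\<^sub>R u) - ?m) + (?m - c)\<^sup>2 \<partial>uniform_sphere)"
    by (rule Bochner_Integration.integral_cong) (simp_all add: power2_eq_square algebra_simps)
  also have "\<dots> = sphere_variance \<alpha> x + 2 * (?m - c) * (\<integral>u. f (x + \<alpha> *\<^sub>R u) - ?m \<partial>uniform_sphere) + (?m - c)\<^sup>2"
    using int[of ?m] iF S.prob_space by (simp add: sphere_variance_def)
  also have "(\<integral>u. f (x + \<alpha> *\<^sub>R u) - ?m \<partial>uniform_sphere) = 0"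
    using integrable_sphere[of x \<alpha>] S.prob_space by (simp add: sphere_mean_def)
  finally show "(\<integral>u. (f (x + \<alpha> *\<^sub>R u) - c)\<^sup>2 \<partial>uniform_sphere) = sphere_variance \<alpha> x + (?m - c)\<^sup>2" by simp
qed

end

section \<open>The mean objective\<close>

text \<open>Approximating the continuous argument by simple functions reduces joint measurability to that of finitely many
sections at a time.\<close>

lemma caratheodory_measurable:
  fixes F :: "'a::euclidean_space \<Rightarrow> 'z \<Rightarrow> real"
  assumes meas: "\<And>y. F y \<in> borel_measurable D"
    and cont: "\<And>z. z \<in> space D \<Longrightarrow> continuous_on UNIV (\<lambda>y. F y z)"
  shows "(\<lambda>p. F (fst p) (snd p)) \<in> borel_measurable (borel \<Otimes>\<^sub>M D)"
proof -
  obtain s :: "nat \<Rightarrow> 'a \<Rightarrow> 'a" where s: "\<And>i. simple_function borel (s i)" "\<And>x. (\<lambda>i. s i x) \<longlonglongrightarrow> x"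
    using borel_measurable_implies_sequence_metric[of "\<lambda>x::'a. x" borel undefined] by auto
  have step: "(\<lambda>p. F (s i (fst p)) (snd p)) \<in> borel_measurable (borel \<Otimes>\<^sub>M D)" for i
  proof (rule measurable_compose_countable'[where I = "range (s i)" and g = "\<lambda>p. s i (fst p)" and f = "\<lambda>j p. F j (snd p)"])
    show "(\<lambda>p. F j (snd p)) \<in> borel_measurable (borel \<Otimes>\<^sub>M D)" for j
      by (rule measurable_compose[OF measurable_snd meas])
    have fin: "finite (range (s i))" using simple_functionD(1)[OF s(1)[of i]] by simp
    then show "countable (range (s i))" by (rule countable_finite)
    have "s i \<in> borel \<rightarrow>\<^sub>M count_space (range (s i))"
      using simple_functionD(2)[OF s(1)[of i]] fin by (auto simp: measurable_count_space_eq2)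
    then show "(\<lambda>p. s i (fst p)) \<in> borel \<Otimes>\<^sub>M D \<rightarrow>\<^sub>M count_space (range (s i))"
      by (rule measurable_compose[OF measurable_fst])
  qed
  show ?thesis
  proof (rule borel_measurable_LIMSEQ_real[OF _ step])
    fix p :: "'a \<times> 'z" assume "p \<in> space (borel \<Otimes>\<^sub>M D)"
    then have "snd p \<in> space D" by (auto simp: space_pair_measure)
    then have "isCont (\<lambda>y. F y (snd p)) (fst p)"
      using cont by (simp add: continuous_on_eq_continuous_at)
    then show "(\<lambda>i. F (s i (fst p)) (snd p)) \<longlonglongrightarrow> F (fst p) (snd p)"
      using s(2) by (rule isCont_tendsto_compose)
  qed
qed

lemma has_derivative_gradient:
  fixes h :: "'a::euclidean_space \<Rightarrow> real"
  assumes "h differentiable (at x)"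
  shows "(h has_derivative (\<lambda>v. gradient h x \<bullet> v)) (at x)"
proof -
  from assms obtain h' where h': "(h has_derivative h') (at x)" by (auto simp: differentiable_def)
  interpret h': bounded_linear h' using h' by (rule has_derivative_bounded_linear)
  define g where "g = (\<Sum>b\<in>Basis. h' b *\<^sub>R b)"
  have "h' v = v \<bullet> g" for v
  proof -
    have "h' v = h' (\<Sum>b\<in>Basis. (v \<bullet> b) *\<^sub>R b)" by (simp add: euclidean_representation)
    also have "\<dots> = v \<bullet> g" by (simp add: g_def h'.sum h'.scaleR inner_sum_right mult.commute)
    finally show ?thesis .
  qed
  then have "h' = (\<lambda>v. v \<bullet> g)" by (rule ext)
  then have D: "GDERIV h x :> g" using h' by (simp add: gderiv_def)
  moreover have "g' = g" if "GDERIV h x :> g'" for g'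
  proof -
    have "(\<lambda>v. v \<bullet> g') = (\<lambda>v. v \<bullet> g)"
      using that D unfolding gderiv_def by (rule has_derivative_unique)
    then have "(g' - g) \<bullet> (g' - g) = 0" by (metis inner_diff_right right_minus_eq)
    then show ?thesis by simp
  qed
  ultimately have "gradient h x = g" unfolding gradient_def by (rule the_equality)
  then show ?thesis using D by (simp add: gderiv_def inner_commute)
qed

lemma has_derivative_quadratic_error:
  fixes f :: "'a::euclidean_space \<Rightarrow> real"
  assumes "\<And>h. \<bar>f (x + h) - f x - g \<bullet> h\<bar> \<le> K * (norm h)\<^sup>2"
  shows "(f has_derivative (\<lambda>h. g \<bullet> h)) (at x)"
  unfolding has_derivative_at
proof (intro conjI bounded_linear_inner_right)
  show "(\<lambda>h. norm (f (x + h) - f x - g \<bullet> h) / norm h) \<midarrow>0\<rightarrow> 0"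
  proof (rule Lim_null_comparison)
    show "\<forall>\<^sub>F h in at 0. norm (norm (f (x + h) - f x - g \<bullet> h) / norm h) \<le> K * norm h"
    proof (rule always_eventually, rule allI)
      fix h
      show "norm (norm (f (x + h) - f x - g \<bullet> h) / norm h) \<le> K * norm h"
        using assms[of h] by (cases "h = 0") (simp_all add: divide_le_eq power2_eq_square mult.assoc)
    qed
    have "((\<lambda>h::'a. K * norm h) \<longlongrightarrow> K * norm (0::'a)) (at 0)" by (intro tendsto_intros)
    then show "((\<lambda>h::'a. K * norm h) \<longlongrightarrow> 0) (at 0)" by simp
  qed
qed

text \<open>Differentiation under the integral sign. Smoothness bounds the linearization error of \<open>F\<close> by a constant
times the square of the increment, uniformly in the sample; the error bound survives integration, and it also gives
the integrability of the gradient.\<close>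

lemma gradient_of_mean:
  fixes F :: "'a::euclidean_space \<Rightarrow> 'z \<Rightarrow> real"
  assumes D: "prob_space D" and int: "\<And>y. integrable D (F y)" and f: "\<And>y. f y = (\<integral>z. F y z \<partial>D)"
    and smooth: "\<And>z. z \<in> space D \<Longrightarrow> smooth L (\<lambda>y. F y z)"
  defines "gf \<equiv> \<lambda>y. \<integral>z. gradient (\<lambda>v. F v z) y \<partial>D"
  shows "(f has_derivative (\<lambda>h. gf y \<bullet> h)) (at y)" and "norm (gf x - gf y) \<le> L * norm (x - y)"
proof -
  interpret prob_space D by fact
  define G where "G y z = gradient (\<lambda>v. F v z) y" for y z
  have der: "((\<lambda>v. F v z) has_derivative (\<lambda>h. G y z \<bullet> h)) (at y)" if "z \<in> space D" for y z
    unfolding G_def using smooth[OF that] by (intro has_derivative_gradient) (auto simp: smooth_def)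
  have lip: "norm (G x z - G y z) \<le> L * norm (x - y)" if "z \<in> space D" for x y z
    using smooth[OF that] by (auto simp: smooth_def G_def)
  have err: "\<bar>F (y + h) z - F y z - G y z \<bullet> h\<bar> \<le> L / 2 * (norm h)\<^sup>2" if z: "z \<in> space D" for y h z
    using smooth_upper_bound[of "\<lambda>v. F v z" "\<lambda>v. G v z" L y h, OF der[OF z] lip[OF z]]
      smooth_lower_bound[of "\<lambda>v. F v z" "\<lambda>v. G v z" L y h, OF der[OF z] lip[OF z]] by linarith
  have [measurable]: "F y \<in> borel_measurable D" for y using int by (rule borel_measurable_integrable)
  have meas_inner: "(\<lambda>z. G y z \<bullet> b) \<in> borel_measurable D" for y b
  proof (rule borel_measurable_LIMSEQ_real)
    let ?X = "\<lambda>n. inverse (real (Suc n))"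
    show "(\<lambda>z. (F (y + ?X n *\<^sub>R b) z - F (y + 0 *\<^sub>R b) z) / ?X n) \<in> borel_measurable D" for n by measurable
    show "(\<lambda>n. (F (y + ?X n *\<^sub>R b) z - F (y + 0 *\<^sub>R b) z) / ?X n) \<longlonglongrightarrow> G y z \<bullet> b" if "z \<in> space D" for z
      by (rule tendsto_difference_quotient[OF has_derivative_along_line[OF der[OF that]] LIMSEQ_inverse_real_of_nat]) simp
  qed
  have meas_G: "G y \<in> borel_measurable D" for y
    unfolding borel_measurable_euclidean_space[of "G y"] using meas_inner by blast
  have int_inner: "integrable D (\<lambda>z. G y z \<bullet> b)" for y b
  proof (rule Bochner_Integration.integrable_bound)
    show "integrable D (\<lambda>z. \<bar>F (y + b) z\<bar> + \<bar>F y z\<bar> + L / 2 * (norm b)\<^sup>2)" using int by simp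
    show "AE z in D. norm (G y z \<bullet> b) \<le> norm (\<bar>F (y + b) z\<bar> + \<bar>F y z\<bar> + L / 2 * (norm b)\<^sup>2)"
    proof (rule AE_I2)
      fix z assume "z \<in> space D"
      from err[OF this, of y b] show "norm (G y z \<bullet> b) \<le> norm (\<bar>F (y + b) z\<bar> + \<bar>F y z\<bar> + L / 2 * (norm b)\<^sup>2)"
        unfolding real_norm_def by linarith
    qed
  qed (rule meas_inner)
  have int_G: "integrable D (G y)" for y
  proof (rule Bochner_Integration.integrable_bound)
    show "integrable D (\<lambda>z. \<Sum>b\<in>Basis. \<bar>G y z \<bullet> b\<bar>)" using int_inner by (intro Bochner_Integration.integrable_sum integrable_abs)
    show "AE z in D. norm (G y z) \<le> norm (\<Sum>b\<in>Basis. \<bar>G y z \<bullet> b\<bar>)"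
      using norm_le_l1[of "G y _"] by (intro AE_I2) (simp add: sum_nonneg)
  qed (rule meas_G)
  have gf: "gf y \<bullet> h = (\<integral>z. G y z \<bullet> h \<partial>D)" for y h
    unfolding gf_def G_def[symmetric] by (rule integral_inner_left[symmetric]) (rule int_G)
  show "(f has_derivative (\<lambda>h. gf y \<bullet> h)) (at y)"
  proof (rule has_derivative_quadratic_error)
    fix h
    have "f (y + h) - f y - gf y \<bullet> h = (\<integral>z. F (y + h) z - F y z - G y z \<bullet> h \<partial>D)"
      using int int_inner by (simp add: f gf)
    also have "\<bar>\<dots>\<bar> \<le> (\<integral>z. L / 2 * (norm h)\<^sup>2 \<partial>D)"
      by (rule order_trans[OF integral_abs_bound], rule integral_mono) (use int int_inner err in auto)
    also have "\<dots> = L / 2 * (norm h)\<^sup>2" using prob_space by simp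
    finally show "\<bar>f (y + h) - f y - gf y \<bullet> h\<bar> \<le> L / 2 * (norm h)\<^sup>2" .
  qed
  have "gf x - gf y = (\<integral>z. G x z - G y z \<partial>D)"
    unfolding gf_def G_def[symmetric] by (rule Bochner_Integration.integral_diff[symmetric]) (rule int_G)+
  also have "norm \<dots> \<le> (\<integral>z. L * norm (x - y) \<partial>D)"
    by (rule order_trans[OF integral_norm_bound], rule integral_mono) (use int_G lip in auto)
  finally show "norm (gf x - gf y) \<le> L * norm (x - y)" using prob_space by simp
qed

section \<open>Histories and fresh samples\<close>

text \<open>The events generated by a single direction \<open>u s\<close> (index \<open>Inl s\<close>) or by a single sample \<open>\<xi> s\<close>
(index \<open>Inr s\<close>). One index type for both families allows a common treatment although their values have different
types.\<close>

definition sample_events ::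
  "'w measure \<Rightarrow> 'b measure \<Rightarrow> (nat \<Rightarrow> 'w \<Rightarrow> 'b) \<Rightarrow> 'c measure \<Rightarrow> (nat \<Rightarrow> 'w \<Rightarrow> 'c) \<Rightarrow> nat + nat \<Rightarrow> 'w set set"
where
  "sample_events M S u D \<xi> k = (case k of
      Inl s \<Rightarrow> {u s -` A \<inter> space M |A. A \<in> sets S}
    | Inr s \<Rightarrow> {\<xi> s -` A \<inter> space M |A. A \<in> sets D})"

text \<open>The sigma-algebra of the variables with indices in \<open>K\<close>, as a measure space so that measurability with respect
to it can be expressed.\<close>

definition history ::
  "'w measure \<Rightarrow> 'b measure \<Rightarrow> (nat \<Rightarrow> 'w \<Rightarrow> 'b) \<Rightarrow> 'c measure \<Rightarrow> (nat \<Rightarrow> 'w \<Rightarrow> 'c) \<Rightarrow> (nat + nat) set \<Rightarrow> 'w measure"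
where
  "history M S u D \<xi> K = sigma (space M) (\<Union>k\<in>K. sample_events M S u D \<xi> k)"

lemma sample_events_Pow: "(\<Union>k\<in>K. sample_events M S u D \<xi> k) \<subseteq> Pow (space M)"
  by (auto simp: sample_events_def split: sum.splits)

lemma space_history [simp]: "space (history M S u D \<xi> K) = space M"
  unfolding history_def by (rule space_measure_of[OF sample_events_Pow])

lemma sets_history: "sets (history M S u D \<xi> K) = sigma_sets (space M) (\<Union>k\<in>K. sample_events M S u D \<xi> k)"
  unfolding history_def by (rule sets_measure_of[OF sample_events_Pow])

lemma measurable_history_mono:
  assumes "Y \<in> history M S u D \<xi> K \<rightarrow>\<^sub>M N" "K \<subseteq> K'"
  shows "Y \<in> history M S u D \<xi> K' \<rightarrow>\<^sub>M N"
proof -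
  have "sets (history M S u D \<xi> K) \<subseteq> sets (history M S u D \<xi> K')"
    unfolding sets_history using assms(2) by (intro sigma_sets_mono') auto
  then show ?thesis using assms(1) by (auto simp: measurable_def)
qed

lemma measurable_history_Inl:
  assumes "Inl s \<in> K" "u s \<in> M \<rightarrow>\<^sub>M S"
  shows "u s \<in> history M S u D \<xi> K \<rightarrow>\<^sub>M S"
proof (rule measurableI)
  fix A assume "A \<in> sets S"
  then have "u s -` A \<inter> space M \<in> sample_events M S u D \<xi> (Inl s)" by (auto simp: sample_events_def)
  then show "u s -` A \<inter> space (history M S u D \<xi> K) \<in> sets (history M S u D \<xi> K)"
    unfolding sets_history space_history using assms(1) by (intro sigma_sets.Basic) auto
qed (use assms(2) in \<open>auto dest: measurable_space\<close>)

lemma measurable_history_Inr: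
  assumes "Inr s \<in> K" "\<xi> s \<in> M \<rightarrow>\<^sub>M D"
  shows "\<xi> s \<in> history M S u D \<xi> K \<rightarrow>\<^sub>M D"
proof (rule measurableI)
  fix A assume "A \<in> sets D"
  then have "\<xi> s -` A \<inter> space M \<in> sample_events M S u D \<xi> (Inr s)" by (auto simp: sample_events_def)
  then show "\<xi> s -` A \<inter> space (history M S u D \<xi> K) \<in> sets (history M S u D \<xi> K)"
    unfolding sets_history space_history using assms(1) by (intro sigma_sets.Basic) auto
qed (use assms(2) in \<open>auto dest: measurable_space\<close>)

locale two_samples = prob_space M
  for M :: "'w measure" and S :: "'b measure" and u :: "nat \<Rightarrow> 'w \<Rightarrow> 'b"
    and D :: "'c measure" and \<xi> :: "nat \<Rightarrow> 'w \<Rightarrow> 'c" and T :: nat +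
  assumes indep_u: "indep_vars (\<lambda>_. S) u {..T}"
    and indep_\<xi>: "indep_vars (\<lambda>_. D) \<xi> {..T}"
    and indep_families: "indep_rv M
           (Pi\<^sub>M {..T} (\<lambda>_. S)) (\<lambda>\<omega>. \<lambda>t\<in>{..T}. u t \<omega>)
           (Pi\<^sub>M {..T} (\<lambda>_. D)) (\<lambda>\<omega>. \<lambda>t\<in>{..T}. \<xi> t \<omega>)"
begin

abbreviation "H \<equiv> history M S u D \<xi>"
abbreviation "E \<equiv> sample_events M S u D \<xi>"
abbreviation "sample_index \<equiv> Inl ` {..T} \<union> Inr ` {..T} :: (nat + nat) set"

lemma u_measurable: "s \<le> T \<Longrightarrow> u s \<in> M \<rightarrow>\<^sub>M S"
  using indep_u by (auto simp: indep_vars_def)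

lemma \<xi>_measurable: "s \<le> T \<Longrightarrow> \<xi> s \<in> M \<rightarrow>\<^sub>M D"
  using indep_\<xi> by (auto simp: indep_vars_def)

text \<open>The empty index set is included; independence itself speaks only of nonempty ones.\<close>

lemma prob_cylinder:
  assumes "indep_vars (\<lambda>_. N) X {..T}" "J \<subseteq> {..T}" "\<And>s. s \<in> J \<Longrightarrow> B s \<in> sets N"
  shows "prob {\<omega> \<in> space M. \<forall>s\<in>J. X s \<omega> \<in> B s} = (\<Prod>s\<in>J. prob (X s -` B s \<inter> space M))"
proof (cases "J = {}")
  case False
  have "{\<omega> \<in> space M. \<forall>s\<in>J. X s \<omega> \<in> B s} = (\<Inter>s\<in>J. X s -` B s \<inter> space M)" using False by auto
  then show ?thesis
    using indep_varsD[OF assms(1) False _ assms(2), of B] assms(2,3) finite_subset[OF assms(2)] by simp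
qed (simp add: prob_space)

lemma cylinder_vimage:
  assumes "J \<subseteq> {..T}" "\<And>s. s \<in> J \<Longrightarrow> B s \<in> sets N" "\<And>s. s \<le> T \<Longrightarrow> X s \<in> M \<rightarrow>\<^sub>M N"
  obtains A where "A \<in> sets (Pi\<^sub>M {..T} (\<lambda>_. N))"
    "{\<omega> \<in> space M. \<forall>s\<in>J. X s \<omega> \<in> B s} = (\<lambda>\<omega>. \<lambda>t\<in>{..T}. X t \<omega>) -` A \<inter> space M"
proof
  let ?A = "Pi\<^sub>E {..T} (\<lambda>s. if s \<in> J then B s else space N)"
  show "?A \<in> sets (Pi\<^sub>M {..T} (\<lambda>_. N))" using assms(2) by (intro sets_PiM_I_finite) auto
  have "(\<forall>s\<in>J. X s \<omega> \<in> B s) \<longleftrightarrow> (\<lambda>t\<in>{..T}. X t \<omega>) \<in> ?A" if "\<omega> \<in> space M" for \<omega>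
    using assms(1) measurable_space[OF assms(3) that] by (auto simp: PiE_iff)
  then show "{\<omega> \<in> space M. \<forall>s\<in>J. X s \<omega> \<in> B s} = (\<lambda>\<omega>. \<lambda>t\<in>{..T}. X t \<omega>) -` ?A \<inter> space M"
    by blast
qed

text \<open>An event that involves finitely many variables splits into one about the directions and one about the samples. The
two families are independent of each other, and each is independent in itself.\<close>

lemma indep_sample_events: "indep_sets E sample_index"
  unfolding indep_sets_def
proof (intro conjI ballI allI impI)
  fix k assume "k \<in> sample_index"
  then show "E k \<subseteq> events"
    by (auto simp: sample_events_def intro: measurable_sets[OF u_measurable] measurable_sets[OF \<xi>_measurable])
next
  fix J A assume J: "J \<subseteq> sample_index" "J \<noteq> {}" "finite J" and A: "A \<in> Pi J E"
  define J1 where "J1 = Inl -` J"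
  define J2 where "J2 = Inr -` J"
  have J12: "J1 \<subseteq> {..T}" "J2 \<subseteq> {..T}" using J(1) by (auto simp: J1_def J2_def)
  have fin: "finite J1" "finite J2" using J12 finite_subset by auto
  have JU: "J = Inl ` J1 \<union> Inr ` J2"
  proof -
    have "k \<in> Inl ` J1 \<union> Inr ` J2" if "k \<in> J" for k
      using that by (cases k) (auto simp: J1_def J2_def)
    then show ?thesis by (auto simp: J1_def J2_def)
  qed
  have "\<forall>s\<in>J1. \<exists>B. B \<in> sets S \<and> A (Inl s) = u s -` B \<inter> space M"
  proof
    fix s assume "s \<in> J1"
    then have "A (Inl s) \<in> E (Inl s)" using A by (auto simp: J1_def Pi_iff)
    then show "\<exists>B. B \<in> sets S \<and> A (Inl s) = u s -` B \<inter> space M"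
      by (auto simp: sample_events_def)
  qed
  from bchoice[OF this] obtain B1 where B1': "\<forall>s\<in>J1. B1 s \<in> sets S \<and> A (Inl s) = u s -` B1 s \<inter> space M" ..
  have B1: "B1 s \<in> sets S" "A (Inl s) = u s -` B1 s \<inter> space M" if "s \<in> J1" for s
    using B1' that by simp_all
  have "\<forall>s\<in>J2. \<exists>B. B \<in> sets D \<and> A (Inr s) = \<xi> s -` B \<inter> space M"
  proof
    fix s assume "s \<in> J2"
    then have "A (Inr s) \<in> E (Inr s)" using A by (auto simp: J2_def Pi_iff)
    then show "\<exists>B. B \<in> sets D \<and> A (Inr s) = \<xi> s -` B \<inter> space M"
      by (auto simp: sample_events_def)
  qed
  from bchoice[OF this] obtain B2 where B2': "\<forall>s\<in>J2. B2 s \<in> sets D \<and> A (Inr s) = \<xi> s -` B2 s \<inter> space M" ..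
  have B2: "B2 s \<in> sets D" "A (Inr s) = \<xi> s -` B2 s \<inter> space M" if "s \<in> J2" for s
    using B2' that by simp_all
  let ?X = "{\<omega> \<in> space M. \<forall>s\<in>J1. u s \<omega> \<in> B1 s}" and ?Y = "{\<omega> \<in> space M. \<forall>s\<in>J2. \<xi> s \<omega> \<in> B2 s}"
  obtain C1 where C1: "C1 \<in> sets (Pi\<^sub>M {..T} (\<lambda>_. S))" "?X = (\<lambda>\<omega>. \<lambda>t\<in>{..T}. u t \<omega>) -` C1 \<inter> space M"
    by (rule cylinder_vimage[OF J12(1) B1(1) u_measurable])
  obtain C2 where C2: "C2 \<in> sets (Pi\<^sub>M {..T} (\<lambda>_. D))" "?Y = (\<lambda>\<omega>. \<lambda>t\<in>{..T}. \<xi> t \<omega>) -` C2 \<inter> space M"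
    by (rule cylinder_vimage[OF J12(2) B2(1) \<xi>_measurable])
  have "prob (?X \<inter> ?Y) = prob ?X * prob ?Y"
    unfolding C1(2) C2(2) using indep_families C1(1) C2(1)
    by (intro indep_setD) (auto simp: indep_rv_def)
  moreover have "(\<Inter>j\<in>J. A j) = ?X \<inter> ?Y"
  proof (rule set_eqI)
    fix \<omega>
    have "\<omega> \<in> (\<Inter>j\<in>J. A j) \<longleftrightarrow> (\<forall>s\<in>J1. \<omega> \<in> A (Inl s)) \<and> (\<forall>s\<in>J2. \<omega> \<in> A (Inr s))"
      by (simp add: JU ball_Un)
    also have "\<dots> \<longleftrightarrow> (\<forall>s\<in>J1. \<omega> \<in> u s -` B1 s \<inter> space M) \<and> (\<forall>s\<in>J2. \<omega> \<in> \<xi> s -` B2 s \<inter> space M)"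
      using B1(2) B2(2) by simp
    also have "\<dots> \<longleftrightarrow> \<omega> \<in> ?X \<inter> ?Y"
      using J(2) unfolding JU by blast
    finally show "\<omega> \<in> (\<Inter>j\<in>J. A j) \<longleftrightarrow> \<omega> \<in> ?X \<inter> ?Y" .
  qed
  moreover have "(\<Prod>j\<in>J. prob (A j)) = (\<Prod>s\<in>J1. prob (A (Inl s))) * (\<Prod>s\<in>J2. prob (A (Inr s)))"
    unfolding JU using fin by (subst prod.union_disjoint) (auto simp: prod.reindex inj_on_def)
  ultimately show "prob (\<Inter>j\<in>J. A j) = (\<Prod>j\<in>J. prob (A j))"
    using prob_cylinder[OF indep_u J12(1) B1(1)] prob_cylinder[OF indep_\<xi> J12(2) B2(1)] B1(2) B2(2) by simp
qed

lemma indep_history: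
  assumes "KY \<subseteq> sample_index" "KZ \<subseteq> sample_index" "KY \<inter> KZ = {}"
  shows "indep_set (sets (H KY)) (sets (H KZ))"
proof -
  have "indep_sets (\<lambda>j. sigma_sets (space M) (\<Union>i\<in>case_bool KY KZ j. E i)) UNIV"
  proof (rule indep_sets_collect_sigma)
    show "indep_sets E (\<Union>j\<in>UNIV. case_bool KY KZ j)"
      by (rule indep_sets_mono_index[OF _ indep_sample_events]) (use assms in \<open>auto simp: UNIV_bool\<close>)
    show "Int_stable (E i)" for i
    proof (rule Int_stableI)
      fix a b assume "a \<in> E i" "b \<in> E i"
      then show "a \<inter> b \<in> E i"
      proof (cases i)
        case (Inl s)
        then obtain A B where "A \<in> sets S" "B \<in> sets S" "a = u s -` A \<inter> space M" "b = u s -` B \<inter> space M"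
          using \<open>a \<in> E i\<close> \<open>b \<in> E i\<close> by (auto simp: sample_events_def)
        then show ?thesis unfolding sample_events_def Inl by (auto intro!: exI[of _ "A \<inter> B"])
      next
        case (Inr s)
        then obtain A B where "A \<in> sets D" "B \<in> sets D" "a = \<xi> s -` A \<inter> space M" "b = \<xi> s -` B \<inter> space M"
          using \<open>a \<in> E i\<close> \<open>b \<in> E i\<close> by (auto simp: sample_events_def)
        then show ?thesis unfolding sample_events_def Inr by (auto intro!: exI[of _ "A \<inter> B"])
      qed
    qed
    show "disjoint_family_on (case_bool KY KZ) UNIV"
      using assms(3) by (auto simp: disjoint_family_on_def split: bool.splits)
  qed
  moreover have "(\<lambda>j. sigma_sets (space M) (\<Union>i\<in>case_bool KY KZ j. E i)) = case_bool (sets (H KY)) (sets (H KZ))"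
    by (auto simp: sets_history fun_eq_iff split: bool.splits)
  ultimately show ?thesis unfolding indep_set_def by simp
qed

lemma history_subset: "K \<subseteq> sample_index \<Longrightarrow> sets (H K) \<subseteq> events"
  unfolding sets_history using indep_sample_events
  by (intro sets.sigma_sets_subset) (auto simp: indep_sets_def)

lemma measurable_history:
  assumes "K \<subseteq> sample_index" "Y \<in> H K \<rightarrow>\<^sub>M N"
  shows "Y \<in> M \<rightarrow>\<^sub>M N"
  using assms(2) history_subset[OF assms(1)] by (auto simp: measurable_def)

lemma u_history: "s \<le> T \<Longrightarrow> Inl s \<in> K \<Longrightarrow> u s \<in> H K \<rightarrow>\<^sub>M S"
  by (rule measurable_history_Inl[where u = u and s = s]) (auto intro: u_measurable)

lemma \<xi>_history: "s \<le> T \<Longrightarrow> Inr s \<in> K \<Longrightarrow> \<xi> s \<in> H K \<rightarrow>\<^sub>M D"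
  by (rule measurable_history_Inr[where \<xi> = \<xi> and s = s]) (auto intro: \<xi>_measurable)

lemma distr_pair_history:
  assumes K: "KY \<subseteq> sample_index" "KZ \<subseteq> sample_index" "KY \<inter> KZ = {}"
    and Y: "Y \<in> H KY \<rightarrow>\<^sub>M NY" and Z: "Z \<in> H KZ \<rightarrow>\<^sub>M NZ"
  shows "distr M (NY \<Otimes>\<^sub>M NZ) (\<lambda>\<omega>. (Y \<omega>, Z \<omega>)) = distr M NY Y \<Otimes>\<^sub>M distr M NZ Z"
proof -
  have [measurable]: "Y \<in> M \<rightarrow>\<^sub>M NY" "Z \<in> M \<rightarrow>\<^sub>M NZ" using K Y Z by (auto intro: measurable_history)
  interpret Y: prob_space "distr M NY Y" by (rule prob_space_distr) measurable
  interpret Z: prob_space "distr M NZ Z" by (rule prob_space_distr) measurable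
  have "distr M NY Y \<Otimes>\<^sub>M distr M NZ Z = distr M (NY \<Otimes>\<^sub>M NZ) (\<lambda>\<omega>. (Y \<omega>, Z \<omega>))"
  proof (rule pair_measure_eqI)
    show "sigma_finite_measure (distr M NY Y)" "sigma_finite_measure (distr M NZ Z)" ..
    show "sets (distr M NY Y \<Otimes>\<^sub>M distr M NZ Z) = sets (distr M (NY \<Otimes>\<^sub>M NZ) (\<lambda>\<omega>. (Y \<omega>, Z \<omega>)))"
      by (simp cong: sets_pair_measure_cong)
    fix A B assume "A \<in> sets (distr M NY Y)" "B \<in> sets (distr M NZ Z)"
    then have [measurable]: "A \<in> sets NY" "B \<in> sets NZ" by auto
    have "Y -` A \<inter> space M \<in> sets (H KY)" "Z -` B \<inter> space M \<in> sets (H KZ)"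
      using measurable_sets[OF Y \<open>A \<in> sets NY\<close>] measurable_sets[OF Z \<open>B \<in> sets NZ\<close>] by simp_all
    then have "prob ((Y -` A \<inter> space M) \<inter> (Z -` B \<inter> space M)) = prob (Y -` A \<inter> space M) * prob (Z -` B \<inter> space M)"
      by (rule indep_setD[OF indep_history[OF K]])
    moreover have "(\<lambda>\<omega>. (Y \<omega>, Z \<omega>)) -` (A \<times> B) \<inter> space M = (Y -` A \<inter> space M) \<inter> (Z -` B \<inter> space M)" by auto
    ultimately show "emeasure (distr M NY Y) A * emeasure (distr M NZ Z) B
        = emeasure (distr M (NY \<Otimes>\<^sub>M NZ) (\<lambda>\<omega>. (Y \<omega>, Z \<omega>))) (A \<times> B)"
      by (simp add: emeasure_distr emeasure_eq_measure ennreal_mult)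
  qed
  then show ?thesis by simp
qed

text \<open>A variable that is independent of the past can be integrated out while the past is kept fixed. This replaces
conditional expectations throughout.\<close>

lemma fresh_nn_integral:
  assumes K: "KY \<subseteq> sample_index" "KZ \<subseteq> sample_index" "KY \<inter> KZ = {}"
    and Y: "Y \<in> H KY \<rightarrow>\<^sub>M NY" and Z: "Z \<in> H KZ \<rightarrow>\<^sub>M NZ" and N: "distr M NZ Z = NZ'"
    and \<Phi>: "\<Phi> \<in> borel_measurable (NY \<Otimes>\<^sub>M NZ)"
  shows "(\<integral>\<^sup>+\<omega>. \<Phi> (Y \<omega>, Z \<omega>) \<partial>M) = (\<integral>\<^sup>+\<omega>. \<integral>\<^sup>+z. \<Phi> (Y \<omega>, z) \<partial>NZ' \<partial>M)"
proof -
  have [measurable]: "Y \<in> M \<rightarrow>\<^sub>M NY" "Z \<in> M \<rightarrow>\<^sub>M NZ" using K Y Z by (auto intro: measurable_history)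
  interpret Y: prob_space "distr M NY Y" by (rule prob_space_distr) measurable
  interpret Z: prob_space NZ' unfolding N[symmetric] by (rule prob_space_distr) measurable
  have sets_N [measurable_cong]: "sets NZ' = sets NZ" unfolding N[symmetric] by simp
  have [measurable]: "\<Phi> \<in> borel_measurable (NY \<Otimes>\<^sub>M NZ)" by (rule \<Phi>)
  have "(\<integral>\<^sup>+\<omega>. \<Phi> (Y \<omega>, Z \<omega>) \<partial>M) = (\<integral>\<^sup>+p. \<Phi> p \<partial>distr M (NY \<Otimes>\<^sub>M NZ) (\<lambda>\<omega>. (Y \<omega>, Z \<omega>)))"
    by (subst nn_integral_distr) measurable
  also have "\<dots> = (\<integral>\<^sup>+p. \<Phi> p \<partial>(distr M NY Y \<Otimes>\<^sub>M NZ'))"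
    by (simp only: distr_pair_history[OF K Y Z] N)
  also have "\<dots> = (\<integral>\<^sup>+y. \<integral>\<^sup>+z. \<Phi> (y, z) \<partial>NZ' \<partial>distr M NY Y)"
    by (rule Z.nn_integral_fst[symmetric]) measurable
  also have "\<dots> = (\<integral>\<^sup>+\<omega>. \<integral>\<^sup>+z. \<Phi> (Y \<omega>, z) \<partial>NZ' \<partial>M)"
    by (rule nn_integral_distr) measurable
  finally show ?thesis .
qed

lemma fresh_integral:
  fixes \<Phi> :: "'y \<times> 'v \<Rightarrow> real"
  assumes K: "KY \<subseteq> sample_index" "KZ \<subseteq> sample_index" "KY \<inter> KZ = {}"
    and Y: "Y \<in> H KY \<rightarrow>\<^sub>M NY" and Z: "Z \<in> H KZ \<rightarrow>\<^sub>M NZ" and N: "distr M NZ Z = NZ'"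
    and \<Phi>: "\<Phi> \<in> borel_measurable (NY \<Otimes>\<^sub>M NZ)" and int: "integrable M (\<lambda>\<omega>. \<Phi> (Y \<omega>, Z \<omega>))"
  shows "(\<integral>\<omega>. \<Phi> (Y \<omega>, Z \<omega>) \<partial>M) = (\<integral>\<omega>. \<integral>z. \<Phi> (Y \<omega>, z) \<partial>NZ' \<partial>M)"
proof -
  have [measurable]: "Y \<in> M \<rightarrow>\<^sub>M NY" "Z \<in> M \<rightarrow>\<^sub>M NZ" using K Y Z by (auto intro: measurable_history)
  interpret Y: prob_space "distr M NY Y" by (rule prob_space_distr) measurable
  interpret Z: prob_space NZ' unfolding N[symmetric] by (rule prob_space_distr) measurable
  interpret P: pair_prob_space "distr M NY Y" NZ' ..
  have sets_N [measurable_cong]: "sets NZ' = sets NZ" unfolding N[symmetric] by simp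
  have [measurable]: "\<Phi> \<in> borel_measurable (NY \<Otimes>\<^sub>M NZ)" by (rule \<Phi>)
  have law: "distr M (NY \<Otimes>\<^sub>M NZ) (\<lambda>\<omega>. (Y \<omega>, Z \<omega>)) = distr M NY Y \<Otimes>\<^sub>M NZ'"
    by (simp only: distr_pair_history[OF K Y Z] N)
  have "integrable (distr M (NY \<Otimes>\<^sub>M NZ) (\<lambda>\<omega>. (Y \<omega>, Z \<omega>))) \<Phi>"
    using int by (subst integrable_distr_eq) measurable
  then have int': "integrable (distr M NY Y \<Otimes>\<^sub>M NZ') \<Phi>" by (simp only: law)
  have "(\<integral>\<omega>. \<Phi> (Y \<omega>, Z \<omega>) \<partial>M) = (\<integral>p. \<Phi> p \<partial>distr M (NY \<Otimes>\<^sub>M NZ) (\<lambda>\<omega>. (Y \<omega>, Z \<omega>)))"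
    by (subst integral_distr) measurable
  also have "\<dots> = (\<integral>y. \<integral>z. \<Phi> (y, z) \<partial>NZ' \<partial>distr M NY Y)"
    unfolding law by (rule P.integral_fst'[OF int', symmetric])
  also have "\<dots> = (\<integral>\<omega>. \<integral>z. \<Phi> (Y \<omega>, z) \<partial>NZ' \<partial>M)"
    by (rule integral_distr) measurable
  finally show ?thesis .
qed

end

section \<open>Moments of the residual estimator\<close>

lemma abs_mult_le_sum_squares: "\<bar>a * b\<bar> \<le> a\<^sup>2 + b\<^sup>2" for a b :: real
proof -
  have "2 * (\<bar>a\<bar> * \<bar>b\<bar>) \<le> \<bar>a\<bar>\<^sup>2 + \<bar>b\<bar>\<^sup>2"
    using sum_squares_bound[of "\<bar>a\<bar>" "\<bar>b\<bar>"] by (simp add: mult.assoc)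
  moreover have "0 \<le> \<bar>a\<bar> * \<bar>b\<bar>" by simp
  ultimately show ?thesis unfolding abs_mult power2_abs by linarith
qed

lemma square_add_le: "(a + b)\<^sup>2 \<le> 2 * a\<^sup>2 + 2 * b\<^sup>2" for a b :: real
  using sum_squares_bound[of a b] by (simp add: power2_sum)

lemma norm_diff_unit_square:
  fixes X v :: "'a::real_inner"
  assumes "norm v = 1"
  shows "(norm (X - a *\<^sub>R v))\<^sup>2 = (norm X)\<^sup>2 - 2 * a * (v \<bullet> X) + a\<^sup>2"
proof -
  have "v \<bullet> v = 1" using assms by (simp add: dot_square_norm)
  then show ?thesis
    unfolding power2_norm_eq_inner
    by (simp add: inner_diff_left inner_diff_right inner_commute[of X v] power2_eq_square)
       (simp add: algebra_simps)
qed

text \<open>The arithmetic of the regret bound, for the sequences of expectations that occur: \<open>D\<close> are the squared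
differences of consecutive values, \<open>V\<close> the sphere variances, \<open>\<delta>\<close> the squared step lengths, \<open>R\<close> the
squared distances to the minimizer, \<open>W\<close> the inner products of the ball gradients with \<open>x - xstar\<close>, \<open>G\<close>
the gaps and \<open>P\<close> the squared ball gradients. The contraction bounds the sum of \<open>D\<close> by the noise and the
variances, and the bound on \<open>\<eta> L d\<close> lets the surplus \<open>P / (2 L)\<close> absorb the gradient part of the variances.\<close>

lemma telescoped_regret:
  fixes D V \<delta> R W G P :: "nat \<Rightarrow> real" and T :: nat and L0 L \<sigma>0 \<alpha> \<eta> d :: real
  assumes val_bound: "\<And>s. s < T \<Longrightarrow> D s \<le> \<sigma>0\<^sup>2 + V (Suc s) + 2 * L0\<^sup>2 * \<delta> s + 2 * (\<sigma>0\<^sup>2 + V s)"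
    and increment: "\<And>s. s < T \<Longrightarrow> \<delta> (Suc s) = (\<eta> * (d / \<alpha>))\<^sup>2 * D s" and \<delta>0: "\<delta> 0 = 0"
    and distance: "\<And>s. s < T \<Longrightarrow> R (Suc s) = R s - 2 * \<eta> * W s + \<delta> (Suc s)" and RT: "0 \<le> R T"
    and descent: "\<And>s. s < T \<Longrightarrow> G s - L * \<alpha>\<^sup>2 / 2 + P s / (2 * L) \<le> W s"
    and variance: "\<And>s. s < T \<Longrightarrow> V (Suc s) \<le> \<alpha>\<^sup>2 / d * (P s + 5 / 8 * (L\<^sup>2 * \<alpha>\<^sup>2))"
    and V0: "V 0 = V (Suc 0)" and Vnn: "\<And>s. 0 \<le> V s" and Dnn: "\<And>s. 0 \<le> D s" and Pnn: "\<And>s. 0 \<le> P s"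
    and pos: "\<alpha> > 0" "\<eta> > 0" "d > 0" "L > 0" and T: "T \<ge> 1"
    and contraction: "L0\<^sup>2 * (\<eta> * (d / \<alpha>))\<^sup>2 \<le> 1 / 64" and step: "\<eta> * L * d \<le> 1 / 10"
  shows "(\<Sum>s<T. G s) \<le> R 0 / (2 * \<eta>) + T * (48 / 31 * (\<eta> * (d / \<alpha>)\<^sup>2 * \<sigma>0\<^sup>2) + (1 / 2 + 5 / 31) * (L * \<alpha>\<^sup>2))"
proof -
  define k where "k = d / \<alpha>"
  define SD where "SD = (\<Sum>s<T. D s)"
  define SV where "SV = (\<Sum>s<T. V (Suc s))"
  define SP where "SP = (\<Sum>s<T. P s)"
  obtain n where n: "T = Suc n" using T by (cases T) auto
  have SD0: "0 \<le> SD" and SP0: "0 \<le> SP" unfolding SD_def SP_def by (intro sum_nonneg Dnn Pnn)+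
  \<comment> \<open>The term at time \<open>0\<close> repeats the one at time \<open>1\<close>, because the algorithm starts with two equal iterates.\<close>
  have sumV: "(\<Sum>s<T. V s) \<le> 2 * SV"
  proof -
    have "(\<Sum>s<T. V s) = V (Suc 0) + (\<Sum>s<n. V (Suc s))"
      unfolding n by (simp only: sum.lessThan_Suc_shift V0)
    moreover have "V (Suc 0) \<le> SV"
      unfolding SV_def n by (rule member_le_sum[of 0 "{..<Suc n}" "\<lambda>s. V (Suc s)"]) (auto intro: Vnn)
    moreover have "(\<Sum>s<n. V (Suc s)) \<le> SV" unfolding SV_def n using Vnn[of "Suc n"] by simp
    ultimately show ?thesis by linarith
  qed
  \<comment> \<open>Shifted by one index, because the step length at \<open>s\<close> belongs to the estimator before it.\<close>
  have sum\<delta>: "(\<Sum>s<T. \<delta> s) \<le> (\<eta> * k)\<^sup>2 * SD"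
  proof -
    have "(\<Sum>s<T. \<delta> s) = (\<Sum>s<n. (\<eta> * k)\<^sup>2 * D s)"
      unfolding n k_def sum.lessThan_Suc_shift \<delta>0 using increment[unfolded n] by simp
    also have "\<dots> = (\<eta> * k)\<^sup>2 * (\<Sum>s<n. D s)" by (rule sum_distrib_left[symmetric])
    also have "\<dots> \<le> (\<eta> * k)\<^sup>2 * SD"
      unfolding SD_def n using Dnn[of n] by (intro mult_left_mono) auto
    finally show ?thesis .
  qed
  have "SD \<le> (\<Sum>s<T. \<sigma>0\<^sup>2 + V (Suc s) + 2 * L0\<^sup>2 * \<delta> s + 2 * (\<sigma>0\<^sup>2 + V s))"
    unfolding SD_def by (intro sum_mono val_bound) simp
  also have "\<dots> = 3 * T * \<sigma>0\<^sup>2 + SV + 2 * L0\<^sup>2 * (\<Sum>s<T. \<delta> s) + 2 * (\<Sum>s<T. V s)"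
    by (simp add: sum.distrib sum_distrib_left[symmetric] SV_def)
  also have "\<dots> \<le> 3 * T * \<sigma>0\<^sup>2 + SV + 2 * L0\<^sup>2 * ((\<eta> * k)\<^sup>2 * SD) + 2 * (2 * SV)"
    using sumV sum\<delta> by (intro add_mono mult_left_mono) auto
  also have "2 * L0\<^sup>2 * ((\<eta> * k)\<^sup>2 * SD) = 2 * (L0\<^sup>2 * (\<eta> * k)\<^sup>2) * SD" by simp
  also have "\<dots> \<le> 2 * (1 / 64) * SD"
    using contraction SD0 unfolding k_def by (intro mult_right_mono mult_left_mono) auto
  finally have SD: "SD \<le> 32 / 31 * (3 * T * \<sigma>0\<^sup>2 + 5 * SV)" by simp
  have "SV \<le> (\<Sum>s<T. \<alpha>\<^sup>2 / d * (P s + 5 / 8 * (L\<^sup>2 * \<alpha>\<^sup>2)))"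
    unfolding SV_def by (intro sum_mono variance) simp
  also have "\<dots> = \<alpha>\<^sup>2 / d * (SP + T * (5 / 8 * (L\<^sup>2 * \<alpha>\<^sup>2)))"
    unfolding SP_def sum_distrib_left[symmetric] sum.distrib by simp
  finally have SV: "SV \<le> \<alpha>\<^sup>2 / d * (SP + T * (5 / 8 * (L\<^sup>2 * \<alpha>\<^sup>2)))" .
  have "(\<Sum>s<T. R (Suc s) - R s) = - 2 * \<eta> * (\<Sum>s<T. W s) + (\<Sum>s<T. \<delta> (Suc s))"
    using distance by (simp add: sum.distrib sum_subtractf sum_distrib_left sum_negf)
  also have "(\<Sum>s<T. \<delta> (Suc s)) = (\<eta> * k)\<^sup>2 * SD"
    unfolding SD_def k_def using increment by (simp add: sum_distrib_left)
  also have "(\<Sum>s<T. R (Suc s) - R s) = R T - R 0" by (rule sum_lessThan_telescope)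
  finally have "2 * \<eta> * (\<Sum>s<T. W s) \<le> R 0 + (\<eta> * k)\<^sup>2 * SD" using RT by linarith
  then have "(\<Sum>s<T. W s) \<le> (R 0 + (\<eta> * k)\<^sup>2 * SD) / (2 * \<eta>)"
    using pos by (simp add: pos_le_divide_eq mult_ac)
  also have "\<dots> = R 0 / (2 * \<eta>) + \<eta> * k\<^sup>2 / 2 * SD"
    using pos by (simp add: add_divide_distrib power_mult_distrib power2_eq_square)
  also have "\<eta> * k\<^sup>2 / 2 * SD \<le> \<eta> * k\<^sup>2 / 2 * (32 / 31 * (3 * T * \<sigma>0\<^sup>2 + 5 * SV))"
    using SD pos by (intro mult_left_mono) auto
  also have "\<dots> = T * (48 / 31 * (\<eta> * k\<^sup>2 * \<sigma>0\<^sup>2)) + 80 / 31 * (\<eta> * k\<^sup>2 * SV)"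
    by (simp add: field_simps)
  also have "\<eta> * k\<^sup>2 * SV \<le> \<eta> * k\<^sup>2 * (\<alpha>\<^sup>2 / d * (SP + T * (5 / 8 * (L\<^sup>2 * \<alpha>\<^sup>2))))"
    using SV pos by (intro mult_left_mono) auto
  also have "\<dots> = (\<eta> * L * d) * ((SP + T * (5 / 8 * (L\<^sup>2 * \<alpha>\<^sup>2))) / L)"
    using pos by (simp add: k_def power2_eq_square)
  also have "\<dots> \<le> 1 / 10 * ((SP + T * (5 / 8 * (L\<^sup>2 * \<alpha>\<^sup>2))) / L)"
    using step SP0 pos by (intro mult_right_mono) auto
  also have "\<dots> = SP / (10 * L) + T * (1 / 16 * (L * \<alpha>\<^sup>2))"
    using pos by (simp add: add_divide_distrib power2_eq_square mult_ac)
  finally have W: "(\<Sum>s<T. W s) \<le> R 0 / (2 * \<eta>)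
      + (T * (48 / 31 * (\<eta> * k\<^sup>2 * \<sigma>0\<^sup>2)) + 80 / 31 * (SP / (10 * L) + T * (1 / 16 * (L * \<alpha>\<^sup>2))))"
    by simp
  have "(\<Sum>s<T. G s - L * \<alpha>\<^sup>2 / 2 + P s / (2 * L)) \<le> (\<Sum>s<T. W s)"
    by (intro sum_mono descent) simp
  moreover have "(\<Sum>s<T. G s - L * \<alpha>\<^sup>2 / 2 + P s / (2 * L)) = (\<Sum>s<T. G s) - T * (L * \<alpha>\<^sup>2 / 2) + SP / (2 * L)"
    by (simp add: sum.distrib sum_subtractf sum_divide_distrib[symmetric] SP_def)
  \<comment> \<open>The surplus of the descent inequality absorbs the gradient part of the variances.\<close>
  moreover have "80 / 31 * (SP / (10 * L)) \<le> SP / (2 * L)"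
    using SP0 pos by (simp add: divide_simps)
  moreover have "T * (48 / 31 * (\<eta> * k\<^sup>2 * \<sigma>0\<^sup>2) + (1 / 2 + 5 / 31) * (L * \<alpha>\<^sup>2))
      = T * (48 / 31 * (\<eta> * k\<^sup>2 * \<sigma>0\<^sup>2)) + T * (L * \<alpha>\<^sup>2 / 2) + 80 / 31 * (T * (1 / 16 * (L * \<alpha>\<^sup>2)))"
    by (simp add: algebra_simps)
  ultimately show ?thesis using W unfolding k_def distrib_left[of "80 / 31"] by linarith
qed

text \<open>The algorithm run on a smooth convex \<open>f\<close> that is the mean of \<open>F\<close>. The sequences
\<open>x\<close>, \<open>query\<close> and \<open>val\<close> defined in it are the iterates, the points at which \<open>F\<close> is evaluated, and the
observed values.\<close>

locale residual_feedback = smooth_convex f gf L L0 + two_samples M borel u D \<xi> T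
  for f :: "'a::euclidean_space \<Rightarrow> real" and gf L L0
    and M :: "'w measure" and u :: "nat \<Rightarrow> 'w \<Rightarrow> 'a" and D :: "'z measure" and \<xi> and T +
  fixes F :: "'a \<Rightarrow> 'z \<Rightarrow> real" and x1 xs :: 'a and \<sigma>0 \<alpha> \<eta> :: real
  assumes D: "prob_space D"
    and F_measurable: "(\<lambda>p. F (fst p) (snd p)) \<in> borel_measurable (borel \<Otimes>\<^sub>M D)"
    and F_integrable: "\<And>y. integrable D (F y)"
    and F_mean: "\<And>y. f y = (\<integral>z. F y z \<partial>D)"
    and noise_integrable: "\<And>y. integrable D (\<lambda>z. (F y z - f y)\<^sup>2)"
    and noise: "\<And>y. (\<integral>z. (F y z - f y)\<^sup>2 \<partial>D) \<le> \<sigma>0\<^sup>2"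
    and u_law: "\<And>t. t \<le> T \<Longrightarrow> distr M borel (u t) = uniform_sphere"
    and \<xi>_law: "\<And>t. t \<le> T \<Longrightarrow> distr M D (\<xi> t) = D"
    and \<alpha>_pos: "\<alpha> > 0" and \<eta>_pos: "\<eta> > 0"
    and minimizer: "\<And>y. f xs \<le> f y"
begin

definition x :: "nat \<Rightarrow> 'w \<Rightarrow> 'a" where
  "x t \<omega> = residual_iterate F \<alpha> \<eta> x1 (\<lambda>s. u s \<omega>) (\<lambda>s. \<xi> s \<omega>) t"

definition query :: "nat \<Rightarrow> 'w \<Rightarrow> 'a" where
  "query t \<omega> = x t \<omega> + \<alpha> *\<^sub>R u t \<omega>"

definition val :: "nat \<Rightarrow> 'w \<Rightarrow> real" where
  "val t \<omega> = F (query t \<omega>) (\<xi> t \<omega>)"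

abbreviation "past t \<equiv> Inl ` {..<t} \<union> Inr ` {..<t} :: (nat + nat) set"
abbreviation "mid t \<equiv> Inl ` {..t} \<union> Inr ` {..<t} :: (nat + nat) set"

lemma x_0: "x 0 \<omega> = x1" and x_1: "x (Suc 0) \<omega> = x1"
  by (simp_all add: x_def)

lemma x_Suc:
  "x (Suc (Suc s)) \<omega> = x (Suc s) \<omega> - (\<eta> * (DIM('a) / \<alpha>) * (val (Suc s) \<omega> - val s \<omega>)) *\<^sub>R u (Suc s) \<omega>"
  by (simp add: x_def val_def query_def residual_estimate_def)

lemma query_measurable:
  assumes "t \<le> T" "x t \<in> H (past t) \<rightarrow>\<^sub>M borel"
  shows "query t \<in> H (mid t) \<rightarrow>\<^sub>M borel"
proof -
  have [measurable]: "x t \<in> H (mid t) \<rightarrow>\<^sub>M borel"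
    by (rule measurable_history_mono[OF assms(2)]) auto
  have [measurable]: "u t \<in> H (mid t) \<rightarrow>\<^sub>M borel"
    by (rule u_history[OF assms(1)]) auto
  show ?thesis unfolding query_def[abs_def] by measurable
qed

lemma val_measurable:
  assumes "t \<le> T" "x t \<in> H (past t) \<rightarrow>\<^sub>M borel"
  shows "val t \<in> H (past (Suc t)) \<rightarrow>\<^sub>M borel"
proof -
  have 1: "query t \<in> H (past (Suc t)) \<rightarrow>\<^sub>M borel"
    by (rule measurable_history_mono[OF query_measurable[OF assms]]) auto
  have 2: "\<xi> t \<in> H (past (Suc t)) \<rightarrow>\<^sub>M D"
    by (rule \<xi>_history[OF assms(1)]) auto
  show ?thesis
    using measurable_compose[OF measurable_Pair[OF 1 2] F_measurable] by (simp add: val_def[abs_def])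
qed

text \<open>The iterate \<open>x t\<close> is a function of the directions and samples with indices below \<open>t\<close>, hence independent of
those at time \<open>t\<close>.\<close>

lemma x_measurable: "t \<le> Suc T \<Longrightarrow> x t \<in> H (past t) \<rightarrow>\<^sub>M borel"
proof (induction t rule: less_induct)
  case (less t)
  consider "t = 0" | "t = Suc 0" | s where "t = Suc (Suc s)" by (metis not0_implies_Suc)
  then show ?case
  proof cases
    case 3
    have s: "Suc s \<le> T" "s \<le> T" using less.prems 3 by auto
    have xs: "x (Suc s) \<in> H (past (Suc s)) \<rightarrow>\<^sub>M borel" "x s \<in> H (past s) \<rightarrow>\<^sub>M borel"
      using less.IH[of "Suc s"] less.IH[of s] less.prems 3 by auto
    have [measurable]: "x (Suc s) \<in> H (past t) \<rightarrow>\<^sub>M borel"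
      by (rule measurable_history_mono[OF xs(1)]) (use 3 in auto)
    have [measurable]: "val (Suc s) \<in> H (past t) \<rightarrow>\<^sub>M borel"
      by (rule measurable_history_mono[OF val_measurable[OF s(1) xs(1)]]) (use 3 in auto)
    have [measurable]: "val s \<in> H (past t) \<rightarrow>\<^sub>M borel"
      by (rule measurable_history_mono[OF val_measurable[OF s(2) xs(2)]]) (use 3 in auto)
    have [measurable]: "u (Suc s) \<in> H (past t) \<rightarrow>\<^sub>M borel"
      by (rule u_history[OF s(1)]) (use 3 in auto)
    have "x t = (\<lambda>\<omega>. x (Suc s) \<omega> - (\<eta> * (DIM('a) / \<alpha>) * (val (Suc s) \<omega> - val s \<omega>)) *\<^sub>R u (Suc s) \<omega>)"
      unfolding 3 by (rule ext) (rule x_Suc)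
    then show ?thesis by simp
  qed (simp_all add: x_0 x_1 cong: measurable_cong)
qed

lemma AE_norm_u:
  assumes "t \<le> T" shows "AE \<omega> in M. norm (u t \<omega>) = 1"
proof (rule AE_distrD[OF u_measurable[OF assms]])
  show "AE v in distr M borel (u t). norm v = 1"
    unfolding u_law[OF assms] by (rule AE_uniform_sphere)
qed

lemma noise_second_moment:
  "integrable D (\<lambda>z. (F y z - c)\<^sup>2)" "(\<integral>z. (F y z - c)\<^sup>2 \<partial>D) \<le> \<sigma>0\<^sup>2 + (f y - c)\<^sup>2"
proof -
  interpret D: prob_space D by (rule D)
  have eq: "(F y z - c)\<^sup>2 = (F y z - f y)\<^sup>2 + 2 * (f y - c) * (F y z - f y) + (f y - c)\<^sup>2" for z
    by (simp add: power2_eq_square algebra_simps)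
  have iF: "integrable D (\<lambda>z. F y z - f y)" using F_integrable by simp
  show "integrable D (\<lambda>z. (F y z - c)\<^sup>2)"
    unfolding eq using iF noise_integrable[of y] by simp
  have "(\<integral>z. (F y z - c)\<^sup>2 \<partial>D)
      = (\<integral>z. (F y z - f y)\<^sup>2 \<partial>D) + 2 * (f y - c) * (\<integral>z. F y z - f y \<partial>D) + (f y - c)\<^sup>2"
    unfolding eq using iF noise_integrable[of y] D.prob_space by simp
  also have "(\<integral>z. F y z - f y \<partial>D) = 0" using F_integrable[of y] D.prob_space by (simp add: F_mean[of y])
  finally show "(\<integral>z. (F y z - c)\<^sup>2 \<partial>D) \<le> \<sigma>0\<^sup>2 + (f y - c)\<^sup>2" using noise[of y] by simp
qed

text \<open>The sample is integrated out first and adds at most \<open>\<sigma>0\<^sup>2\<close>; then the direction is integrated out and adds the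
sphere variance. The reference value \<open>c\<close> may be any function of the past; it will be the previous value in one
application and the sphere mean in the other.\<close>

lemma val_second_moment:
  assumes t: "t \<le> T" and c: "c \<in> H (past t) \<rightarrow>\<^sub>M borel"
    and int: "integrable M (\<lambda>\<omega>. (sphere_mean \<alpha> (x t \<omega>) - c \<omega>)\<^sup>2)"
    and intV: "integrable M (\<lambda>\<omega>. sphere_variance \<alpha> (x t \<omega>))"
  shows "integrable M (\<lambda>\<omega>. (val t \<omega> - c \<omega>)\<^sup>2)"
    and "(\<integral>\<omega>. (val t \<omega> - c \<omega>)\<^sup>2 \<partial>M)
      \<le> \<sigma>0\<^sup>2 + (\<integral>\<omega>. sphere_variance \<alpha> (x t \<omega>) \<partial>M) + (\<integral>\<omega>. (sphere_mean \<alpha> (x t \<omega>) - c \<omega>)\<^sup>2 \<partial>M)"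
proof -
  have xt: "x t \<in> H (past t) \<rightarrow>\<^sub>M borel" by (rule x_measurable) (use t in simp)
  have idx: "past t \<subseteq> sample_index" "mid t \<subseteq> sample_index" "past (Suc t) \<subseteq> sample_index" using t by auto
  have [measurable]: "x t \<in> borel_measurable M" "c \<in> borel_measurable M" "val t \<in> borel_measurable M"
    using measurable_history[OF idx(1) xt] measurable_history[OF idx(1) c]
      measurable_history[OF idx(3) val_measurable[OF t xt]] by auto
  have [measurable]: "(\<lambda>p. F (fst p) (snd p)) \<in> borel_measurable (borel \<Otimes>\<^sub>M D)" by (rule F_measurable)
  let ?B = "\<sigma>0\<^sup>2 + (\<integral>\<omega>. sphere_variance \<alpha> (x t \<omega>) \<partial>M) + (\<integral>\<omega>. (sphere_mean \<alpha> (x t \<omega>) - c \<omega>)\<^sup>2 \<partial>M)"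
  let ?\<Phi> = "\<lambda>p::('a \<times> real) \<times> 'z. ennreal ((F (fst (fst p)) (snd p) - snd (fst p))\<^sup>2)"
  let ?\<Psi> = "\<lambda>p::('a \<times> real) \<times> 'a. ennreal (\<sigma>0\<^sup>2 + (f (fst (fst p) + \<alpha> *\<^sub>R snd p) - snd (fst p))\<^sup>2)"
  have "(\<lambda>p::('a \<times> real) \<times> 'z. F (fst (fst p)) (snd p)) \<in> borel_measurable ((borel \<Otimes>\<^sub>M borel) \<Otimes>\<^sub>M D)"
    using measurable_compose[OF measurable_Pair[OF measurable_compose[OF measurable_fst measurable_fst] measurable_snd] F_measurable]
    by simp
  then have \<Phi>m: "?\<Phi> \<in> borel_measurable ((borel \<Otimes>\<^sub>M borel) \<Otimes>\<^sub>M D)" by measurable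
  have \<Psi>m: "?\<Psi> \<in> borel_measurable ((borel \<Otimes>\<^sub>M borel) \<Otimes>\<^sub>M borel)" by measurable
  have "(\<integral>\<^sup>+\<omega>. ennreal ((val t \<omega> - c \<omega>)\<^sup>2) \<partial>M) = (\<integral>\<^sup>+\<omega>. ?\<Phi> ((query t \<omega>, c \<omega>), \<xi> t \<omega>) \<partial>M)"
    by (simp add: val_def)
  also have "\<dots> = (\<integral>\<^sup>+\<omega>. \<integral>\<^sup>+z. ?\<Phi> ((query t \<omega>, c \<omega>), z) \<partial>D \<partial>M)"
  proof (rule fresh_nn_integral[where \<Phi> = ?\<Phi> and KY = "mid t" and KZ = "{Inr t}", OF _ _ _ _ _ \<xi>_law[OF t] \<Phi>m])
    show "(\<lambda>\<omega>. (query t \<omega>, c \<omega>)) \<in> H (mid t) \<rightarrow>\<^sub>M borel \<Otimes>\<^sub>M borel"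
      by (rule measurable_Pair[OF query_measurable[OF t xt] measurable_history_mono[OF c]]) auto
    show "\<xi> t \<in> H {Inr t} \<rightarrow>\<^sub>M D" by (rule \<xi>_history[OF t]) simp
  qed (use t in auto)
  also have "\<dots> \<le> (\<integral>\<^sup>+\<omega>. ?\<Psi> ((x t \<omega>, c \<omega>), u t \<omega>) \<partial>M)"
  proof (rule nn_integral_mono)
    fix \<omega>
    show "(\<integral>\<^sup>+z. ?\<Phi> ((query t \<omega>, c \<omega>), z) \<partial>D) \<le> ?\<Psi> ((x t \<omega>, c \<omega>), u t \<omega>)"
      using noise_second_moment[of "query t \<omega>" "c \<omega>"]
      by (simp add: nn_integral_eq_integral query_def ennreal_leI del: ennreal_plus)
  qed
  also have "\<dots> = (\<integral>\<^sup>+\<omega>. \<integral>\<^sup>+v. ?\<Psi> ((x t \<omega>, c \<omega>), v) \<partial>uniform_sphere \<partial>M)"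
  proof (rule fresh_nn_integral[where \<Phi> = ?\<Psi> and KY = "past t" and KZ = "{Inl t}", OF _ _ _ _ _ u_law[OF t] \<Psi>m])
    show "(\<lambda>\<omega>. (x t \<omega>, c \<omega>)) \<in> H (past t) \<rightarrow>\<^sub>M borel \<Otimes>\<^sub>M borel"
      by (rule measurable_Pair[OF xt c])
    show "u t \<in> H {Inl t} \<rightarrow>\<^sub>M borel" by (rule u_history[OF t]) simp
  qed (use t in auto)
  also have "\<dots> = (\<integral>\<^sup>+\<omega>. ennreal (\<sigma>0\<^sup>2 + sphere_variance \<alpha> (x t \<omega>) + (sphere_mean \<alpha> (x t \<omega>) - c \<omega>)\<^sup>2) \<partial>M)"
  proof (rule nn_integral_cong)
    fix \<omega>
    interpret S: prob_space "uniform_sphere :: 'a measure" by (rule prob_space_uniform_sphere)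
    have "(\<integral>\<^sup>+v. ?\<Psi> ((x t \<omega>, c \<omega>), v) \<partial>uniform_sphere)
        = ennreal (\<integral>v. \<sigma>0\<^sup>2 + (f (x t \<omega> + \<alpha> *\<^sub>R v) - c \<omega>)\<^sup>2 \<partial>uniform_sphere)"
      using sphere_second_moment(1)[of "x t \<omega>" \<alpha> "c \<omega>"] by (simp add: nn_integral_eq_integral del: ennreal_plus)
    also have "(\<integral>v. \<sigma>0\<^sup>2 + (f (x t \<omega> + \<alpha> *\<^sub>R v) - c \<omega>)\<^sup>2 \<partial>uniform_sphere)
        = \<sigma>0\<^sup>2 + sphere_variance \<alpha> (x t \<omega>) + (sphere_mean \<alpha> (x t \<omega>) - c \<omega>)\<^sup>2"
      using sphere_second_moment[of "x t \<omega>" \<alpha> "c \<omega>"] S.prob_space by simp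
    finally show "(\<integral>\<^sup>+v. ?\<Psi> ((x t \<omega>, c \<omega>), v) \<partial>uniform_sphere)
        = ennreal (\<sigma>0\<^sup>2 + sphere_variance \<alpha> (x t \<omega>) + (sphere_mean \<alpha> (x t \<omega>) - c \<omega>)\<^sup>2)" .
  qed
  also have "\<dots> = ennreal (\<integral>\<omega>. \<sigma>0\<^sup>2 + sphere_variance \<alpha> (x t \<omega>) + (sphere_mean \<alpha> (x t \<omega>) - c \<omega>)\<^sup>2 \<partial>M)"
    using int intV by (intro nn_integral_eq_integral) (auto simp: sphere_variance_nonneg)
  also have "(\<integral>\<omega>. \<sigma>0\<^sup>2 + sphere_variance \<alpha> (x t \<omega>) + (sphere_mean \<alpha> (x t \<omega>) - c \<omega>)\<^sup>2 \<partial>M) = ?B"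
    using int intV prob_space by simp
  finally have bd: "(\<integral>\<^sup>+\<omega>. ennreal ((val t \<omega> - c \<omega>)\<^sup>2) \<partial>M) \<le> ennreal ?B" .
  show res: "integrable M (\<lambda>\<omega>. (val t \<omega> - c \<omega>)\<^sup>2)"
  proof (rule integrableI_nonneg)
    show "(\<integral>\<^sup>+\<omega>. ennreal ((val t \<omega> - c \<omega>)\<^sup>2) \<partial>M) < \<infinity>" using bd by (rule le_less_trans) simp
  qed auto
  have B0: "0 \<le> ?B"
    by (intro add_nonneg_nonneg integral_nonneg_AE) (auto simp: sphere_variance_nonneg)
  show "(\<integral>\<omega>. (val t \<omega> - c \<omega>)\<^sup>2 \<partial>M) \<le> ?B"
    using bd nn_integral_eq_integral[OF res] B0 by simp
qed

lemma past_subset: "t \<le> Suc T \<Longrightarrow> past t \<subseteq> sample_index"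
  by auto

lemma x_borel: "t \<le> Suc T \<Longrightarrow> x t \<in> borel_measurable M"
  by (rule measurable_history[OF past_subset x_measurable])

lemma val_borel:
  assumes "t \<le> T" shows "val t \<in> borel_measurable M"
proof (rule measurable_history)
  show "past (Suc t) \<subseteq> sample_index" using assms by auto
  show "val t \<in> H (past (Suc t)) \<rightarrow>\<^sub>M borel"
    using assms by (intro val_measurable x_measurable) auto
qed

lemma variance_integrable:
  assumes "t \<le> Suc T" shows "integrable M (\<lambda>\<omega>. sphere_variance \<alpha> (x t \<omega>))"
proof (rule integrable_const_bound)
  have [measurable]: "x t \<in> borel_measurable M" by (rule x_borel[OF assms])
  show "(\<lambda>\<omega>. sphere_variance \<alpha> (x t \<omega>)) \<in> borel_measurable M" by measurable
  show "AE \<omega> in M. norm (sphere_variance \<alpha> (x t \<omega>)) \<le> \<alpha>\<^sup>2 / DIM('a) * (L0\<^sup>2 + 5 / 8 * (L\<^sup>2 * \<alpha>\<^sup>2))"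
  proof (rule AE_I2)
    fix \<omega>
    have "sphere_variance \<alpha> (x t \<omega>) \<le> \<alpha>\<^sup>2 / DIM('a) * ((norm (ball_gradient \<alpha> (x t \<omega>)))\<^sup>2 + 5 / 8 * (L\<^sup>2 * \<alpha>\<^sup>2))"
      using \<alpha>_pos by (intro sphere_variance_bound) simp
    also have "\<dots> \<le> \<alpha>\<^sup>2 / DIM('a) * (L0\<^sup>2 + 5 / 8 * (L\<^sup>2 * \<alpha>\<^sup>2))"
      by (intro mult_left_mono add_right_mono power_mono norm_ball_gradient_le) auto
    finally show "norm (sphere_variance \<alpha> (x t \<omega>)) \<le> \<alpha>\<^sup>2 / DIM('a) * (L0\<^sup>2 + 5 / 8 * (L\<^sup>2 * \<alpha>\<^sup>2))"
      using sphere_variance_nonneg by simp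
  qed
qed

lemma gradient_square_integrable:
  assumes "t \<le> Suc T" shows "integrable M (\<lambda>\<omega>. (norm (ball_gradient \<alpha> (x t \<omega>)))\<^sup>2)"
proof (rule integrable_const_bound)
  have [measurable]: "x t \<in> borel_measurable M" by (rule x_borel[OF assms])
  show "(\<lambda>\<omega>. (norm (ball_gradient \<alpha> (x t \<omega>)))\<^sup>2) \<in> borel_measurable M" by measurable
  show "AE \<omega> in M. norm ((norm (ball_gradient \<alpha> (x t \<omega>)))\<^sup>2) \<le> L0\<^sup>2"
    by (rule AE_I2) (simp add: power_mono norm_ball_gradient_le)
qed

lemma gradient_inner_integrable:
  assumes t: "t \<le> Suc T" and X: "integrable M (\<lambda>\<omega>. (norm (x t \<omega> - xs))\<^sup>2)"
  shows "integrable M (\<lambda>\<omega>. ball_gradient \<alpha> (x t \<omega>) \<bullet> (x t \<omega> - xs))"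
proof (rule Bochner_Integration.integrable_bound)
  have [measurable]: "x t \<in> borel_measurable M" by (rule x_borel[OF t])
  show "(\<lambda>\<omega>. ball_gradient \<alpha> (x t \<omega>) \<bullet> (x t \<omega> - xs)) \<in> borel_measurable M" by measurable
  show "integrable M (\<lambda>\<omega>. L0\<^sup>2 + (norm (x t \<omega> - xs))\<^sup>2)" using X by simp
  show "AE \<omega> in M. norm (ball_gradient \<alpha> (x t \<omega>) \<bullet> (x t \<omega> - xs)) \<le> norm (L0\<^sup>2 + (norm (x t \<omega> - xs))\<^sup>2)"
  proof (rule AE_I2)
    fix \<omega>
    have "\<bar>ball_gradient \<alpha> (x t \<omega>) \<bullet> (x t \<omega> - xs)\<bar> \<le> norm (ball_gradient \<alpha> (x t \<omega>)) * norm (x t \<omega> - xs)"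
      by (rule Cauchy_Schwarz_ineq2)
    also have "\<dots> \<le> L0 * norm (x t \<omega> - xs)" by (intro mult_right_mono norm_ball_gradient_le) simp
    also have "\<dots> \<le> L0\<^sup>2 + (norm (x t \<omega> - xs))\<^sup>2"
      using abs_mult_le_sum_squares[of L0 "norm (x t \<omega> - xs)"] by linarith
    finally show "norm (ball_gradient \<alpha> (x t \<omega>) \<bullet> (x t \<omega> - xs)) \<le> norm (L0\<^sup>2 + (norm (x t \<omega> - xs))\<^sup>2)" by simp
  qed
qed

text \<open>The estimator is unbiased for the ball gradient. The reference value \<open>c\<close> drops out because a uniform direction
has mean zero.\<close>

lemma val_inner:
  assumes t: "t \<le> T" and c: "c \<in> H (past t) \<rightarrow>\<^sub>M borel"
    and int: "integrable M (\<lambda>\<omega>. (sphere_mean \<alpha> (x t \<omega>) - c \<omega>)\<^sup>2)"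
    and X: "integrable M (\<lambda>\<omega>. (norm (x t \<omega> - xs))\<^sup>2)"
  shows "integrable M (\<lambda>\<omega>. (val t \<omega> - c \<omega>) * (u t \<omega> \<bullet> (x t \<omega> - xs)))"
    and "(\<integral>\<omega>. (val t \<omega> - c \<omega>) * (u t \<omega> \<bullet> (x t \<omega> - xs)) \<partial>M)
      = \<alpha> / DIM('a) * (\<integral>\<omega>. ball_gradient \<alpha> (x t \<omega>) \<bullet> (x t \<omega> - xs) \<partial>M)"
proof -
  interpret D: prob_space D by (rule D)
  interpret S: prob_space "uniform_sphere :: 'a measure" by (rule prob_space_uniform_sphere)
  have t': "t \<le> Suc T" using t by simp
  have xt: "x t \<in> H (past t) \<rightarrow>\<^sub>M borel" by (rule x_measurable[OF t'])
  have [measurable]: "x t \<in> borel_measurable M" "val t \<in> borel_measurable M" "u t \<in> borel_measurable M"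
    by (rule x_borel[OF t'] val_borel[OF t] u_measurable[OF t])+
  have [measurable]: "c \<in> borel_measurable M" by (rule measurable_history[OF past_subset[OF t'] c])
  have [measurable]: "query t \<in> borel_measurable M" unfolding query_def[abs_def] by measurable
  have sb: "AE \<omega> in M. (u t \<omega> \<bullet> (x t \<omega> - xs))\<^sup>2 \<le> (norm (x t \<omega> - xs))\<^sup>2"
    using AE_norm_u[OF t]
  proof eventually_elim
    case (elim \<omega>)
    have "\<bar>u t \<omega> \<bullet> (x t \<omega> - xs)\<bar> \<le> norm (x t \<omega> - xs)"
      using Cauchy_Schwarz_ineq2[of "u t \<omega>" "x t \<omega> - xs"] elim by simp
    from power_mono[OF this abs_ge_zero, of 2] show ?case by simp
  qed
  show i1: "integrable M (\<lambda>\<omega>. (val t \<omega> - c \<omega>) * (u t \<omega> \<bullet> (x t \<omega> - xs)))"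
  proof (rule Bochner_Integration.integrable_bound)
    show "integrable M (\<lambda>\<omega>. (val t \<omega> - c \<omega>)\<^sup>2 + (norm (x t \<omega> - xs))\<^sup>2)"
      using val_second_moment(1)[OF t c int variance_integrable[OF t']] X by simp
    show "AE \<omega> in M. norm ((val t \<omega> - c \<omega>) * (u t \<omega> \<bullet> (x t \<omega> - xs))) \<le> norm ((val t \<omega> - c \<omega>)\<^sup>2 + (norm (x t \<omega> - xs))\<^sup>2)"
      using sb
    proof eventually_elim
      case (elim \<omega>)
      then show ?case
        using abs_mult_le_sum_squares[of "val t \<omega> - c \<omega>" "u t \<omega> \<bullet> (x t \<omega> - xs)"] by simp
    qed
  qed measurable
  have i2: "integrable M (\<lambda>\<omega>. (f (query t \<omega>) - c \<omega>) * (u t \<omega> \<bullet> (x t \<omega> - xs)))"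
  proof (rule Bochner_Integration.integrable_bound)
    show "integrable M (\<lambda>\<omega>. (2 * (2 * L0 * \<alpha>)\<^sup>2 + 2 * (sphere_mean \<alpha> (x t \<omega>) - c \<omega>)\<^sup>2) + (norm (x t \<omega> - xs))\<^sup>2)"
      using int X by simp
    show "AE \<omega> in M. norm ((f (query t \<omega>) - c \<omega>) * (u t \<omega> \<bullet> (x t \<omega> - xs)))
        \<le> norm ((2 * (2 * L0 * \<alpha>)\<^sup>2 + 2 * (sphere_mean \<alpha> (x t \<omega>) - c \<omega>)\<^sup>2) + (norm (x t \<omega> - xs))\<^sup>2)"
      using sb AE_norm_u[OF t]
    proof eventually_elim
      case (elim \<omega>)
      have "\<bar>f (query t \<omega>) - f (x t \<omega>)\<bar> \<le> L0 * \<alpha>"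
        using lipschitzD[of "query t \<omega>" "x t \<omega>"] elim(2) \<alpha>_pos by (simp add: query_def)
      moreover have "\<bar>f (x t \<omega>) - sphere_mean \<alpha> (x t \<omega>)\<bar> \<le> L0 * \<alpha>"
      proof -
        have "f (x t \<omega>) - sphere_mean \<alpha> (x t \<omega>) = (\<integral>v. f (x t \<omega>) - f (x t \<omega> + \<alpha> *\<^sub>R v) \<partial>uniform_sphere)"
          using integrable_sphere[of "x t \<omega>" \<alpha>] S.prob_space by (simp add: sphere_mean_def)
        also have "\<bar>\<dots>\<bar> \<le> (\<integral>v. L0 * \<alpha> \<partial>(uniform_sphere :: 'a measure))"
        proof (rule order_trans[OF integral_abs_bound], rule integral_mono_AE)
          show "integrable uniform_sphere (\<lambda>v. \<bar>f (x t \<omega>) - f (x t \<omega> + \<alpha> *\<^sub>R v)\<bar>)"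
            using integrable_sphere[of "x t \<omega>" \<alpha>] by simp
          show "AE v in uniform_sphere. \<bar>f (x t \<omega>) - f (x t \<omega> + \<alpha> *\<^sub>R v)\<bar> \<le> L0 * \<alpha>"
            using AE_uniform_sphere
          proof eventually_elim
            case (elim v)
            then show ?case using lipschitzD[of "x t \<omega>" "x t \<omega> + \<alpha> *\<^sub>R v"] \<alpha>_pos by simp
          qed
        qed simp
        finally show ?thesis using S.prob_space by simp
      qed
      ultimately have "\<bar>f (query t \<omega>) - sphere_mean \<alpha> (x t \<omega>)\<bar> \<le> 2 * L0 * \<alpha>" by linarith
      from power_mono[OF this abs_ge_zero, of 2]
      have 1: "(f (query t \<omega>) - sphere_mean \<alpha> (x t \<omega>))\<^sup>2 \<le> (2 * L0 * \<alpha>)\<^sup>2" unfolding power2_abs .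
      have 2: "(f (query t \<omega>) - c \<omega>)\<^sup>2 \<le> 2 * (f (query t \<omega>) - sphere_mean \<alpha> (x t \<omega>))\<^sup>2 + 2 * (sphere_mean \<alpha> (x t \<omega>) - c \<omega>)\<^sup>2"
        using square_add_le[of "f (query t \<omega>) - sphere_mean \<alpha> (x t \<omega>)" "sphere_mean \<alpha> (x t \<omega>) - c \<omega>"] by simp
      have 3: "\<bar>(f (query t \<omega>) - c \<omega>) * (u t \<omega> \<bullet> (x t \<omega> - xs))\<bar> \<le> (f (query t \<omega>) - c \<omega>)\<^sup>2 + (u t \<omega> \<bullet> (x t \<omega> - xs))\<^sup>2"
        by (rule abs_mult_le_sum_squares)
      show ?case unfolding real_norm_def using 1 2 3 elim(1) by linarith
    qed
  qed measurable
  let ?\<Phi> = "\<lambda>p::('a \<times> real \<times> real) \<times> 'z. (F (fst (fst p)) (snd p) - fst (snd (fst p))) * snd (snd (fst p))"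
  let ?\<Psi> = "\<lambda>p::('a \<times> real) \<times> 'a. (f (fst (fst p) + \<alpha> *\<^sub>R snd p) - snd (fst p)) * (snd p \<bullet> (fst (fst p) - xs))"
  have "(\<lambda>p::('a \<times> real \<times> real) \<times> 'z. F (fst (fst p)) (snd p)) \<in> borel_measurable ((borel \<Otimes>\<^sub>M borel \<Otimes>\<^sub>M borel) \<Otimes>\<^sub>M D)"
    using measurable_compose[OF measurable_Pair[OF measurable_compose[OF measurable_fst measurable_fst] measurable_snd] F_measurable]
    by simp
  then have \<Phi>m: "?\<Phi> \<in> borel_measurable ((borel \<Otimes>\<^sub>M borel \<Otimes>\<^sub>M borel) \<Otimes>\<^sub>M D)" by measurable
  have \<Psi>m: "?\<Psi> \<in> borel_measurable ((borel \<Otimes>\<^sub>M borel) \<Otimes>\<^sub>M borel)" by measurable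
  have "(\<integral>\<omega>. (val t \<omega> - c \<omega>) * (u t \<omega> \<bullet> (x t \<omega> - xs)) \<partial>M)
      = (\<integral>\<omega>. ?\<Phi> ((query t \<omega>, c \<omega>, u t \<omega> \<bullet> (x t \<omega> - xs)), \<xi> t \<omega>) \<partial>M)"
    by (simp add: val_def)
  also have "\<dots> = (\<integral>\<omega>. \<integral>z. ?\<Phi> ((query t \<omega>, c \<omega>, u t \<omega> \<bullet> (x t \<omega> - xs)), z) \<partial>D \<partial>M)"
  proof (rule fresh_integral[where \<Phi> = ?\<Phi> and KY = "mid t" and KZ = "{Inr t}", OF _ _ _ _ _ \<xi>_law[OF t] \<Phi>m])
    have [measurable]: "x t \<in> H (mid t) \<rightarrow>\<^sub>M borel" by (rule measurable_history_mono[OF xt]) auto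
    have [measurable]: "c \<in> H (mid t) \<rightarrow>\<^sub>M borel" by (rule measurable_history_mono[OF c]) auto
    have [measurable]: "u t \<in> H (mid t) \<rightarrow>\<^sub>M borel" by (rule u_history[OF t]) simp
    have [measurable]: "query t \<in> H (mid t) \<rightarrow>\<^sub>M borel" by (rule query_measurable[OF t xt])
    show "(\<lambda>\<omega>. (query t \<omega>, c \<omega>, u t \<omega> \<bullet> (x t \<omega> - xs))) \<in> H (mid t) \<rightarrow>\<^sub>M borel \<Otimes>\<^sub>M borel \<Otimes>\<^sub>M borel"
      by measurable
    show "\<xi> t \<in> H {Inr t} \<rightarrow>\<^sub>M D" by (rule \<xi>_history[OF t]) simp
    show "integrable M (\<lambda>\<omega>. ?\<Phi> ((query t \<omega>, c \<omega>, u t \<omega> \<bullet> (x t \<omega> - xs)), \<xi> t \<omega>))"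
      using i1 by (simp add: val_def)
  qed (use t in auto)
  also have "\<dots> = (\<integral>\<omega>. ?\<Psi> ((x t \<omega>, c \<omega>), u t \<omega>) \<partial>M)"
  proof (rule Bochner_Integration.integral_cong[OF refl])
    fix \<omega>
    have "(\<integral>z. F (query t \<omega>) z - c \<omega> \<partial>D) = f (query t \<omega>) - c \<omega>"
      using F_integrable[of "query t \<omega>"] D.prob_space by (simp add: F_mean[of "query t \<omega>"])
    then show "(\<integral>z. ?\<Phi> ((query t \<omega>, c \<omega>, u t \<omega> \<bullet> (x t \<omega> - xs)), z) \<partial>D) = ?\<Psi> ((x t \<omega>, c \<omega>), u t \<omega>)"
      by (simp add: query_def)
  qed
  also have "\<dots> = (\<integral>\<omega>. \<integral>v. ?\<Psi> ((x t \<omega>, c \<omega>), v) \<partial>uniform_sphere \<partial>M)"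
  proof (rule fresh_integral[where \<Phi> = ?\<Psi> and KY = "past t" and KZ = "{Inl t}", OF _ _ _ _ _ u_law[OF t] \<Psi>m])
    show "(\<lambda>\<omega>. (x t \<omega>, c \<omega>)) \<in> H (past t) \<rightarrow>\<^sub>M borel \<Otimes>\<^sub>M borel" by (rule measurable_Pair[OF xt c])
    show "u t \<in> H {Inl t} \<rightarrow>\<^sub>M borel" by (rule u_history[OF t]) simp
    show "integrable M (\<lambda>\<omega>. ?\<Psi> ((x t \<omega>, c \<omega>), u t \<omega>))"
      using i2 by (simp add: query_def)
  qed (use t in auto)
  also have "\<dots> = (\<integral>\<omega>. \<alpha> / DIM('a) * (ball_gradient \<alpha> (x t \<omega>) \<bullet> (x t \<omega> - xs)) \<partial>M)"
  proof (rule Bochner_Integration.integral_cong[OF refl])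
    fix \<omega>
    define y w where "y = x t \<omega>" and "w = x t \<omega> - xs"
    have j1: "integrable uniform_sphere (\<lambda>v. f (y + \<alpha> *\<^sub>R v) * (v \<bullet> w))"
    proof (rule integrable_uniform_sphere_bounded)
      fix v :: 'a assume v: "norm v = 1"
      have "\<bar>f (y + \<alpha> *\<^sub>R v)\<bar> \<le> \<bar>f y\<bar> + L0 * \<alpha>" using lipschitzD[of "y + \<alpha> *\<^sub>R v" y] v \<alpha>_pos by simp
      moreover have "\<bar>v \<bullet> w\<bar> \<le> norm w" using Cauchy_Schwarz_ineq2[of v w] v by simp
      ultimately show "\<bar>f (y + \<alpha> *\<^sub>R v) * (v \<bullet> w)\<bar> \<le> (\<bar>f y\<bar> + L0 * \<alpha>) * norm w"
        unfolding abs_mult using L0_nonneg \<alpha>_pos by (intro mult_mono) auto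
    qed measurable
    have j2: "integrable uniform_sphere (\<lambda>v::'a. v \<bullet> w)"
      using integrable_inner_uniform_sphere[of w] by (simp add: inner_commute)
    have "(\<integral>v. (f (y + \<alpha> *\<^sub>R v) - c \<omega>) * (v \<bullet> w) \<partial>uniform_sphere)
        = (\<integral>v. f (y + \<alpha> *\<^sub>R v) * (v \<bullet> w) - c \<omega> * (v \<bullet> w) \<partial>uniform_sphere)"
      by (simp only: left_diff_distrib)
    also have "\<dots> = \<alpha> / DIM('a) * (ball_gradient \<alpha> y \<bullet> w)"
      by (simp only: Bochner_Integration.integral_diff[OF j1 integrable_mult_right[OF j2]] integral_mult_right_zero
          sphere_gradient_estimate integral_uniform_sphere_inner mult_zero_right diff_zero)
    finally show "(\<integral>v. ?\<Psi> ((x t \<omega>, c \<omega>), v) \<partial>uniform_sphere) = \<alpha> / DIM('a) * (ball_gradient \<alpha> (x t \<omega>) \<bullet> (x t \<omega> - xs))"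
      by (simp add: y_def w_def)
  qed
  also have "\<dots> = \<alpha> / DIM('a) * (\<integral>\<omega>. ball_gradient \<alpha> (x t \<omega>) \<bullet> (x t \<omega> - xs) \<partial>M)"
    by (rule integral_mult_right_zero)
  finally show "(\<integral>\<omega>. (val t \<omega> - c \<omega>) * (u t \<omega> \<bullet> (x t \<omega> - xs)) \<partial>M)
      = \<alpha> / DIM('a) * (\<integral>\<omega>. ball_gradient \<alpha> (x t \<omega>) \<bullet> (x t \<omega> - xs) \<partial>M)" .
qed

text \<open>One step of the algorithm. Relative to the previous value, the current value has the sphere mean at \<open>x (Suc s)\<close>;
this mean differs from that at \<open>x s\<close> by the Lipschitz bound, and the latter differs from the previous value by its noise
and its sphere variance. That is where the weights \<open>2\<close> come from.\<close>

lemma residual_step: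
  assumes s: "Suc s \<le> T"
    and incr: "integrable M (\<lambda>\<omega>. (norm (x (Suc s) \<omega> - x s \<omega>))\<^sup>2)"
    and dist: "integrable M (\<lambda>\<omega>. (norm (x (Suc s) \<omega> - xs))\<^sup>2)"
  shows "(\<integral>\<omega>. (val (Suc s) \<omega> - val s \<omega>)\<^sup>2 \<partial>M)
      \<le> \<sigma>0\<^sup>2 + (\<integral>\<omega>. sphere_variance \<alpha> (x (Suc s) \<omega>) \<partial>M)
        + 2 * L0\<^sup>2 * (\<integral>\<omega>. (norm (x (Suc s) \<omega> - x s \<omega>))\<^sup>2 \<partial>M)
        + 2 * (\<sigma>0\<^sup>2 + (\<integral>\<omega>. sphere_variance \<alpha> (x s \<omega>) \<partial>M))"
    and "integrable M (\<lambda>\<omega>. (norm (x (Suc (Suc s)) \<omega> - x (Suc s) \<omega>))\<^sup>2)"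
    and "(\<integral>\<omega>. (norm (x (Suc (Suc s)) \<omega> - x (Suc s) \<omega>))\<^sup>2 \<partial>M)
      = (\<eta> * (DIM('a) / \<alpha>))\<^sup>2 * (\<integral>\<omega>. (val (Suc s) \<omega> - val s \<omega>)\<^sup>2 \<partial>M)"
    and "integrable M (\<lambda>\<omega>. (norm (x (Suc (Suc s)) \<omega> - xs))\<^sup>2)"
    and "(\<integral>\<omega>. (norm (x (Suc (Suc s)) \<omega> - xs))\<^sup>2 \<partial>M)
      = (\<integral>\<omega>. (norm (x (Suc s) \<omega> - xs))\<^sup>2 \<partial>M)
        - 2 * \<eta> * (\<integral>\<omega>. ball_gradient \<alpha> (x (Suc s) \<omega>) \<bullet> (x (Suc s) \<omega> - xs) \<partial>M)
        + (\<integral>\<omega>. (norm (x (Suc (Suc s)) \<omega> - x (Suc s) \<omega>))\<^sup>2 \<partial>M)"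
proof -
  have s': "s \<le> T" "s \<le> Suc T" "Suc s \<le> Suc T" "Suc (Suc s) \<le> Suc T" using s by auto
  have [measurable]: "x s \<in> borel_measurable M" "x (Suc s) \<in> borel_measurable M" "x (Suc (Suc s)) \<in> borel_measurable M"
    by (rule x_borel[OF s'(2)] x_borel[OF s'(3)] x_borel[OF s'(4)])+
  have [measurable]: "val s \<in> borel_measurable M" "val (Suc s) \<in> borel_measurable M" "u (Suc s) \<in> borel_measurable M"
    by (rule val_borel[OF s'(1)] val_borel[OF s] u_measurable[OF s])+
  have xs_past: "x s \<in> H (past s) \<rightarrow>\<^sub>M borel" by (rule x_measurable[OF s'(2)])
  have mean_past: "(\<lambda>\<omega>. sphere_mean \<alpha> (x s \<omega>)) \<in> H (past s) \<rightarrow>\<^sub>M borel"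
    by (rule measurable_compose[OF xs_past measurable_sphere_mean])
  have val_past: "val s \<in> H (past (Suc s)) \<rightarrow>\<^sub>M borel" by (rule val_measurable[OF s'(1) xs_past])
  let ?m = "\<lambda>t \<omega>. sphere_mean \<alpha> (x t \<omega>)"
  have zero: "integrable M (\<lambda>\<omega>. (?m s \<omega> - ?m s \<omega>)\<^sup>2)" by simp
  note vs = val_second_moment[OF s'(1) mean_past zero variance_integrable[OF s'(2)]]
  have pt: "(?m (Suc s) \<omega> - val s \<omega>)\<^sup>2 \<le> 2 * L0\<^sup>2 * (norm (x (Suc s) \<omega> - x s \<omega>))\<^sup>2 + 2 * (val s \<omega> - ?m s \<omega>)\<^sup>2" for \<omega>
  proof -
    have "(?m (Suc s) \<omega> - ?m s \<omega>)\<^sup>2 \<le> (L0 * norm (x (Suc s) \<omega> - x s \<omega>))\<^sup>2"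
      using power_mono[OF sphere_mean_lipschitz abs_ge_zero, of _ _ _ 2] by simp
    moreover have "(?m (Suc s) \<omega> - val s \<omega>)\<^sup>2 \<le> 2 * (?m (Suc s) \<omega> - ?m s \<omega>)\<^sup>2 + 2 * (?m s \<omega> - val s \<omega>)\<^sup>2"
      using square_add_le[of "?m (Suc s) \<omega> - ?m s \<omega>" "?m s \<omega> - val s \<omega>"] by simp
    ultimately show ?thesis by (simp add: power_mult_distrib power2_commute[of "val s \<omega>"])
  qed
  have bd_int: "integrable M (\<lambda>\<omega>. 2 * L0\<^sup>2 * (norm (x (Suc s) \<omega> - x s \<omega>))\<^sup>2 + 2 * (val s \<omega> - ?m s \<omega>)\<^sup>2)"
    using incr vs(1) by simp
  have int: "integrable M (\<lambda>\<omega>. (?m (Suc s) \<omega> - val s \<omega>)\<^sup>2)"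
    by (rule Bochner_Integration.integrable_bound[OF bd_int]) (measurable, use pt in \<open>auto intro!: AE_I2 order_trans[OF pt]\<close>)
  note vS = val_second_moment[OF s val_past int variance_integrable[OF s'(3)]]
  have "(\<integral>\<omega>. (?m (Suc s) \<omega> - val s \<omega>)\<^sup>2 \<partial>M)
      \<le> (\<integral>\<omega>. 2 * L0\<^sup>2 * (norm (x (Suc s) \<omega> - x s \<omega>))\<^sup>2 + 2 * (val s \<omega> - ?m s \<omega>)\<^sup>2 \<partial>M)"
    by (rule integral_mono[OF int bd_int pt])
  also have "\<dots> = 2 * L0\<^sup>2 * (\<integral>\<omega>. (norm (x (Suc s) \<omega> - x s \<omega>))\<^sup>2 \<partial>M) + 2 * (\<integral>\<omega>. (val s \<omega> - ?m s \<omega>)\<^sup>2 \<partial>M)"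
    using incr vs(1) by simp
  also have "\<dots> \<le> 2 * L0\<^sup>2 * (\<integral>\<omega>. (norm (x (Suc s) \<omega> - x s \<omega>))\<^sup>2 \<partial>M)
      + 2 * (\<sigma>0\<^sup>2 + (\<integral>\<omega>. sphere_variance \<alpha> (x s \<omega>) \<partial>M))"
    using vs(2) by simp
  finally show "(\<integral>\<omega>. (val (Suc s) \<omega> - val s \<omega>)\<^sup>2 \<partial>M)
      \<le> \<sigma>0\<^sup>2 + (\<integral>\<omega>. sphere_variance \<alpha> (x (Suc s) \<omega>) \<partial>M)
        + 2 * L0\<^sup>2 * (\<integral>\<omega>. (norm (x (Suc s) \<omega> - x s \<omega>))\<^sup>2 \<partial>M)
        + 2 * (\<sigma>0\<^sup>2 + (\<integral>\<omega>. sphere_variance \<alpha> (x s \<omega>) \<partial>M))"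
    using vS(2) by linarith
  define k where "k = \<eta> * (DIM('a) / \<alpha>)"
  have k\<alpha>: "k * (\<alpha> / DIM('a)) = \<eta>" using \<alpha>_pos by (simp add: k_def)
  let ?d = "\<lambda>\<omega>. val (Suc s) \<omega> - val s \<omega>" and ?X = "\<lambda>\<omega>. x (Suc s) \<omega> - xs"
  have inc_AE: "AE \<omega> in M. (norm (x (Suc (Suc s)) \<omega> - x (Suc s) \<omega>))\<^sup>2 = k\<^sup>2 * (?d \<omega>)\<^sup>2"
    using AE_norm_u[OF s]
  proof eventually_elim
    case (elim \<omega>)
    have "x (Suc (Suc s)) \<omega> - x (Suc s) \<omega> = - ((k * ?d \<omega>) *\<^sub>R u (Suc s) \<omega>)"
      unfolding x_Suc k_def[symmetric] by simp
    then have "norm (x (Suc (Suc s)) \<omega> - x (Suc s) \<omega>) = \<bar>k * ?d \<omega>\<bar>" using elim by simp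
    then show ?case by (simp only: power2_abs power_mult_distrib)
  qed
  have dist_AE: "AE \<omega> in M. (norm (x (Suc (Suc s)) \<omega> - xs))\<^sup>2
      = (norm (?X \<omega>))\<^sup>2 - 2 * k * (?d \<omega> * (u (Suc s) \<omega> \<bullet> ?X \<omega>)) + k\<^sup>2 * (?d \<omega>)\<^sup>2"
    using AE_norm_u[OF s]
  proof eventually_elim
    case (elim \<omega>)
    have "x (Suc (Suc s)) \<omega> - xs = ?X \<omega> - (k * ?d \<omega>) *\<^sub>R u (Suc s) \<omega>"
      unfolding x_Suc k_def[symmetric] by simp
    then have "(norm (x (Suc (Suc s)) \<omega> - xs))\<^sup>2
        = (norm (?X \<omega>))\<^sup>2 - 2 * (k * ?d \<omega>) * (u (Suc s) \<omega> \<bullet> ?X \<omega>) + (k * ?d \<omega>)\<^sup>2"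
      by (simp only: norm_diff_unit_square[OF elim])
    then show ?case by (simp only: power_mult_distrib mult.assoc)
  qed
  show inc_int: "integrable M (\<lambda>\<omega>. (norm (x (Suc (Suc s)) \<omega> - x (Suc s) \<omega>))\<^sup>2)"
    by (subst integrable_cong_AE[OF _ _ inc_AE]) (use vS(1) in simp_all)
  have "(\<integral>\<omega>. (norm (x (Suc (Suc s)) \<omega> - x (Suc s) \<omega>))\<^sup>2 \<partial>M) = (\<integral>\<omega>. k\<^sup>2 * (?d \<omega>)\<^sup>2 \<partial>M)"
    by (rule integral_cong_AE[OF _ _ inc_AE]) simp_all
  also have "\<dots> = k\<^sup>2 * (\<integral>\<omega>. (?d \<omega>)\<^sup>2 \<partial>M)" by (rule integral_mult_right_zero)
  finally have inc_eq: "(\<integral>\<omega>. (norm (x (Suc (Suc s)) \<omega> - x (Suc s) \<omega>))\<^sup>2 \<partial>M) = k\<^sup>2 * (\<integral>\<omega>. (?d \<omega>)\<^sup>2 \<partial>M)" .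
  then show "(\<integral>\<omega>. (norm (x (Suc (Suc s)) \<omega> - x (Suc s) \<omega>))\<^sup>2 \<partial>M)
      = (\<eta> * (DIM('a) / \<alpha>))\<^sup>2 * (\<integral>\<omega>. (val (Suc s) \<omega> - val s \<omega>)\<^sup>2 \<partial>M)"
    by (simp only: k_def)
  note vi = val_inner[OF s val_past int dist]
  have rhs_int: "integrable M (\<lambda>\<omega>. (norm (?X \<omega>))\<^sup>2 - 2 * k * (?d \<omega> * (u (Suc s) \<omega> \<bullet> ?X \<omega>)) + k\<^sup>2 * (?d \<omega>)\<^sup>2)"
    by (intro Bochner_Integration.integrable_add Bochner_Integration.integrable_diff integrable_mult_right dist vi(1) vS(1))
  have meas: "(\<lambda>\<omega>. (norm (x (Suc (Suc s)) \<omega> - xs))\<^sup>2) \<in> borel_measurable M" by measurable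
  show "integrable M (\<lambda>\<omega>. (norm (x (Suc (Suc s)) \<omega> - xs))\<^sup>2)"
    using rhs_int by (subst integrable_cong_AE[OF meas _ dist_AE]) (rule borel_measurable_integrable)
  have "(\<integral>\<omega>. (norm (x (Suc (Suc s)) \<omega> - xs))\<^sup>2 \<partial>M)
     = (\<integral>\<omega>. (norm (?X \<omega>))\<^sup>2 - 2 * k * (?d \<omega> * (u (Suc s) \<omega> \<bullet> ?X \<omega>)) + k\<^sup>2 * (?d \<omega>)\<^sup>2 \<partial>M)"
    by (rule integral_cong_AE[OF meas borel_measurable_integrable[OF rhs_int] dist_AE])
  also have "\<dots> = (\<integral>\<omega>. (norm (?X \<omega>))\<^sup>2 \<partial>M) - 2 * k * (\<integral>\<omega>. ?d \<omega> * (u (Suc s) \<omega> \<bullet> ?X \<omega>) \<partial>M) + k\<^sup>2 * (\<integral>\<omega>. (?d \<omega>)\<^sup>2 \<partial>M)"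
    by (simp only: Bochner_Integration.integral_add[OF Bochner_Integration.integrable_diff[OF dist integrable_mult_right[OF vi(1)]] integrable_mult_right[OF vS(1)]]
        Bochner_Integration.integral_diff[OF dist integrable_mult_right[OF vi(1)]] integral_mult_right_zero)
  also have "2 * k * (\<integral>\<omega>. ?d \<omega> * (u (Suc s) \<omega> \<bullet> ?X \<omega>) \<partial>M)
      = 2 * (k * (\<alpha> / DIM('a))) * (\<integral>\<omega>. ball_gradient \<alpha> (x (Suc s) \<omega>) \<bullet> ?X \<omega> \<partial>M)"
    unfolding vi(2) by simp
  finally show "(\<integral>\<omega>. (norm (x (Suc (Suc s)) \<omega> - xs))\<^sup>2 \<partial>M)
      = (\<integral>\<omega>. (norm (x (Suc s) \<omega> - xs))\<^sup>2 \<partial>M)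
        - 2 * \<eta> * (\<integral>\<omega>. ball_gradient \<alpha> (x (Suc s) \<omega>) \<bullet> (x (Suc s) \<omega> - xs) \<partial>M)
        + (\<integral>\<omega>. (norm (x (Suc (Suc s)) \<omega> - x (Suc s) \<omega>))\<^sup>2 \<partial>M)"
    unfolding k\<alpha> inc_eq .
qed

text \<open>Square integrability propagates along the steps, and it starts with the constant \<open>x1\<close>.\<close>

lemma iterates_square_integrable:
  "s \<le> T \<Longrightarrow> integrable M (\<lambda>\<omega>. (norm (x (Suc s) \<omega> - x s \<omega>))\<^sup>2)
     \<and> integrable M (\<lambda>\<omega>. (norm (x (Suc s) \<omega> - xs))\<^sup>2)"
proof (induction s)
  case 0
  show ?case by (simp add: x_0 x_1)
next
  case (Suc s)
  then have "integrable M (\<lambda>\<omega>. (norm (x (Suc s) \<omega> - x s \<omega>))\<^sup>2)" "integrable M (\<lambda>\<omega>. (norm (x (Suc s) \<omega> - xs))\<^sup>2)"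
    by auto
  from residual_step(2,4)[OF Suc.prems this] show ?case by simp
qed

lemma gap_integrable:
  assumes t: "1 \<le> t" "t \<le> T"
  shows "integrable M (\<lambda>\<omega>. f (x t \<omega>) - f xs)"
proof -
  obtain s where s: "t = Suc s" using t(1) by (cases t) auto
  have X: "integrable M (\<lambda>\<omega>. (norm (x t \<omega> - xs))\<^sup>2)"
    using iterates_square_integrable[of s] t by (simp add: s)
  have [measurable]: "x t \<in> borel_measurable M" using t by (intro x_borel) simp
  show ?thesis
  proof (rule Bochner_Integration.integrable_bound)
    show "integrable M (\<lambda>\<omega>. L0\<^sup>2 + (norm (x t \<omega> - xs))\<^sup>2)" using X by simp
    show "AE \<omega> in M. norm (f (x t \<omega>) - f xs) \<le> norm (L0\<^sup>2 + (norm (x t \<omega> - xs))\<^sup>2)"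
    proof (rule AE_I2)
      fix \<omega>
      show "norm (f (x t \<omega>) - f xs) \<le> norm (L0\<^sup>2 + (norm (x t \<omega> - xs))\<^sup>2)"
        using lipschitzD[of "x t \<omega>" xs] abs_mult_le_sum_squares[of L0 "norm (x t \<omega> - xs)"] by simp
    qed
  qed measurable
qed

theorem regret_bound:
  assumes T: "T \<ge> 1"
    and contraction: "L0\<^sup>2 * (\<eta> * (DIM('a) / \<alpha>))\<^sup>2 \<le> 1 / 64" and step: "\<eta> * L * DIM('a) \<le> 1 / 10"
  shows "(\<Sum>t=1..T. \<integral>\<omega>. f (x t \<omega>) - f xs \<partial>M) \<le> (norm (x1 - xs))\<^sup>2 / (2 * \<eta>)
     + T * (48 / 31 * (\<eta> * (DIM('a) / \<alpha>)\<^sup>2 * \<sigma>0\<^sup>2) + (1 / 2 + 5 / 31) * (L * \<alpha>\<^sup>2))"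
proof -
  let ?R = "\<lambda>s. \<integral>\<omega>. (norm (x (Suc s) \<omega> - xs))\<^sup>2 \<partial>M"
  let ?W = "\<lambda>s. \<integral>\<omega>. ball_gradient \<alpha> (x (Suc s) \<omega>) \<bullet> (x (Suc s) \<omega> - xs) \<partial>M"
  let ?P = "\<lambda>s. \<integral>\<omega>. (norm (ball_gradient \<alpha> (x (Suc s) \<omega>)))\<^sup>2 \<partial>M"
  let ?V = "\<lambda>t. \<integral>\<omega>. sphere_variance \<alpha> (x t \<omega>) \<partial>M"
  let ?G = "\<lambda>s. \<integral>\<omega>. f (x (Suc s) \<omega>) - f xs \<partial>M"
  have sq: "integrable M (\<lambda>\<omega>. (norm (x (Suc s) \<omega> - x s \<omega>))\<^sup>2)" "integrable M (\<lambda>\<omega>. (norm (x (Suc s) \<omega> - xs))\<^sup>2)"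
    if "s \<le> T" for s
    using iterates_square_integrable[OF that] by auto
  have "(\<Sum>s<T. ?G s) \<le> ?R 0 / (2 * \<eta>)
     + T * (48 / 31 * (\<eta> * (DIM('a) / \<alpha>)\<^sup>2 * \<sigma>0\<^sup>2) + (1 / 2 + 5 / 31) * (L * \<alpha>\<^sup>2))"
  proof (rule telescoped_regret[where D = "\<lambda>s. \<integral>\<omega>. (val (Suc s) \<omega> - val s \<omega>)\<^sup>2 \<partial>M" and V = ?V
        and \<delta> = "\<lambda>s. \<integral>\<omega>. (norm (x (Suc s) \<omega> - x s \<omega>))\<^sup>2 \<partial>M" and R = ?R and W = ?W and P = ?P and ?L0.0 = L0])
    fix s assume s: "s < T"
    note st = residual_step[OF Suc_leI[OF s] sq[OF less_imp_le[OF s]]]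
    show "(\<integral>\<omega>. (val (Suc s) \<omega> - val s \<omega>)\<^sup>2 \<partial>M) \<le> \<sigma>0\<^sup>2 + ?V (Suc s)
        + 2 * L0\<^sup>2 * (\<integral>\<omega>. (norm (x (Suc s) \<omega> - x s \<omega>))\<^sup>2 \<partial>M) + 2 * (\<sigma>0\<^sup>2 + ?V s)"
      by (rule st(1))
    show "(\<integral>\<omega>. (norm (x (Suc (Suc s)) \<omega> - x (Suc s) \<omega>))\<^sup>2 \<partial>M)
        = (\<eta> * (DIM('a) / \<alpha>))\<^sup>2 * (\<integral>\<omega>. (val (Suc s) \<omega> - val s \<omega>)\<^sup>2 \<partial>M)"
      by (rule st(3))
    show "?R (Suc s) = ?R s - 2 * \<eta> * ?W s + (\<integral>\<omega>. (norm (x (Suc (Suc s)) \<omega> - x (Suc s) \<omega>))\<^sup>2 \<partial>M)"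
      by (rule st(5))
    have t: "1 \<le> Suc s" "Suc s \<le> T" "Suc s \<le> Suc T" using s by auto
    have gi: "integrable M (\<lambda>\<omega>. f (x (Suc s) \<omega>) - f xs)" by (rule gap_integrable[OF t(1,2)])
    have pi: "integrable M (\<lambda>\<omega>. (norm (ball_gradient \<alpha> (x (Suc s) \<omega>)))\<^sup>2)" by (rule gradient_square_integrable[OF t(3)])
    have wi: "integrable M (\<lambda>\<omega>. ball_gradient \<alpha> (x (Suc s) \<omega>) \<bullet> (x (Suc s) \<omega> - xs))"
      by (rule gradient_inner_integrable[OF t(3) sq(2)]) (use s in simp)
    have "(\<integral>\<omega>. (f (x (Suc s) \<omega>) - f xs) - L * \<alpha>\<^sup>2 / 2 + (norm (ball_gradient \<alpha> (x (Suc s) \<omega>)))\<^sup>2 / (2 * L) \<partial>M) \<le> ?W s"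
    proof (rule integral_mono[OF _ wi])
      show "integrable M (\<lambda>\<omega>. (f (x (Suc s) \<omega>) - f xs) - L * \<alpha>\<^sup>2 / 2 + (norm (ball_gradient \<alpha> (x (Suc s) \<omega>)))\<^sup>2 / (2 * L))"
        by (intro Bochner_Integration.integrable_add Bochner_Integration.integrable_diff gi pi integrable_const integrable_divide_zero)
      fix \<omega>
      show "(f (x (Suc s) \<omega>) - f xs) - L * \<alpha>\<^sup>2 / 2 + (norm (ball_gradient \<alpha> (x (Suc s) \<omega>)))\<^sup>2 / (2 * L)
          \<le> ball_gradient \<alpha> (x (Suc s) \<omega>) \<bullet> (x (Suc s) \<omega> - xs)"
        using \<alpha>_pos by (intro ball_gradient_descent minimizer) simp
    qed
    moreover have "(\<integral>\<omega>. (f (x (Suc s) \<omega>) - f xs) - L * \<alpha>\<^sup>2 / 2 + (norm (ball_gradient \<alpha> (x (Suc s) \<omega>)))\<^sup>2 / (2 * L) \<partial>M)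
        = ?G s - L * \<alpha>\<^sup>2 / 2 + ?P s / (2 * L)"
      using prob_space
      by (subst Bochner_Integration.integral_add[OF Bochner_Integration.integrable_diff[OF gi integrable_const] integrable_divide_zero[OF pi]],
          subst Bochner_Integration.integral_diff[OF gi integrable_const]) simp
    ultimately show "?G s - L * \<alpha>\<^sup>2 / 2 + ?P s / (2 * L) \<le> ?W s" by linarith
    have "?V (Suc s) \<le> (\<integral>\<omega>. \<alpha>\<^sup>2 / DIM('a) * ((norm (ball_gradient \<alpha> (x (Suc s) \<omega>)))\<^sup>2 + 5 / 8 * (L\<^sup>2 * \<alpha>\<^sup>2)) \<partial>M)"
    proof (rule integral_mono[OF variance_integrable[OF t(3)]])
      show "integrable M (\<lambda>\<omega>. \<alpha>\<^sup>2 / DIM('a) * ((norm (ball_gradient \<alpha> (x (Suc s) \<omega>)))\<^sup>2 + 5 / 8 * (L\<^sup>2 * \<alpha>\<^sup>2)))"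
        by (intro integrable_mult_right Bochner_Integration.integrable_add pi integrable_const)
    qed (use \<alpha>_pos in \<open>intro sphere_variance_bound, simp\<close>)
    also have "\<dots> = \<alpha>\<^sup>2 / DIM('a) * (?P s + 5 / 8 * (L\<^sup>2 * \<alpha>\<^sup>2))"
      unfolding integral_mult_right_zero Bochner_Integration.integral_add[OF pi integrable_const] using prob_space by simp
    finally show "?V (Suc s) \<le> \<alpha>\<^sup>2 / DIM('a) * (?P s + 5 / 8 * (L\<^sup>2 * \<alpha>\<^sup>2))" .
  next
    show "0 \<le> ?V s" for s by (rule integral_nonneg_AE) (simp add: sphere_variance_nonneg)
  qed (use T contraction step \<alpha>_pos \<eta>_pos L_pos in \<open>simp_all add: x_0 x_1\<close>)
  moreover have "(\<Sum>t=1..T. \<integral>\<omega>. f (x t \<omega>) - f xs \<partial>M) = (\<Sum>s<T. ?G s)"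
    using sum.shift_bounds_Suc_ivl[of "\<lambda>t. \<integral>\<omega>. f (x t \<omega>) - f xs \<partial>M" 0 T]
    by (simp add: atLeastLessThanSuc_atLeastAtMost atLeast0LessThan del: sum.shift_bounds_Suc_ivl)
  moreover have "?R 0 = (norm (x1 - xs))\<^sup>2" using prob_space by (simp add: x_1)
  ultimately show ?thesis by simp
qed

end

section \<open>Step size and sample complexity\<close>

lemma cube_powr_sixth:
  assumes "0 < (T::real)"
  shows "(1 / T powr (1/6)) ^ 3 = 1 / sqrt T"
proof -
  have "(T powr (1/6)) ^ 3 = T powr (1/2)"
    unfolding power3_eq_cube powr_add[symmetric] by simp
  also have "\<dots> = sqrt T" using assms by (simp add: powr_half_sqrt)
  finally show ?thesis by (simp add: power_divide)
qed

text \<open>Both parameters are chosen such that \<open>L \<alpha>\<^sup>3 \<surd>T = 64 d R \<sigma>0\<close> and \<open>8 \<surd>T d \<sigma>0 \<eta> = \<alpha> R\<close>. The two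
identities follow from these equations alone, each of the three inequalities needs one lower bound on \<open>T\<close>, and the
last two are proved for the cubes.\<close>

lemma step_size_calculus:
  fixes \<alpha> \<eta> R L L0 \<sigma>0 \<epsilon> d T :: real
  assumes pos: "0 < R" "0 < L" "0 < L0" "0 < \<sigma>0" "0 < \<epsilon>" "0 < d" "0 < T" "0 < \<alpha>"
    and \<alpha>: "\<alpha> = 4 * (d * R * \<sigma>0 / L) powr (1/3) * (1 / T powr (1/6))"
    and \<eta>: "\<eta> = \<alpha> * R / (8 * sqrt T * d * \<sigma>0)"
    and T1: "L0\<^sup>2 * R\<^sup>2 / \<sigma>0\<^sup>2 \<le> T"
    and T2: "2 powr (7/2) * L * d powr (1/2) * R\<^sup>2 / \<sigma>0 \<le> T"
    and T3: "12 ^ 3 * L * d\<^sup>2 * R\<^sup>2 * \<sigma>0\<^sup>2 / \<epsilon> ^ 3 \<le> T"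
  shows "R\<^sup>2 / (2 * \<eta>) = T * (L * \<alpha>\<^sup>2 / 16)"
    and "\<eta> * (d / \<alpha>)\<^sup>2 * \<sigma>0\<^sup>2 = L * \<alpha>\<^sup>2 / 512"
    and "L0\<^sup>2 * (\<eta> * (d / \<alpha>))\<^sup>2 \<le> 1 / 64"
    and "\<eta> * L * d \<le> 1 / 10"
    and "3 / 4 * (L * \<alpha>\<^sup>2) \<le> \<epsilon>"
proof -
  define s where "s = sqrt T"
  have s: "0 < s" "s * s = T" using pos by (simp_all add: s_def)
  have q: "0 < d * R * \<sigma>0 / L" using pos by simp
  have cube_root: "(y powr (1/3)) ^ 3 = y" if "0 < y" for y :: real
    using that unfolding power3_eq_cube powr_add[symmetric] by simp
  from cube_root[OF q] have "\<alpha> ^ 3 = 64 * (d * R * \<sigma>0 / L) * (1 / s)"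
    unfolding \<alpha> power_mult_distrib cube_powr_sixth[OF \<open>0 < T\<close>] s_def by simp
  then have \<alpha>3: "L * \<alpha> ^ 3 * s = 64 * (d * R * \<sigma>0)" using pos s by (simp add: field_simps)
  have \<eta>s: "\<eta> * (8 * s * d * \<sigma>0) = \<alpha> * R" unfolding \<eta> s_def[symmetric] using pos s by simp
  have \<eta>0: "0 < \<eta>" unfolding \<eta> using pos by simp
  have Q: "d * R * \<sigma>0 = L * \<alpha> ^ 3 * s / 64" using \<alpha>3 by simp
  show "R\<^sup>2 / (2 * \<eta>) = T * (L * \<alpha>\<^sup>2 / 16)"
  proof -
    have "R\<^sup>2 * \<alpha> = \<eta> * (8 * s * (d * R * \<sigma>0))" using \<eta>s by (simp add: power2_eq_square mult_ac)
    also have "\<dots> = (2 * \<eta> * ((s * s) * (L * \<alpha>\<^sup>2 / 16))) * \<alpha>"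
      unfolding Q by (simp add: power2_eq_square power3_eq_cube)
    finally have "R\<^sup>2 = 2 * \<eta> * (T * (L * \<alpha>\<^sup>2 / 16))" using pos unfolding s(2) by simp
    then show ?thesis using nonzero_mult_div_cancel_left[of "2 * \<eta>" "T * (L * \<alpha>\<^sup>2 / 16)"] \<eta>0 by (simp del: times_divide_eq_right)
  qed
  show "\<eta> * (d / \<alpha>)\<^sup>2 * \<sigma>0\<^sup>2 = L * \<alpha>\<^sup>2 / 512"
  proof -
    have "(\<eta> * (d * \<sigma>0)\<^sup>2) * (8 * s) = (\<eta> * (8 * s * d * \<sigma>0)) * (d * \<sigma>0)"
      by (simp add: power2_eq_square mult_ac)
    also have "\<dots> = \<alpha> * (d * R * \<sigma>0)" unfolding \<eta>s by (simp add: mult_ac)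
    also have "\<dots> = (L * \<alpha> ^ 4 / 512) * (8 * s)"
      unfolding Q by (simp add: power3_eq_cube power4_eq_xxxx)
    finally have "\<eta> * (d * \<sigma>0)\<^sup>2 = L * \<alpha> ^ 4 / 512" using s(1) by simp
    then show ?thesis using pos by (simp add: power_divide power_mult_distrib power4_eq_xxxx power2_eq_square field_simps)
  qed
  show "L0\<^sup>2 * (\<eta> * (d / \<alpha>))\<^sup>2 \<le> 1 / 64"
  proof -
    have "\<eta> * (d / \<alpha>) = R / (8 * s * \<sigma>0)" unfolding \<eta> s_def[symmetric] using pos s by simp
    then have "L0\<^sup>2 * (\<eta> * (d / \<alpha>))\<^sup>2 = (L0\<^sup>2 * R\<^sup>2 / \<sigma>0\<^sup>2) / (64 * (s * s))"
      by (simp add: power_divide power_mult_distrib power2_eq_square)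
    also have "\<dots> \<le> T / (64 * (s * s))" using T1 s by (intro divide_right_mono) auto
    also have "\<dots> = 1 / 64" unfolding s(2) using pos by simp
    finally show ?thesis .
  qed
  show "\<eta> * L * d \<le> 1 / 10"
  proof -
    have sq: "(2 powr (7/2) * L * d powr (1/2) * R\<^sup>2 / \<sigma>0)\<^sup>2 = 128 * L\<^sup>2 * d * R ^ 4 / \<sigma>0\<^sup>2"
    proof -
      have "(2 powr (7/2) :: real)\<^sup>2 = 2 powr (7/2 + 7/2)" unfolding power2_eq_square powr_add ..
      also have "\<dots> = 2 powr real 7" by simp
      also have "\<dots> = 2 ^ 7" by (rule powr_realpow) simp
      finally have "(2 powr (7/2) :: real)\<^sup>2 = 128" by simp
      moreover have "(d powr (1/2))\<^sup>2 = d" using pos by (simp add: powr_half_sqrt)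
      moreover have "(R\<^sup>2)\<^sup>2 = R ^ 4" by (simp add: power_mult[symmetric])
      ultimately show ?thesis by (simp add: power_mult_distrib power_divide)
    qed
    have "(2 powr (7/2) * L * d powr (1/2) * R\<^sup>2 / \<sigma>0)\<^sup>2 \<le> T\<^sup>2"
      by (rule power_mono[OF T2]) (use pos in simp)
    then have T2': "128 * (L\<^sup>2 * d * R ^ 4) \<le> T\<^sup>2 * \<sigma>0\<^sup>2" unfolding sq using pos by (simp add: divide_le_eq mult_ac)
    have "(\<eta> * L * d) * (8 * s * \<sigma>0) = \<alpha> * R * L" using \<eta>s by (simp add: mult_ac)
    then have "((\<eta> * L * d) * (8 * s * \<sigma>0)) ^ 3 = (\<alpha> * R * L) ^ 3" by (simp only:)
    then have "(\<eta> * L * d) ^ 3 * (8 * s * \<sigma>0) ^ 3 * s = (\<alpha> * R * L) ^ 3 * s"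
      by (simp only: power_mult_distrib)
    also have "\<dots> = (L * \<alpha> ^ 3 * s) * (R ^ 3 * L\<^sup>2)"
      by (simp add: power_mult_distrib power3_eq_cube power2_eq_square)
    also have "\<dots> = 64 * \<sigma>0 * (L\<^sup>2 * d * R ^ 4)"
      unfolding \<alpha>3 by (simp add: power3_eq_cube power4_eq_xxxx mult_ac)
    also have "\<dots> \<le> 64 * \<sigma>0 * (T\<^sup>2 * \<sigma>0\<^sup>2 / 128)"
      using T2' pos by (intro mult_left_mono) auto
    also have "\<dots> = (1 / 1024) * ((8 * s * \<sigma>0) ^ 3 * s)"
      unfolding s(2)[symmetric] by (simp add: power_mult_distrib power3_eq_cube power2_eq_square)
    finally have "(\<eta> * L * d) ^ 3 * ((8 * s * \<sigma>0) ^ 3 * s) \<le> (1 / 1024) * ((8 * s * \<sigma>0) ^ 3 * s)"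
      by (simp only: mult.assoc)
    then have "(\<eta> * L * d) ^ 3 \<le> 1 / 1024"
      by (rule mult_right_le_imp_le) (use pos s in simp)
    \<comment> \<open>The factor \<open>2 powr (7/2)\<close> in the lower bound on \<open>T\<close> is what makes the cube small enough.\<close>
    also have "\<dots> \<le> (1 / 10) ^ 3" by (simp add: power3_eq_cube)
    finally show ?thesis
      by (rule power_mono_iff[THEN iffD1, rotated 3]) (use pos \<eta>0 in simp_all)
  qed
  show "3 / 4 * (L * \<alpha>\<^sup>2) \<le> \<epsilon>"
  proof -
    have T3': "1728 * (L * (d * R * \<sigma>0)\<^sup>2) \<le> \<epsilon> ^ 3 * T"
      using T3 pos by (simp add: divide_le_eq power_mult_distrib mult_ac)
    have "(3 / 4 * (L * \<alpha>\<^sup>2)) ^ 3 * T = 27 / 64 * L * (L * \<alpha> ^ 3 * s)\<^sup>2"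
      unfolding s(2)[symmetric] by (simp add: power_mult_distrib power3_eq_cube power2_eq_square)
    also have "\<dots> = 1728 * (L * (d * R * \<sigma>0)\<^sup>2)"
      unfolding \<alpha>3 by (simp add: power_mult_distrib)
    also have "\<dots> \<le> \<epsilon> ^ 3 * T" by (rule T3')
    finally have "(3 / 4 * (L * \<alpha>\<^sup>2)) ^ 3 \<le> \<epsilon> ^ 3"
      by (rule mult_right_le_imp_le) (rule \<open>0 < T\<close>)
    then show ?thesis
      by (rule power_mono_iff[THEN iffD1, rotated 3]) (use pos in simp_all)
  qed
qed

theorem corollary16:
  fixes F :: "'a::euclidean_space \<Rightarrow> 'z \<Rightarrow> real"
    and f :: "'a \<Rightarrow> real"
    and D :: "'z measure"
    and M :: "'w measure"
    and u :: "nat \<Rightarrow> 'w \<Rightarrow> 'a"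
    and \<xi> :: "nat \<Rightarrow> 'w \<Rightarrow> 'z"
    and x1 xstar :: 'a
    and L0 L \<sigma>0 \<sigma>1 \<alpha> \<eta> \<epsilon> :: real
    and T :: nat
  defines "x \<equiv> (\<lambda>t \<omega>. residual_iterate F \<alpha> \<eta> x1 (\<lambda>s. u s \<omega>) (\<lambda>s. \<xi> s \<omega>) t)"
  assumes "prob_space D"
    and "\<And>y. integrable D (F y)"
    and "\<And>y. f y = (\<integral>z. F y z \<partial>D)"
    and "convex_on UNIV f"
    and "L0 > 0" and "L0-lipschitz_on UNIV f"
    and "\<And>y. f xstar \<le> f y"
    and "L > 0" and "\<And>z. z \<in> space D \<Longrightarrow> smooth L (\<lambda>y. F y z)"
    and "\<sigma>0 > 0"
    and "\<And>y. integrable D (\<lambda>z. (F y z - f y)\<^sup>2)"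
    and "\<And>y. (\<integral>z. (F y z - f y)\<^sup>2 \<partial>D) \<le> \<sigma>0\<^sup>2"
    and "\<sigma>1 > 0"
    and "\<And>y. integrable D (\<lambda>z. (norm (gradient (\<lambda>v. F v z) y - gradient f y))\<^sup>2)"
    and "\<And>y. (\<integral>z. (norm (gradient (\<lambda>v. F v z) y - gradient f y))\<^sup>2 \<partial>D) \<le> \<sigma>1\<^sup>2"
    and "prob_space M"
    and "prob_space.indep_vars M (\<lambda>_. borel) u {..T}"
    and "\<And>t. t \<le> T \<Longrightarrow> distr M borel (u t) = uniform_sphere"
    and "prob_space.indep_vars M (\<lambda>_. D) \<xi> {..T}"
    and "\<And>t. t \<le> T \<Longrightarrow> distr M D (\<xi> t) = D"
    and "indep_rv M
           (Pi\<^sub>M {..T} (\<lambda>_. borel)) (\<lambda>\<omega>. \<lambda>t\<in>{..T}. u t \<omega>)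
           (Pi\<^sub>M {..T} (\<lambda>_. D)) (\<lambda>\<omega>. \<lambda>t\<in>{..T}. \<xi> t \<omega>)"
    and "real T \<ge> Max {20 powr (3/2) * L * (norm (x1 - xstar))\<^sup>2 / (\<sigma>0 * real DIM('a) ^ 4),
                       L0\<^sup>2 * (norm (x1 - xstar))\<^sup>2 / \<sigma>0\<^sup>2,
                       2 powr (7/2) * L * real DIM('a) powr (1/2) * (norm (x1 - xstar))\<^sup>2 / \<sigma>0,
                       L0\<^sup>2 / (4 * \<sigma>1\<^sup>2)}"
    and "\<alpha> > 0"
    and "\<alpha> = 4 * (real DIM('a) * norm (x1 - xstar) * \<sigma>0 / L) powr (1/3) * (1 / real T powr (1/6))"
    and "\<eta> > 0"
    and "\<eta> = \<alpha> * norm (x1 - xstar) / (8 * sqrt (real T) * real DIM('a) * \<sigma>0)"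
    and "\<epsilon> > 0"
    and "real T \<ge> Max {12 ^ 3 * L * (real DIM('a))\<^sup>2 * (norm (x1 - xstar))\<^sup>2 * \<sigma>0\<^sup>2 / \<epsilon> ^ 3,
                       2 powr (21/2) * real DIM('a) powr (1/2) * (norm (x1 - xstar))\<^sup>2 * \<sigma>1 ^ 3
                         / (L powr (1/2) * \<sigma>0 * \<epsilon> powr (3/2))}"
  shows "(\<forall>t\<in>{1..T}. integrable M (\<lambda>\<omega>. f (x t \<omega>) - f xstar)) \<and>
         1 / real T * (\<Sum>t=1..T. \<integral>\<omega>. (f (x t \<omega>) - f xstar) \<partial>M) \<le> \<epsilon>"
proof -
  define R where "R = norm (x1 - xstar)"
  define d where "d = real DIM('a)"
  define gf where "gf y = (\<integral>z. gradient (\<lambda>v. F v z) y \<partial>D)" for y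
  have Fint: "\<And>y. integrable D (F y)" by fact
  have Fmean: "\<And>y. f y = (\<integral>z. F y z \<partial>D)" by fact
  have Fsmooth: "smooth L (\<lambda>y. F y z)" if "z \<in> space D" for z using that by fact
  note gom = gradient_of_mean[OF \<open>prob_space D\<close> Fint Fmean Fsmooth, folded gf_def]
  have Fcont: "continuous_on UNIV (\<lambda>y. F y z)" if "z \<in> space D" for z
    using Fsmooth[OF that]
    by (intro differentiable_imp_continuous_on) (auto simp: smooth_def differentiable_on_def differentiable_at_withinI)
  have Tmax: "Max {20 powr (3/2) * L * (norm (x1 - xstar))\<^sup>2 / (\<sigma>0 * real DIM('a) ^ 4),
                       L0\<^sup>2 * (norm (x1 - xstar))\<^sup>2 / \<sigma>0\<^sup>2,
                       2 powr (7/2) * L * real DIM('a) powr (1/2) * (norm (x1 - xstar))\<^sup>2 / \<sigma>0,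
                       L0\<^sup>2 / (4 * \<sigma>1\<^sup>2)} \<le> real T" by fact
  have Tmax': "Max {12 ^ 3 * L * (real DIM('a))\<^sup>2 * (norm (x1 - xstar))\<^sup>2 * \<sigma>0\<^sup>2 / \<epsilon> ^ 3,
                       2 powr (21/2) * real DIM('a) powr (1/2) * (norm (x1 - xstar))\<^sup>2 * \<sigma>1 ^ 3
                         / (L powr (1/2) * \<sigma>0 * \<epsilon> powr (3/2))} \<le> real T" by fact
  have T1: "L0\<^sup>2 * R\<^sup>2 / \<sigma>0\<^sup>2 \<le> T" and T2: "2 powr (7/2) * L * d powr (1/2) * R\<^sup>2 / \<sigma>0 \<le> T"
    and T4: "L0\<^sup>2 / (4 * \<sigma>1\<^sup>2) \<le> T" and T3: "12 ^ 3 * L * d\<^sup>2 * R\<^sup>2 * \<sigma>0\<^sup>2 / \<epsilon> ^ 3 \<le> T"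
    using Tmax Tmax' by (simp_all add: R_def d_def)
  have "0 < L0\<^sup>2 / (4 * \<sigma>1\<^sup>2)" using \<open>L0 > 0\<close> \<open>\<sigma>1 > 0\<close> by simp
  then have Tpos: "0 < real T" using T4 by linarith
  then have T: "1 \<le> T" by simp
  have \<eta>: "\<eta> = \<alpha> * R / (8 * sqrt (real T) * d * \<sigma>0)" unfolding R_def d_def by fact
  have \<alpha>: "\<alpha> = 4 * (d * R * \<sigma>0 / L) powr (1/3) * (1 / real T powr (1/6))" unfolding R_def d_def by fact
  have "R \<noteq> 0" using \<eta> \<open>\<eta> > 0\<close> by auto
  then have R: "0 < R" by (simp add: R_def)
  have d: "0 < d" by (simp add: d_def)
  note calc = step_size_calculus[OF R \<open>L > 0\<close> \<open>L0 > 0\<close> \<open>\<sigma>0 > 0\<close> \<open>\<epsilon> > 0\<close> d Tpos \<open>\<alpha> > 0\<close> \<alpha> \<eta> T1 T2 T3]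
  interpret M: prob_space M by fact
  interpret rf: residual_feedback f gf L L0 M u D \<xi> T F x1 xstar \<sigma>0 \<alpha> \<eta>
  proof (rule residual_feedback.intro)
    show "smooth_convex f gf L L0"
      by (rule smooth_convex.intro[OF gom]) (assumption | fact)+
    show "two_samples M borel u D \<xi> T"
      by (intro two_samples.intro two_samples_axioms.intro) fact+
    show "residual_feedback_axioms f M u D \<xi> T F xstar \<sigma>0 \<alpha> \<eta>"
    proof (rule residual_feedback_axioms.intro)
      show "(\<lambda>p. F (fst p) (snd p)) \<in> borel_measurable (borel \<Otimes>\<^sub>M D)"
        by (rule caratheodory_measurable[OF borel_measurable_integrable[OF Fint]]) (rule Fcont)
    qed fact+
  qed
  have xeq: "x t \<omega> = rf.x t \<omega>" for t \<omega> unfolding x_def rf.x_def ..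
  show ?thesis
  proof (intro conjI ballI)
    fix t assume "t \<in> {1..T}"
    then show "integrable M (\<lambda>\<omega>. f (x t \<omega>) - f xstar)"
      unfolding xeq by (intro rf.gap_integrable) auto
  next
    have "(\<Sum>t=1..T. \<integral>\<omega>. f (x t \<omega>) - f xstar \<partial>M)
        \<le> R\<^sup>2 / (2 * \<eta>) + T * (48 / 31 * (\<eta> * (d / \<alpha>)\<^sup>2 * \<sigma>0\<^sup>2) + (1 / 2 + 5 / 31) * (L * \<alpha>\<^sup>2))"
      unfolding xeq R_def d_def by (rule rf.regret_bound[OF T calc(3,4)[unfolded d_def]])
    \<comment> \<open>Initial distance, noise, and smoothing bias with the nonlinear part of the variances; the sum is about \<open>0.727\<close>.\<close>
    also have "\<dots> = T * ((1 / 16 + 48 / 31 / 512 + (1 / 2 + 5 / 31)) * (L * \<alpha>\<^sup>2))"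
      unfolding calc(1,2) by (simp add: algebra_simps)
    also have "\<dots> \<le> T * (3 / 4 * (L * \<alpha>\<^sup>2))"
      using \<open>L > 0\<close> by (intro mult_left_mono mult_right_mono) auto
    also have "\<dots> \<le> T * \<epsilon>" using calc(5) by (intro mult_left_mono) auto
    finally show "1 / real T * (\<Sum>t=1..T. \<integral>\<omega>. f (x t \<omega>) - f xstar \<partial>M) \<le> \<epsilon>"
      using Tpos by (simp add: divide_le_eq mult.commute)
  qed
qed

end
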